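(* Let $h\in L^1(0,1)$ and suppose there exist $z\in(0,1)$, $\delta_1>0$ and $\delta_2>0$, with $(z-\delta_1,z+\delta_2)\subseteq(0,1)$, such that $h(x)\ge0$ a.e. in $(z-\delta_1,z)$ and $h(x)\le0$ a.e. in $(z,z+\delta_2)$. Let $u\in BV(0,1)$ be a bounded variation solution of $$-\left(\frac{u'}{\sqrt{1+(u')^2}}\right)'=h(x),\quad 0<x<1.$$ Then: (a) $u\in W^{2,1}_{\mathrm{loc}}(z-\delta_1,z+\delta_2)$ if $$\text{either}\quad\int_{z-\delta_1}^z\left(\int_x^zh(t)\,dt\right)^{-\frac12}dx=\infty,\quad\text{or}\quad\int_z^{z+\delta_2}\left(\int_x^zh(t)\,dt\right)^{-\frac12}dx=\infty,$$ where this condition is understood to be satisfied whenever $\int_{x_0}^zh(t)\,dt=0$ for some $x_0\in(z-\delta_1,z+\delta_2)\setminus\{z\}$; (b) $u(z^-)>u(z^+)$ if $\int_x^zh(t)\,dt>0$ for all $x\in(z-\delta_1,z+\delta_2)\setminus\{z\}$ and there are $x_1\in(z-\delta_1,z)$, $x_2\in(z,z+\delta_2)$ such that $$\int_{x_1}^z\left(\int_x^zh(t)\,dt\right)^{-\frac12}dx<\infty,\qquad\int_z^{x_2}\left(\int_x^zh(t)\,dt\right)^{-\frac12}dx<\infty,$$ $$\int_{x_1}^{x_2}\left(\int_x^zh(t)\,dt\right)^{-\frac12}dx\le u(x_1)-u(x_2).$$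
   Context: A bounded variation solution of $-\left(u'/\sqrt{1+(u')^2}\right)'=h(x)$ in $(0,1)$ is a function $u\in BV(0,1)$ such that $$\int_0^1 \frac{Du^a\,D\phi^a}{\sqrt{1+(Du^a)^2}}\,dx+\int_0^1\frac{Du^s}{|Du^s|}\,D\phi^s=\int_0^1h\phi\,dx$$ for every $\phi\in BV(0,1)$ with essential support in $(0,1)$ and such that $|D\phi^s|$ is absolutely continuous with respect to $|Du^s|$. Here, for $v\in BV(0,1)$, $Dv=Dv^a\,dx+Dv^s$ is the Lebesgue decomposition of the measure $Dv$ (with $Dv^a$ the density of the absolutely continuous part and $Dv^s$ the singular part), and $\frac{Dv^s}{|Dv^s|}$ is the density of $Dv^s$ with respect to its total variation $|Dv^s|$. Under the sign condition on $h$, such a $u$ is (has a representative which is) concave in $(z-\delta_1,z)$ and convex in $(z,z+\delta_2)$, with restrictions in $W^{2,1}_{\mathrm{loc}}\cap W^{1,1}$ of each of these two intervals; pointwise values of $u$ on these intervals refer to this continuous representative, and $u(z^\pm)$ denote the one-sided limits at $z$. *)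

theory Defs
  imports "HOL-Analysis.Analysis"
begin

subsection \<open>Finite signed measures\<close>

text \<open>
  A finite signed measure on the measurable space underlying \<open>M\<close> is a real-valued set function on
  \<open>sets M\<close>; the measure of \<open>M\<close> itself plays no role. The series in the definition converges
  absolutely, because the same condition holds for every rearrangement of the sequence \<open>A\<close>.
\<close>

definition signed_measure :: "'a measure \<Rightarrow> ('a set \<Rightarrow> real) \<Rightarrow> bool" where
  "signed_measure M \<mu> \<longleftrightarrow> \<mu> {} = 0 \<and>
     (\<forall>A :: nat \<Rightarrow> 'a set. range A \<subseteq> sets M \<longrightarrow> disjoint_family A \<longrightarrow>
        (\<lambda>i. \<mu> (A i)) sums \<mu> (\<Union>i. A i))"

text \<open>
  Jordan decomposition \<open>\<mu> = \<mu>\<^sup>+ - \<mu>\<^sup>-\<close> and total variation \<open>\<bar>\<mu>\<bar> = \<mu>\<^sup>+ + \<mu>\<^sup>-\<close>, where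
  \<open>\<mu>\<^sup>+ A\<close> is the supremum of \<open>\<mu> B\<close> over measurable \<open>B \<subseteq> A\<close>. Negative values are truncated to
  \<open>0\<close> by \<open>ennreal\<close>, which does not change the supremum since \<open>B = {}\<close> is allowed.
\<close>

definition pos_variation :: "'a measure \<Rightarrow> ('a set \<Rightarrow> real) \<Rightarrow> 'a measure" where
  "pos_variation M \<mu> =
     measure_of (space M) (sets M) (\<lambda>A. SUP B \<in> {B \<in> sets M. B \<subseteq> A}. ennreal (\<mu> B))"

definition neg_variation :: "'a measure \<Rightarrow> ('a set \<Rightarrow> real) \<Rightarrow> 'a measure" where
  "neg_variation M \<mu> = pos_variation M (\<lambda>A. - \<mu> A)"

definition total_variation :: "'a measure \<Rightarrow> ('a set \<Rightarrow> real) \<Rightarrow> 'a measure" where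
  "total_variation M \<mu> =
     measure_of (space M) (sets M)
       (\<lambda>A. emeasure (pos_variation M \<mu>) A + emeasure (neg_variation M \<mu>) A)"

definition signed_integral :: "'a measure \<Rightarrow> ('a set \<Rightarrow> real) \<Rightarrow> ('a \<Rightarrow> real) \<Rightarrow> real" where
  "signed_integral M \<mu> f =
     (LINT x|pos_variation M \<mu>. f x) - (LINT x|neg_variation M \<mu>. f x)"

definition is_signed_density :: "'a measure \<Rightarrow> ('a set \<Rightarrow> real) \<Rightarrow> ('a \<Rightarrow> real) \<Rightarrow> bool" where
  "is_signed_density N \<mu> f \<longleftrightarrow>
     integrable N f \<and> (\<forall>A\<in>sets N. \<mu> A = (LINT x:A|N. f x))"

definition mutually_singular :: "'a measure \<Rightarrow> 'a measure \<Rightarrow> bool" where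
  "mutually_singular M N \<longleftrightarrow>
     (\<exists>Z\<in>sets M. emeasure M Z = 0 \<and> emeasure N (space M - Z) = 0)"

abbreviation borel_on :: "real set \<Rightarrow> real measure" where
  "borel_on \<Omega> \<equiv> restrict_space borel \<Omega>"

text \<open>\<open>\<mu> = g dx + \<mu>\<^sub>s\<close> on \<open>\<Omega>\<close>, with \<open>\<mu>\<^sub>s\<close> singular with respect to Lebesgue measure.\<close>

definition lebesgue_decomposition ::
    "real set \<Rightarrow> (real set \<Rightarrow> real) \<Rightarrow> (real \<Rightarrow> real) \<Rightarrow> (real set \<Rightarrow> real) \<Rightarrow> bool" where
  "lebesgue_decomposition \<Omega> \<mu> g \<mu>s \<longleftrightarrow>
     g absolutely_integrable_on \<Omega> \<and>
     signed_measure (borel_on \<Omega>) \<mu>s \<and>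
     mutually_singular (restrict_space lborel \<Omega>) (total_variation (borel_on \<Omega>) \<mu>s) \<and>
     (\<forall>A\<in>sets (borel_on \<Omega>). \<mu> A = (LINT x:A|lebesgue. g x) + \<mu>s A)"


subsection \<open>Functions of bounded variation and Sobolev functions\<close>

text \<open>
  Elements of \<open>L\<^sup>1\<close>, \<open>BV\<close> and the Sobolev spaces are given by Lebesgue measurable representatives;
  all predicates below are invariant under changes on Lebesgue null sets, and only depend on the
  values in \<open>\<Omega>\<close>, an open set.
\<close>

definition C1_compact_support :: "real set \<Rightarrow> (real \<Rightarrow> real) set" where
  "C1_compact_support \<Omega> = {\<psi>. \<psi> C1_differentiable_on UNIV \<and>
     compact (closure {x. \<psi> x \<noteq> 0}) \<and> closure {x. \<psi> x \<noteq> 0} \<subseteq> \<Omega>}"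

definition is_derivative_measure :: "real set \<Rightarrow> (real \<Rightarrow> real) \<Rightarrow> (real set \<Rightarrow> real) \<Rightarrow> bool" where
  "is_derivative_measure \<Omega> v \<mu> \<longleftrightarrow> signed_measure (borel_on \<Omega>) \<mu> \<and>
     (\<forall>\<psi>\<in>C1_compact_support \<Omega>.
        (LINT x:\<Omega>|lebesgue. v x * deriv \<psi> x) = - signed_integral (borel_on \<Omega>) \<mu> \<psi>)"

definition BV :: "real set \<Rightarrow> (real \<Rightarrow> real) set" where
  "BV \<Omega> = {v. v absolutely_integrable_on \<Omega> \<and> (\<exists>\<mu>. is_derivative_measure \<Omega> v \<mu>)}"

definition L1_loc :: "real set \<Rightarrow> (real \<Rightarrow> real) set" where
  "L1_loc \<Omega> = {f. \<forall>K. compact K \<and> K \<subseteq> \<Omega> \<longrightarrow> f absolutely_integrable_on K}"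

definition weak_derivative :: "real set \<Rightarrow> (real \<Rightarrow> real) \<Rightarrow> (real \<Rightarrow> real) \<Rightarrow> bool" where
  "weak_derivative \<Omega> f g \<longleftrightarrow> f \<in> L1_loc \<Omega> \<and> g \<in> L1_loc \<Omega> \<and>
     (\<forall>\<psi>\<in>C1_compact_support \<Omega>.
        (LINT x:\<Omega>|lebesgue. f x * deriv \<psi> x) = - (LINT x:\<Omega>|lebesgue. g x * \<psi> x))"

definition W21_loc :: "real set \<Rightarrow> (real \<Rightarrow> real) set" where
  "W21_loc \<Omega> = {f. \<exists>f' f''. weak_derivative \<Omega> f f' \<and> weak_derivative \<Omega> f' f''}"

text \<open>
  The complement of the largest open subset of the real line on which \<open>v\<close>, extended by \<open>0\<close> outside
  \<open>\<Omega>\<close>, vanishes almost everywhere. The closure is taken in the real line, so that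
  \<open>ess_support \<Omega> v \<subseteq> \<Omega>\<close> forces \<open>v\<close> to vanish near the boundary of \<open>\<Omega>\<close>.
\<close>

definition ess_support :: "real set \<Rightarrow> (real \<Rightarrow> real) \<Rightarrow> real set" where
  "ess_support \<Omega> v =
     - \<Union>{U. open U \<and> (AE x in lebesgue. x \<in> U \<inter> \<Omega> \<longrightarrow> v x = 0)}"


subsection \<open>Bounded variation solutions\<close>

text \<open>
  The objects \<open>Du\<close>, \<open>Du\<^sup>a\<close>, \<open>Du\<^sup>s\<close> and \<open>\<sigma> = Du\<^sup>s / \<bar>Du\<^sup>s\<bar>\<close> are determined by \<open>u\<close>: the measures
  uniquely on Borel subsets of \<open>(0,1)\<close>, the two densities up to null sets. The function \<open>\<sigma>\<close> is
  relevant only up to \<open>\<bar>D\<phi>\<^sup>s\<bar>\<close>-null sets, so the absolute continuity of \<open>\<bar>D\<phi>\<^sup>s\<bar>\<close> makes the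
  second integral independent of the choice of \<open>\<sigma>\<close>.
\<close>

definition bv_solution :: "(real \<Rightarrow> real) \<Rightarrow> (real \<Rightarrow> real) \<Rightarrow> bool" where
  "bv_solution h u \<longleftrightarrow> u \<in> BV {0<..<1} \<and>
     (\<exists>Du Dua Dus \<sigma>.
        is_derivative_measure {0<..<1} u Du \<and>
        lebesgue_decomposition {0<..<1} Du Dua Dus \<and>
        is_signed_density (total_variation (borel_on {0<..<1}) Dus) Dus \<sigma> \<and>
        (\<forall>\<phi> D\<phi> D\<phi>a D\<phi>s.
           \<phi> \<in> BV {0<..<1} \<and>
           ess_support {0<..<1} \<phi> \<subseteq> {0<..<1} \<and>
           is_derivative_measure {0<..<1} \<phi> D\<phi> \<and>
           lebesgue_decomposition {0<..<1} D\<phi> D\<phi>a D\<phi>s \<and>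
           absolutely_continuous
             (total_variation (borel_on {0<..<1}) Dus)
             (total_variation (borel_on {0<..<1}) D\<phi>s) \<longrightarrow>
           (LINT x:{0<..<1}|lebesgue. Dua x * D\<phi>a x / sqrt (1 + (Dua x)\<^sup>2))
             + signed_integral (borel_on {0<..<1}) D\<phi>s \<sigma>
           = (LINT x:{0<..<1}|lebesgue. h x * \<phi> x)))"

text \<open>The oriented integral of \<open>h\<close> from \<open>x\<close> to \<open>z\<close>, with reversed sign if \<open>z < x\<close>. Its
  power \<open>-1/2\<close> is written with \<open>powr\<close>, where \<open>0 powr (-1/2) = 0\<close>; vanishing of this integral at
  a point other than \<open>z\<close> must therefore be treated as a separate case.\<close>

definition integral_to :: "(real \<Rightarrow> real) \<Rightarrow> real \<Rightarrow> real \<Rightarrow> real" where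
  "integral_to h z x = (LINT t=ereal x..ereal z|lebesgue. h t)"

text \<open>
  A representative of \<open>u\<close> that is continuous on \<open>(a,z)\<close> and on \<open>(z,b)\<close>; its values on these two
  intervals are determined by \<open>u\<close>.
\<close>

definition continuous_representative ::
    "(real \<Rightarrow> real) \<Rightarrow> real \<Rightarrow> real \<Rightarrow> real \<Rightarrow> (real \<Rightarrow> real) \<Rightarrow> bool" where
  "continuous_representative u a z b w \<longleftrightarrow>
     (AE x in lebesgue. x \<in> {0<..<1} \<longrightarrow> w x = u x) \<and>
     continuous_on {a<..<z} w \<and> continuous_on {z<..<b} w"

end

theory Submission
  imports Defs
begin

text \<open>
  Formally the equation says that the flux \<open>P = u' / sqrt (1 + u'\<^sup>2)\<close> has derivative \<open>- h\<close>. Testing with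
  \<open>C\<^sup>1\<close> functions shows that this holds for the absolutely continuous part of \<open>Du\<close>: almost everywhere
  \<open>Du\<^sup>a / sqrt (1 + (Du\<^sup>a)\<^sup>2)\<close> equals \<open>P = c - H\<close>, where \<open>H\<close> is a primitive of \<open>h\<close>. So \<open>P\<close> is continuous,
  \<open>\<bar>P\<bar> < 1\<close> almost everywhere, and \<open>Du\<^sup>a = P / sqrt (1 - P\<^sup>2)\<close> (\<open>inverse_flux\<close>).

  The singular part is tested with functions whose derivative is \<open>\<bar>Du\<^sup>s\<bar>\<close> restricted to a set \<open>B\<close>, balanced by
  a constant density on an interval containing \<open>B\<close> so that the function vanishes near the end points. This gives
  \<open>Du\<^sup>s = P \<bar>Du\<^sup>s\<bar>\<close> (\<open>bv_solution_flux\<close>). Hence \<open>\<bar>Du\<^sup>s\<bar>\<close> has no mass where \<open>\<bar>P\<bar> < 1\<close>, because there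
  \<open>\<bar>Du\<^sup>s\<bar>(B) \<le> \<integral>\<^sub>B \<bar>P\<bar> d\<bar>Du\<^sup>s\<bar>\<close>.

  Under the sign condition \<open>P\<close> decreases up to \<open>z\<close> and increases afterwards. If \<open>\<bar>P\<bar>\<close> were \<open>1\<close> at a point
  other than \<open>z\<close>, monotonicity would force \<open>\<bar>P\<bar> \<ge> 1\<close> on an interval next to it, contradicting
  \<open>\<bar>P\<bar> < 1\<close> almost everywhere. So \<open>\<bar>P\<bar> < 1\<close> away from \<open>z\<close>, and the only possible singularity of \<open>u\<close> is a
  jump at \<open>z\<close>. As \<open>z\<close> is the minimum point of \<open>P\<close>, a jump requires \<open>P z = - 1\<close>, and it is then downward. The
  integral of \<open>h\<close> from \<open>x\<close> to \<open>z\<close> is \<open>P x - P z\<close>.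

  (a) If \<open>P z = - 1\<close>, that integral is \<open>1 + P x > 0\<close> for \<open>x \<noteq> z\<close>, and \<open>(1 + P) powr (- 1/2)\<close> is bounded by
  \<open>3 \<bar>u'\<bar> + 3\<close> (\<open>inverse_sqrt_le_gradient\<close>), which is integrable; each of the three alternatives in the hypothesis
  fails. Otherwise \<open>\<bar>P\<bar> < 1\<close> on the whole interval, there is no jump, and the chain rule turns
  \<open>u' = P / sqrt (1 - P\<^sup>2)\<close> into a locally integrable second derivative.

  (b) Without a jump, \<open>u x\<^sub>1 - u x\<^sub>2\<close> is the integral of \<open>- u'\<close> over \<open>(x\<^sub>1, x\<^sub>2)\<close>. As \<open>P z \<ge> - 1\<close>, pointwise
  \<open>- u' < (P x - P z) powr (- 1/2)\<close> (\<open>neg_gradient_less\<close>), so the last inequality of the hypothesis is violated.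
\<close>

section \<open>Signed measures given by a density\<close>

lemma set_integrable_of_integrable:
  fixes f :: "'a \<Rightarrow> real"
  shows "integrable M f \<Longrightarrow> A \<in> sets M \<Longrightarrow> set_integrable M A f"
  unfolding set_integrable_def by (rule integrable_mult_indicator)

text \<open>
  The supremum is attained on the part of \<open>A\<close> where \<open>f > 0\<close>. So the Jordan decomposition of a signed measure with
  density \<open>f\<close> is the decomposition of \<open>f\<close> into its positive and negative part.
\<close>

lemma emeasure_density_positive_part_eq_SUP:
  fixes f :: "'a \<Rightarrow> real"
  assumes f: "integrable K f" and A: "A \<in> sets K"
  shows "(SUP B\<in>{B\<in>sets K. B \<subseteq> A}. ennreal (LINT x:B|K. f x)) = emeasure (density K (\<lambda>x. ennreal (f x))) A"
    (is "?S = ?D")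
proof (rule antisym)
  have [measurable]: "f \<in> borel_measurable K" using f by simp
  have pos: "integrable K (\<lambda>x. max 0 (f x))" by (rule integrable_max) (use f in auto)
  show "?S \<le> ?D"
  proof (rule SUP_least, clarsimp)
    fix B assume B: "B \<in> sets K" "B \<subseteq> A"
    have "ennreal (LINT x:B|K. f x) \<le> ennreal (LINT x:B|K. max 0 (f x))"
      by (intro ennreal_leI set_integral_mono)
         (auto intro!: set_integrable_of_integrable f pos B)
    also have "\<dots> = (\<integral>\<^sup>+x\<in>B. ennreal (max 0 (f x)) \<partial>K)"
      unfolding set_lebesgue_integral_def
      by (subst nn_integral_eq_integral[symmetric])
         (use integrable_mult_indicator[OF B(1) pos] in
           \<open>auto simp: indicator_def intro!: nn_integral_cong\<close>)
    also have "\<dots> = (\<integral>\<^sup>+x\<in>B. ennreal (f x) \<partial>K)"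
      by (simp add: max_def ennreal_neg cong: if_cong)
         (auto intro!: nn_integral_cong simp: ennreal_neg)
    also have "\<dots> = emeasure (density K (\<lambda>x. ennreal (f x))) B"
      using B by (simp add: emeasure_density)
    also have "\<dots> \<le> ?D" by (rule emeasure_mono) (use B A in auto)
    finally show "ennreal (LINT x:B|K. f x) \<le> ?D" .
  qed
  \<comment> \<open>the maximising set\<close>
  let ?B = "A \<inter> {x\<in>space K. f x > 0}"
  have Bs: "?B \<in> sets K" using A by measurable
  have "?D = (\<integral>\<^sup>+x\<in>A. ennreal (f x) \<partial>K)" using A by (simp add: emeasure_density)
  also have "\<dots> = (\<integral>\<^sup>+x. ennreal (indicator ?B x * f x) \<partial>K)"
    by (intro nn_integral_cong) (auto simp: indicator_def ennreal_neg)
  also have "\<dots> = ennreal (LINT x:?B|K. f x)"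
    unfolding set_lebesgue_integral_def real_scaleR_def
    by (rule nn_integral_eq_integral)
       (use integrable_mult_indicator[OF Bs f] in \<open>auto simp: indicator_def\<close>)
  also have "\<dots> \<le> ?S" by (rule SUP_upper) (use Bs in auto)
  finally show "?D \<le> ?S" .
qed

context
  fixes M K :: "'a measure" and \<mu> :: "'a set \<Rightarrow> real" and f :: "'a \<Rightarrow> real"
  assumes sets_eq: "sets K = sets M" and f: "integrable K f"
    and \<mu>: "\<And>A. A \<in> sets M \<Longrightarrow> \<mu> A = (LINT x:A|K. f x)"
begin

lemma signed_measure_density: "signed_measure M \<mu>"
  unfolding signed_measure_def
proof (intro conjI allI impI)
  show "\<mu> {} = 0" by (simp add: \<mu> set_lebesgue_integral_def)
  fix A :: "nat \<Rightarrow> 'a set" assume A: "range A \<subseteq> sets M" "disjoint_family A"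
  have meas: "A i \<in> sets K" for i using A sets_eq by auto
  have "(\<Union>i. A i) \<in> sets K" using meas by auto
  then have int: "set_integrable K (\<Union>i. A i) f" "set_integrable K (A i) f" for i
    using f meas by (auto intro: set_integrable_of_integrable)
  have "(\<lambda>n. LINT x:(\<Union>i<n. A i)|K. f x) \<longlonglongrightarrow> (LINT x:(\<Union>n. \<Union>i<n. A i)|K. f x)"
  proof (rule set_integral_cont_up)
    show "(\<Union>i<n. A i) \<in> sets K" for n using meas by auto
    show "incseq (\<lambda>n. \<Union>i<n. A i)" by (force simp: incseq_def)
    show "set_integrable K (\<Union>n. \<Union>i<n. A i) f"
      unfolding set_integrable_def using meas by (intro integrable_mult_indicator f) auto
  qed
  also have "(\<Union>n. \<Union>i<n. A i) = (\<Union>i. A i)" by blast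
  also have "(\<lambda>n. LINT x:(\<Union>i<n. A i)|K. f x) = (\<lambda>n. \<Sum>i<n. LINT x:A i|K. f x)"
    using A meas int by (intro ext set_integral_finite_Union) (auto simp: disjoint_family_on_def)
  finally have "(\<lambda>i. LINT x:A i|K. f x) sums (LINT x:(\<Union>i. A i)|K. f x)"
    by (simp add: sums_def)
  then show "(\<lambda>i. \<mu> (A i)) sums \<mu> (\<Union>i. A i)"
    using \<mu> meas sets_eq by (simp add: sets.countable_UN)
qed

lemma pos_variation_density: "pos_variation M \<mu> = density K (\<lambda>x. ennreal (f x))"
proof -
  have sp: "space K = space M" using sets_eq by (rule sets_eq_imp_space_eq)
  have "pos_variation M \<mu> = measure_of (space K) (sets K) (emeasure (density K (\<lambda>x. ennreal (f x))))"
    unfolding pos_variation_def sp sets_eq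
  proof (rule measure_of_eq)
    show "sets M \<subseteq> Pow (space M)" by (rule sets.space_closed)
    fix A assume "A \<in> sigma_sets (space M) (sets M)"
    then have A: "A \<in> sets K" by (simp add: sets.sigma_sets_eq sets_eq)
    show "(SUP B\<in>{B \<in> sets M. B \<subseteq> A}. ennreal (\<mu> B)) = emeasure (density K (\<lambda>x. ennreal (f x))) A"
      unfolding emeasure_density_positive_part_eq_SUP[OF f A, symmetric]
      by (intro SUP_cong) (auto simp: \<mu> sets_eq)
  qed
  also have "\<dots> = density K (\<lambda>x. ennreal (f x))"
    using measure_of_of_measure[of "density K (\<lambda>x. ennreal (f x))"] by simp
  finally show ?thesis .
qed

end

lemma neg_variation_density:
  assumes "sets K = sets M" "integrable K f" "\<And>A. A \<in> sets M \<Longrightarrow> \<mu> A = (LINT x:A|K. f x)"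
  shows "neg_variation M \<mu> = density K (\<lambda>x. ennreal (- f x))"
  unfolding neg_variation_def
  by (rule pos_variation_density) (use assms in \<open>auto simp: set_lebesgue_integral_def\<close>)

lemma total_variation_density:
  assumes "sets K = sets M" "integrable K f" "\<And>A. A \<in> sets M \<Longrightarrow> \<mu> A = (LINT x:A|K. f x)"
  shows "total_variation M \<mu> = density K (\<lambda>x. ennreal \<bar>f x\<bar>)"
proof -
  have sp: "space K = space M" using assms(1) by (rule sets_eq_imp_space_eq)
  have [measurable]: "f \<in> borel_measurable K" using assms by simp
  have pos: "pos_variation M \<mu> = density K (\<lambda>x. ennreal (f x))"
    and neg: "neg_variation M \<mu> = density K (\<lambda>x. ennreal (- f x))"
    using assms by (intro pos_variation_density neg_variation_density; blast)+
  have "total_variation M \<mu> = measure_of (space K) (sets K) (emeasure (density K (\<lambda>x. ennreal \<bar>f x\<bar>)))"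
    unfolding total_variation_def sp assms(1)
      pos neg
  proof (rule measure_of_eq)
    show "sets M \<subseteq> Pow (space M)" by (rule sets.space_closed)
    fix A assume "A \<in> sigma_sets (space M) (sets M)"
    then have A: "A \<in> sets K" by (simp add: sets.sigma_sets_eq assms)
    then show "emeasure (density K (\<lambda>x. ennreal (f x))) A + emeasure (density K (\<lambda>x. ennreal (- f x))) A
        = emeasure (density K (\<lambda>x. ennreal \<bar>f x\<bar>)) A"
      by (simp add: emeasure_density nn_integral_add[symmetric])
         (auto intro!: nn_integral_cong simp: indicator_def abs_if ennreal_neg)
  qed
  also have "\<dots> = density K (\<lambda>x. ennreal \<bar>f x\<bar>)"
    using measure_of_of_measure[of "density K (\<lambda>x. ennreal \<bar>f x\<bar>)"] by simp
  finally show ?thesis .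
qed

lemma signed_integral_density:
  assumes "sets K = sets M" "integrable K f" "\<And>A. A \<in> sets M \<Longrightarrow> \<mu> A = (LINT x:A|K. f x)"
    and \<psi>: "\<psi> \<in> borel_measurable M" and int: "integrable K (\<lambda>x. f x * \<psi> x)"
  shows "signed_integral M \<mu> \<psi> = (LINT x|K. f x * \<psi> x)"
proof -
  have [measurable]: "f \<in> borel_measurable K" "\<psi> \<in> borel_measurable K"
    using assms measurable_cong_sets[OF assms(1) refl] by auto
  have e: "density K (\<lambda>x. ennreal (g x)) = density K (\<lambda>x. ennreal (max 0 (g x)))" for g :: "'a \<Rightarrow> real"
    by (rule arg_cong[where f="density K"]) (auto simp: max_def ennreal_neg)
  have i: "integrable K (\<lambda>x. max 0 (f x) * \<psi> x)" "integrable K (\<lambda>x. max 0 (- f x) * \<psi> x)"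
    by (rule Bochner_Integration.integrable_bound[OF int]; auto simp: abs_mult mult_right_mono)+
  have pos: "pos_variation M \<mu> = density K (\<lambda>x. ennreal (f x))"
    and neg: "neg_variation M \<mu> = density K (\<lambda>x. ennreal (- f x))"
    using assms by (intro pos_variation_density neg_variation_density; blast)+
  have "signed_integral M \<mu> \<psi> = (LINT x|K. max 0 (f x) * \<psi> x) - (LINT x|K. max 0 (- f x) * \<psi> x)"
    unfolding signed_integral_def pos neg e[of f] e[of "\<lambda>x. - f x"]
    by (simp add: integral_density)
  also have "\<dots> = (LINT x|K. max 0 (f x) * \<psi> x - max 0 (- f x) * \<psi> x)"
    using i by simp
  also have "\<dots> = (LINT x|K. f x * \<psi> x)"
    by (intro Bochner_Integration.integral_cong) (auto simp: max_def)
  finally show ?thesis .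
qed

text \<open>
  Needed to give \<open>Dv = a dx + Dv\<^sup>s\<close> a density with respect to a single measure, so that the lemmas above apply to it.
\<close>

definition add_measure :: "'a measure \<Rightarrow> 'a measure \<Rightarrow> 'a measure" where
  "add_measure L N = measure_of (space L) (sets L) (\<lambda>A. emeasure L A + emeasure N A)"

lemma sets_add_measure [simp, measurable_cong]: "sets (add_measure L N) = sets L"
  and space_add_measure [simp]: "space (add_measure L N) = space L"
  unfolding add_measure_def by auto

lemma emeasure_add_measure:
  assumes "sets N = sets L" "A \<in> sets L"
  shows "emeasure (add_measure L N) A = emeasure L A + emeasure N A"
  unfolding add_measure_def
proof (rule emeasure_measure_of_sigma)
  show "sigma_algebra (space L) (sets L)" by (rule sets.sigma_algebra_axioms)
  show "positive (sets L) (\<lambda>A. emeasure L A + emeasure N A)" by (simp add: positive_def)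
  show "countably_additive (sets L) (\<lambda>A. emeasure L A + emeasure N A)"
  proof (rule countably_additiveI)
    fix A :: "nat \<Rightarrow> _" assume A: "range A \<subseteq> sets L" "disjoint_family A"
    have "(\<Sum>i. emeasure L (A i) + emeasure N (A i)) = (\<Sum>i. emeasure L (A i)) + (\<Sum>i. emeasure N (A i))"
      by (rule suminf_add[symmetric]) auto
    also have "\<dots> = emeasure L (\<Union>i. A i) + emeasure N (\<Union>i. A i)"
      using A assms by (simp add: suminf_emeasure)
    finally show "(\<Sum>i. emeasure L (A i) + emeasure N (A i)) = emeasure L (\<Union>i. A i) + emeasure N (\<Union>i. A i)" .
  qed
qed (use assms in auto)

lemma nn_integral_add_measure:
  assumes s: "sets N = sets L" and f: "f \<in> borel_measurable L"
  shows "(\<integral>\<^sup>+x. f x \<partial>add_measure L N) = (\<integral>\<^sup>+x. f x \<partial>L) + (\<integral>\<^sup>+x. f x \<partial>N)"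
  using f
proof (induction f rule: borel_measurable_induct)
  case (cong f g)
  have "space N = space L" using s by (rule sets_eq_imp_space_eq)
  with cong show ?case
    by (metis (no_types, lifting) nn_integral_cong space_add_measure)
next
  case (set A)
  then show ?case using s by (simp add: emeasure_add_measure)
next
  case (mult u c)
  then have "u \<in> borel_measurable N" by (simp_all add: measurable_cong_sets[OF s refl])
  with mult show ?case by (simp add: nn_integral_cmult distrib_left)
next
  case (add u v)
  then have "u \<in> borel_measurable N" "v \<in> borel_measurable N" by (simp_all add: measurable_cong_sets[OF s refl])
  with add show ?case by (simp add: nn_integral_add ac_simps)
next
  case (seq U)
  then have U: "U i \<in> borel_measurable N" for i by (simp_all add: measurable_cong_sets[OF s refl])
  have inc: "incseq (\<lambda>i. \<integral>\<^sup>+x. U i x \<partial>M')" for M'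
    using seq(3) by (auto simp: incseq_def le_fun_def intro!: nn_integral_mono)
  have "(\<integral>\<^sup>+x. (SUP i. U i x) \<partial>add_measure L N) = (SUP i. \<integral>\<^sup>+x. U i x \<partial>L) + (SUP i. \<integral>\<^sup>+x. U i x \<partial>N)"
    using seq by (subst nn_integral_monotone_convergence_SUP) (auto simp: ennreal_SUP_add[OF inc inc])
  also have "\<dots> = (\<integral>\<^sup>+x. (SUP i. U i x) \<partial>L) + (\<integral>\<^sup>+x. (SUP i. U i x) \<partial>N)"
    using seq U by (simp add: nn_integral_monotone_convergence_SUP)
  finally show ?case by (simp add: image_comp)
qed

lemma
  fixes f :: "'a \<Rightarrow> real"
  assumes s: "sets N = sets L" and L: "integrable L f" and N: "integrable N f"
  shows integrable_add_measure: "integrable (add_measure L N) f"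
    and integral_add_measure: "(LINT x|add_measure L N. f x) = (LINT x|L. f x) + (LINT x|N. f x)"
proof -
  have [measurable]: "f \<in> borel_measurable L" using L by simp
  have nn: "(\<integral>\<^sup>+x. g x \<partial>add_measure L N) = (\<integral>\<^sup>+x. g x \<partial>L) + (\<integral>\<^sup>+x. g x \<partial>N)"
    if "g \<in> borel_measurable L" for g using nn_integral_add_measure[OF s that] .
  show i: "integrable (add_measure L N) f"
    using L N by (auto simp: integrable_iff_bounded nn)
  show "(LINT x|add_measure L N. f x) = (LINT x|L. f x) + (LINT x|N. f x)"
    unfolding real_lebesgue_integral_def[OF i] real_lebesgue_integral_def[OF L] real_lebesgue_integral_def[OF N]
    using L N by (simp add: nn enn2real_plus real_integrable_def less_top)
qed

section \<open>Primitives on the unit interval\<close>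

abbreviation unit_lborel :: "real measure" where
  "unit_lborel \<equiv> restrict_space lborel {0<..<1}"

lemma sets_unit_lborel: "sets unit_lborel = sets (borel_on {0<..<1})"
  by (simp add: sets_restrict_space)

lemma finite_measure_unit_lborel: "finite_measure unit_lborel"
  by (rule finite_measureI) (simp add: space_restrict_space emeasure_restrict_space)

lemma
  fixes w :: "real \<Rightarrow> real"
  assumes "w \<in> borel_measurable unit_lborel"
  shows lebesgue_eq_unit_lborel: "(LINT x:{0<..<1}|lebesgue. w x) = (LINT x|unit_lborel. w x)"
    and absolutely_integrable_iff_unit_lborel:
      "w absolutely_integrable_on {0<..<1} \<longleftrightarrow> integrable unit_lborel w"
proof -
  have m: "(\<lambda>x. indicator {0<..<1} x *\<^sub>R w x) \<in> borel_measurable lborel"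
    using assms by (subst (asm) borel_measurable_restrict_space_iff) auto
  show "(LINT x:{0<..<1}|lebesgue. w x) = (LINT x|unit_lborel. w x)"
    unfolding set_lebesgue_integral_def integral_completion[OF m]
    by (subst integral_restrict_space) auto
  show "w absolutely_integrable_on {0<..<1} \<longleftrightarrow> integrable unit_lborel w"
    unfolding set_integrable_def integrable_completion[OF m]
    by (subst integrable_restrict_space) auto
qed

lemma AE_unit_lborel_iff: "(AE x in unit_lborel. Q x) \<longleftrightarrow> (AE x in lborel. x \<in> {0<..<1} \<longrightarrow> Q x)"
  by (subst AE_restrict_space_iff) auto

lemma AE_lebesgue_unit: "(AE x in lebesgue. x \<in> {0<..<1} \<longrightarrow> Q x) \<longleftrightarrow> (AE x in unit_lborel. Q x)"
  unfolding AE_unit_lborel_iff by (rule AE_completion_iff)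

lemma
  fixes k :: "real \<Rightarrow> real"
  assumes k: "integrable unit_lborel k"
  shows unit_initial_integral: "0 < y \<Longrightarrow> y < 1 \<Longrightarrow> (LINT x:{..y}|unit_lborel. k x) = integral {0..y} (\<lambda>x. indicator {0<..<1} x * k x)"
    and unit_final_integral: "0 < y \<Longrightarrow> y < 1 \<Longrightarrow> (LINT x:{y..}|unit_lborel. k x) = integral {y..1} (\<lambda>x. indicator {0<..<1} x * k x)"
    and unit_total_integral: "(LINT x|unit_lborel. k x) = integral {0..1} (\<lambda>x. indicator {0<..<1} x * k x)"
    and unit_extension_integrable: "(\<lambda>x. indicator {0<..<1} x * k x) integrable_on {a..b}"
    and unit_extension_abs_integrable: "integrable lborel (\<lambda>x. indicator {0<..<1} x * k x)"
proof -
  show k0: "integrable lborel (\<lambda>x. indicator {0<..<1} x * k x)"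
    using k by (subst (asm) integrable_restrict_space) auto
  have si: "set_integrable lborel A (\<lambda>x. indicator {0<..<1} x * k x)" if "A \<in> sets borel" for A
    using that by (intro set_integrable_of_integrable k0) auto
  show "(\<lambda>x. indicator {0<..<1} x * k x) integrable_on {a..b}" for a b
    by (rule set_borel_integral_eq_integral(1)[OF si]) auto
  have *: "(LINT x:A|unit_lborel. k x) = (LINT x:B|lborel. indicator {0<..<1} x * k x)"
    if "\<And>x. x \<in> {0<..<1} \<Longrightarrow> x \<in> A \<longleftrightarrow> x \<in> B" for A B :: "real set"
    unfolding set_lebesgue_integral_def
    by (subst integral_restrict_space)
       (auto intro!: Bochner_Integration.integral_cong simp: indicator_def that)
  show "(LINT x:{..y}|unit_lborel. k x) = integral {0..y} (\<lambda>x. indicator {0<..<1} x * k x)"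
    if "0 < y" "y < 1"
    by (subst set_borel_integral_eq_integral(2)[symmetric, OF si]) (auto intro!: *)
  show "(LINT x:{y..}|unit_lborel. k x) = integral {y..1} (\<lambda>x. indicator {0<..<1} x * k x)"
    if "0 < y" "y < 1"
    by (subst set_borel_integral_eq_integral(2)[symmetric, OF si]) (auto intro!: *)
  have "(LINT x|unit_lborel. k x) = (LINT x:UNIV|unit_lborel. k x)" by (simp add: set_lebesgue_integral_def)
  also have "\<dots> = integral {0..1} (\<lambda>x. indicator {0<..<1} x * k x)"
    by (subst set_borel_integral_eq_integral(2)[symmetric, OF si]) (auto intro!: *)
  finally show "(LINT x|unit_lborel. k x) = integral {0..1} (\<lambda>x. indicator {0<..<1} x * k x)" .
qed

lemma borel_measurable_unit:
  fixes g :: "real \<Rightarrow> real"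
  assumes "sets K = sets (borel_on {0<..<1})" "g \<in> borel_measurable borel"
  shows "g \<in> borel_measurable K"
  using measurable_restrict_space1[OF assms(2)] by (simp add: measurable_cong_sets[OF assms(1) refl])

lemma borel_measurable_initial_integral:
  fixes f :: "real \<Rightarrow> real"
  assumes K: "finite_measure K" and s: "sets K = sets (borel_on {0<..<1})" and f: "integrable K f"
  shows "(\<lambda>x. LINT y:{..x}|K. f y) \<in> borel_measurable borel"
proof -
  interpret finite_measure K by (rule K)
  have [measurable]: "f \<in> borel_measurable K" using f by simp
  have [measurable]: "(\<lambda>x. x) \<in> measurable K borel"
    by (rule borel_measurable_unit[OF s]) simp
  show ?thesis
    unfolding set_lebesgue_integral_def indicator_def atMost_iff by measurable
qed

lemma abs_initial_integral_le:
  fixes f :: "real \<Rightarrow> real"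
  assumes s: "sets K = sets (borel_on {0<..<1})" and f: "integrable K f"
  shows "\<bar>LINT y:{..x}|K. f y\<bar> \<le> (LINT y|K. \<bar>f y\<bar>)"
proof -
  have i: "{..x} \<inter> space K \<in> sets K"
    unfolding s using sets_eq_imp_space_eq[OF s] by (auto simp: sets_restrict_space space_restrict_space)
  have "(LINT y:{..x}|K. f y) = (LINT y:{..x} \<inter> space K|K. f y)"
    unfolding set_lebesgue_integral_def by (intro Bochner_Integration.integral_cong) (auto simp: indicator_def)
  also have "\<bar>\<dots>\<bar> \<le> (LINT y:{..x} \<inter> space K|K. \<bar>f y\<bar>)"
    using set_integral_norm_bound[OF set_integrable_of_integrable[OF f i]] by simp
  also have "\<dots> \<le> (LINT y|K. \<bar>f y\<bar>)"
    unfolding set_lebesgue_integral_def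
    using f i by (intro integral_mono integrable_mult_indicator) (auto simp: indicator_def)
  finally show ?thesis .
qed

text \<open>
  Exchanging the integrations over the triangle \<open>y \<le> x\<close>. Every integration by parts below is an instance: with
  \<open>k = deriv \<psi>\<close> the inner integral is \<open>- \<psi> y\<close>, with \<open>k = h\<close> it is a primitive of \<open>h\<close> up to sign and a constant.
\<close>

lemma initial_integral_Fubini:
  fixes f k :: "real \<Rightarrow> real"
  assumes K: "finite_measure K" and s: "sets K = sets (borel_on {0<..<1})" and f: "integrable K f"
    and k: "integrable unit_lborel k"
  shows "(LINT x|unit_lborel. (LINT y:{..x}|K. f y) * k x) = (LINT y|K. f y * (LINT x:{y..}|unit_lborel. k x))"
proof -
  interpret K: finite_measure K by (rule K)
  interpret L: finite_measure unit_lborel by (rule finite_measure_unit_lborel)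
  interpret P: pair_sigma_finite K unit_lborel ..
  have [measurable]: "f \<in> borel_measurable K" "k \<in> borel_measurable unit_lborel" using f k by auto
  have [measurable]: "(\<lambda>x. x) \<in> measurable K borel" "(\<lambda>x. x) \<in> measurable unit_lborel borel"
    by (rule borel_measurable_unit; use s sets_unit_lborel in simp)+
  let ?g = "\<lambda>y x. (if y \<le> x then f y * k x else 0)"
  have "integrable (K \<Otimes>\<^sub>M unit_lborel) (\<lambda>(y, x). f y * k x)"
    by (rule P.Fubini_integrable) (use f k in \<open>auto simp: abs_mult\<close>)
  then have "integrable (K \<Otimes>\<^sub>M unit_lborel) (case_prod ?g)"
    by (rule Bochner_Integration.integrable_bound) auto
  from P.Fubini_integral[OF this]
  have "(LINT x|unit_lborel. LINT y|K. ?g y x) = (LINT y|K. LINT x|unit_lborel. ?g y x)" .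
  moreover have "(LINT y|K. ?g y x) = (LINT y:{..x}|K. f y) * k x" for x
  proof -
    have "(LINT y|K. ?g y x) = (LINT y|K. indicator {..x} y *\<^sub>R f y * k x)"
      by (intro Bochner_Integration.integral_cong) (auto simp: indicator_def)
    then show ?thesis by (simp add: set_lebesgue_integral_def)
  qed
  moreover have "(LINT x|unit_lborel. ?g y x) = f y * (LINT x:{y..}|unit_lborel. k x)" for y
  proof -
    have "(LINT x|unit_lborel. ?g y x) = (LINT x|unit_lborel. f y * indicator {y..} x *\<^sub>R k x)"
      by (intro Bochner_Integration.integral_cong) (auto simp: indicator_def)
    then show ?thesis by (simp add: set_lebesgue_integral_def mult.assoc)
  qed
  ultimately show ?thesis by simp
qed

section \<open>The du Bois-Reymond lemma\<close>

text \<open>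
  The open sets form a generator of the Borel sets that is stable under intersections.
\<close>

lemma AE_zero_of_open_set_integrals:
  fixes f :: "real \<Rightarrow> real"
  assumes f: "integrable lborel f" and z: "\<And>U. open U \<Longrightarrow> (LINT x:U|lborel. f x) = 0"
  shows "AE x in lborel. f x = 0"
proof (rule density_unique_real[OF f])
  fix A :: "real set" assume "A \<in> sets lborel"
  then have A: "A \<in> sigma_sets UNIV {S. open S}" by (simp add: borel_def)
  have "Int_stable {S :: real set. open S}" "{S :: real set. open S} \<subseteq> Pow UNIV"
    by (auto simp: Int_stable_def)
  from this A have "(LINT x:A|lborel. f x) = 0"
  proof (induction rule: sigma_sets_induct_disjoint)
    case (basic A) then show ?case by (auto intro: z)
  next
    case empty show ?case by (simp add: set_lebesgue_integral_def)
  next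
    case (compl A)
    then have A: "A \<in> sets lborel" by (simp add: borel_def)
    have "(LINT x:A \<union> (UNIV - A)|lborel. f x) = (LINT x:A|lborel. f x) + (LINT x:UNIV - A|lborel. f x)"
      by (rule set_integral_Un) (use A in \<open>auto intro!: set_integrable_of_integrable f\<close>)
    with z[OF open_UNIV] compl show ?case by simp
  next
    case (union A)
    then have A: "A i \<in> sets lborel" for i by (auto simp: borel_def)
    have "(LINT x:(\<Union>i. A i)|lborel. f x) = (\<Sum>i. (LINT x:(A i)|lborel. f x))"
      by (rule lebesgue_integral_countable_add)
         (use union A in \<open>auto intro!: set_integrable_of_integrable f simp: disjoint_family_on_def\<close>)
    with union show ?case by simp
  qed
  then show "(LINT x:A|lborel. f x) = (LINT x:A|lborel. 0)"
    by (simp add: set_lebesgue_integral_def)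
qed simp

text \<open>
  The test function is the antiderivative of \<open>\<eta>\<close> that vanishes at \<open>a\<close>; the mean value zero makes it vanish beyond \<open>b\<close>
  as well.
\<close>

lemma C1_test_function_of_mean_zero:
  fixes \<eta> :: "real \<Rightarrow> real"
  assumes cont: "continuous_on UNIV \<eta>" and ab: "0 < a" "a \<le> b" "b < 1"
    and out: "\<And>x. x \<notin> {a..b} \<Longrightarrow> \<eta> x = 0" and mean: "(LINT x|lborel. \<eta> x) = 0"
  obtains \<psi> where "\<psi> \<in> C1_compact_support {0<..<1}" "deriv \<psi> = \<eta>"
proof -
  obtain F where F: "\<And>x. (F has_vector_derivative \<eta> x) (at x)"
    using einterval_antiderivative[of "-\<infinity>" "\<infinity>" \<eta>] cont by (auto simp: continuous_on_eq_continuous_at)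
  have FTC: "(\<eta> has_integral (F t - F s)) {s..t}" if "s \<le> t" for s t
    using that F by (intro fundamental_theorem_of_calculus) (auto intro: has_vector_derivative_at_within)
  have const: "F t = F s" if "s \<le> t" "\<And>x. x \<in> {s<..<t} \<Longrightarrow> \<eta> x = 0" for s t
  proof -
    have "((\<lambda>x. 0) has_integral (F t - F s)) {s..t}"
      by (rule has_integral_spike_finite[OF _ _ FTC[OF that(1)], of "{s,t}"]) (use that in auto)
    then show ?thesis using has_integral_unique has_integral_0 by (metis eq_iff_diff_eq_0)
  qed
  have "(LINT x|lborel. \<eta> x) = (LINT x:{a..b}|lborel. \<eta> x)"
    unfolding set_lebesgue_integral_def
    by (intro Bochner_Integration.integral_cong) (use out in \<open>auto simp: indicator_def\<close>)
  also have "\<dots> = integral {a..b} \<eta>"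
    using cont by (intro set_borel_integral_eq_integral borel_integrable_atLeastAtMost')
      (auto intro: continuous_on_subset)
  also have "\<dots> = F b - F a" using FTC[OF ab(2)] by (rule integral_unique)
  finally have "F a = F b" using mean by simp
  then have zero: "F x = F a" if "x \<notin> {a..b}" for x
    using const[of x a] const[of b x] out that by (cases "x \<le> a") auto
  define \<psi> where "\<psi> x = F x - F a" for x
  have d: "(\<psi> has_vector_derivative \<eta> x) (at x)" for x
    unfolding \<psi>_def using F[of x] by (auto intro!: derivative_eq_intros)
  have "{x. \<psi> x \<noteq> 0} \<subseteq> {a..b}" using zero unfolding \<psi>_def by force
  then have cl: "closure {x. \<psi> x \<noteq> 0} \<subseteq> {a..b}" by (rule closure_minimal) simp
  have "\<psi> C1_differentiable_on UNIV"
    unfolding C1_differentiable_on_def using d cont by auto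
  moreover have "compact (closure {x. \<psi> x \<noteq> 0})"
    using cl by (meson bounded_closed_interval bounded_subset closed_closure compact_eq_bounded_closed)
  moreover have "{a..b} \<subseteq> {0<..<1}" using ab by auto
  ultimately have "\<psi> \<in> C1_compact_support {0<..<1}"
    using cl by (auto simp: C1_compact_support_def)
  moreover have "deriv \<psi> = \<eta>"
    using d by (auto intro!: DERIV_imp_deriv simp: has_real_derivative_iff_has_vector_derivative)
  ultimately show ?thesis by (rule that)
qed

lemma LIMSEQ_unique_eventually:
  fixes X Y :: "nat \<Rightarrow> real"
  assumes "X \<longlonglongrightarrow> a" "Y \<longlonglongrightarrow> b" "\<forall>\<^sub>F n in sequentially. X n = Y n"
  shows "a = b"
  using assms tendsto_cong[OF assms(3)] LIMSEQ_unique by blast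

text \<open>
  For two cut-off functions \<open>\<eta>\<close> and \<open>\<theta>\<close>, the combination \<open>(\<integral>\<eta>) \<theta> - (\<integral>\<theta>) \<eta>\<close> has mean zero, hence is the
  derivative of a test function, so that \<open>(\<integral>\<eta>) (\<integral>v\<theta>) = (\<integral>\<theta>) (\<integral>v\<eta>)\<close>. Letting \<open>\<eta>\<close> increase to the indicator of
  an open set \<open>U\<close> and \<open>\<theta>\<close> to that of \<open>(0,1)\<close>, the integral of \<open>v\<close> over \<open>U\<close> is the measure of \<open>U\<close> times the
  integral of \<open>v\<close> over \<open>(0,1)\<close>.
\<close>

lemma du_Bois_Reymond:
  fixes v :: "real \<Rightarrow> real"
  assumes v: "integrable unit_lborel v"
    and orth: "\<And>\<psi>. \<psi> \<in> C1_compact_support {0<..<1} \<Longrightarrow> (LINT x|unit_lborel. v x * deriv \<psi> x) = 0"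
  shows "\<exists>c. AE x in unit_lborel. v x = c"
proof -
  \<comment> \<open>the shift by 1 keeps the support at distance \<open>1 / n\<close> from the complement of \<open>U\<close>, hence compact\<close>
  define \<eta> where "\<eta> U n x = max 0 (min 1 (real n * infdist x (- U) - 1))" for U :: "real set" and n x
  have cont: "continuous_on UNIV (\<eta> U n)" for U n
    unfolding \<eta>_def by (intro continuous_intros continuous_on_infdist)
  have [measurable]: "\<eta> U n \<in> borel_measurable borel" for U n
    by (rule borel_measurable_continuous_onI[OF cont])
  have range: "0 \<le> \<eta> U n x" "\<eta> U n x \<le> 1" for U n x by (auto simp: \<eta>_def)
  have out: "\<eta> U n x = 0" if "U \<subseteq> {0<..<1}" "x \<notin> {1 / n..1 - 1 / n}" "n > 0" for U n x
  proof -
    have "infdist x (-U) \<le> dist x 0" "infdist x (-U) \<le> dist x 1" using that by (intro infdist_le; auto)+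
    moreover have "infdist x (-U) = 0" if "x \<notin> {0<..<1}"
      using that \<open>U \<subseteq> _\<close> by (intro infdist_zero) auto
    ultimately have "infdist x (-U) \<le> 1 / n"
      using that by (auto simp: dist_real_def abs_if split: if_splits)
    then have "real n * infdist x (- U) \<le> 1" using that by (simp add: field_simps)
    then show ?thesis by (simp add: \<eta>_def)
  qed
  have lim: "(\<lambda>n. \<eta> U n x) \<longlonglongrightarrow> indicator U x" if U: "open U" "U \<subseteq> {0<..<1}" for U x
  proof (cases "x \<in> U")
    case True
    have "-U \<noteq> {}" using U by auto
    then have pos: "infdist x (-U) > 0"
      using True U in_closed_iff_infdist_zero[of "-U" x] infdist_nonneg[of x "-U"] by (auto simp: closed_def)
    obtain m where m: "2 / infdist x (-U) \<le> real m" using real_arch_simple by blast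
    have "\<eta> U n x = 1" if "n \<ge> m" for n
    proof -
      have "2 / infdist x (-U) \<le> real n" using m that by linarith
      then show ?thesis using pos by (simp add: \<eta>_def field_simps)
    qed
    then have "\<forall>\<^sub>F n in sequentially. \<eta> U n x = indicator U x"
      using True by (auto simp: eventually_sequentially)
    then show ?thesis by (rule tendsto_eventually)
  next
    case False
    then have "infdist x (-U) = 0" by (intro infdist_zero) auto
    then show ?thesis using False by (simp add: \<eta>_def)
  qed
  have intl: "integrable unit_lborel (\<lambda>x. w x * \<eta> U n x)" if w: "integrable unit_lborel w" for w U n
  proof (rule Bochner_Integration.integrable_bound[OF w])
    show "(\<lambda>x. w x * \<eta> U n x) \<in> borel_measurable unit_lborel"
      using borel_measurable_integrable[OF w]
      by (rule borel_measurable_times) (rule measurable_restrict_space1, simp)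
  qed (use range[of U n] in \<open>auto simp: abs_mult intro!: mult_left_le\<close>)
  have conv: "(\<lambda>n. LINT x|unit_lborel. w x * \<eta> U n x) \<longlonglongrightarrow> (LINT x|unit_lborel. w x * indicator U x)"
    if w: "integrable unit_lborel w" and U: "open U" "U \<subseteq> {0<..<1}" for w U
  proof (rule integral_dominated_convergence[where w="\<lambda>x. \<bar>w x\<bar>"])
    show "AE x in unit_lborel. (\<lambda>n. w x * \<eta> U n x) \<longlonglongrightarrow> w x * indicator U x"
      using lim[OF U] by (auto intro!: tendsto_intros)
    show "AE x in unit_lborel. norm (w x * \<eta> U n x) \<le> \<bar>w x\<bar>" for n
      using range[of U n] by (auto simp: abs_mult intro!: mult_left_le)
    show "(\<lambda>x. w x * indicator U x) \<in> borel_measurable unit_lborel"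
      using borel_measurable_integrable[OF w]
      by (rule borel_measurable_times) (rule measurable_restrict_space1, use U in simp)
  qed (use w intl[OF w] in auto)
  have one: "integrable unit_lborel (\<lambda>x. 1::real)"
    using finite_measure.integrable_const[OF finite_measure_unit_lborel] .
  let ?I = "{0<..<1::real}"
  define m where "m U n = (LINT x|unit_lborel. 1 * \<eta> U n x)" for U n
  have mean: "m U n * (LINT x|unit_lborel. v x * \<eta> ?I n x) = m ?I n * (LINT x|unit_lborel. v x * \<eta> U n x)"
    if U: "U \<subseteq> ?I" and n: "n \<ge> 2" for U n
  proof -
    let ?\<zeta> = "\<lambda>x. m U n * \<eta> ?I n x - m ?I n * \<eta> U n x"
    have z: "?\<zeta> x = 0" if "x \<notin> {1 / n..1 - 1 / n}" for x
      using out[OF U that] out[OF order_refl that] n by simp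
    have zI: "?\<zeta> x = 0" if "x \<notin> ?I" for x
    proof (rule z)
      have "1 / real n > 0" using n by simp
      with that show "x \<notin> {1 / n..1 - 1 / n}"
        unfolding greaterThanLessThan_iff atLeastAtMost_iff by linarith
    qed
    have "(LINT x|lborel. ?\<zeta> x) = (LINT x|lborel. indicator ?I x * ?\<zeta> x)"
      by (intro Bochner_Integration.integral_cong) (use zI in \<open>auto simp: indicator_def\<close>)
    also have "\<dots> = (LINT x|unit_lborel. ?\<zeta> x)"
      by (subst integral_restrict_space) auto
    also have "\<dots> = 0"
      using intl[OF one] by (simp add: m_def)
    finally have mean0: "(LINT x|lborel. ?\<zeta> x) = 0" .
    have n': "0 < 1 / real n" "1 / real n \<le> 1 - 1 / real n" "1 - 1 / real n < 1"
      using n by (auto simp: field_simps)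
    have "continuous_on UNIV ?\<zeta>" by (intro continuous_intros cont)
    from this n' z mean0
    obtain \<psi> where "\<psi> \<in> C1_compact_support ?I" "deriv \<psi> = ?\<zeta>"
      by (rule C1_test_function_of_mean_zero)
    from orth[OF this(1)] this(2) have "0 = (LINT x|unit_lborel. v x * ?\<zeta> x)" by simp
    also have "\<dots> = (LINT x|unit_lborel. m U n * (v x * \<eta> ?I n x) - m ?I n * (v x * \<eta> U n x))"
      by (intro Bochner_Integration.integral_cong) (auto simp: algebra_simps)
    also have "\<dots> = m U n * (LINT x|unit_lborel. v x * \<eta> ?I n x) - m ?I n * (LINT x|unit_lborel. v x * \<eta> U n x)"
      using intl[OF v] by simp
    finally show ?thesis by simp
  qed
  define c where "c = (LINT x|unit_lborel. v x)"
  have U: "(LINT x|unit_lborel. v x * indicator U x) = c * (LINT x|unit_lborel. indicator U x)"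
    if U: "open U" "U \<subseteq> ?I" for U
  proof -
    have m: "m V \<longlonglongrightarrow> (LINT x|unit_lborel. indicator V x)" if "open V" "V \<subseteq> ?I" for V
      using conv[OF one that] by (simp add: m_def[abs_def])
    have "(\<lambda>n. m U n * (LINT x|unit_lborel. v x * \<eta> ?I n x)) \<longlonglongrightarrow>
       (LINT x|unit_lborel. indicator U x) * (LINT x|unit_lborel. v x * indicator ?I x)"
      by (intro tendsto_mult m conv v U) auto
    moreover have "(\<lambda>n. m ?I n * (LINT x|unit_lborel. v x * \<eta> U n x)) \<longlonglongrightarrow>
       (LINT x|unit_lborel. indicator ?I x) * (LINT x|unit_lborel. v x * indicator U x)"
      by (intro tendsto_mult m conv v U) auto
    moreover have "\<forall>\<^sub>F n in sequentially. m U n * (LINT x|unit_lborel. v x * \<eta> ?I n x)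
        = m ?I n * (LINT x|unit_lborel. v x * \<eta> U n x)"
      using mean[OF U(2)] by (auto simp: eventually_sequentially)
    ultimately have eq: "(LINT x|unit_lborel. indicator U x) * (LINT x|unit_lborel. v x * indicator ?I x)
      = (LINT x|unit_lborel. indicator ?I x) * (LINT x|unit_lborel. v x * indicator U x)"
      by (rule LIMSEQ_unique_eventually)
    moreover have "(LINT x|unit_lborel. v x * indicator ?I x) = c"
      unfolding c_def by (intro Bochner_Integration.integral_cong) (auto simp: space_restrict_space)
    moreover have "(LINT x|unit_lborel. indicator ?I x) = (1::real)"
    proof -
      have "(LINT x|unit_lborel. indicator ?I x) = (LINT x|unit_lborel. (1::real))"
        by (intro Bochner_Integration.integral_cong) (auto simp: space_restrict_space)
      also have "\<dots> = 1" by (simp add: measure_restrict_space space_restrict_space)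
      finally show ?thesis .
    qed
    ultimately show ?thesis using eq by (simp add: mult.commute)
  qed
  have vc: "integrable unit_lborel (\<lambda>x. v x - c)" using v one integrable_mult_right[OF one, of c] by simp
  have "AE x in lborel. indicator ?I x * (v x - c) = 0"
  proof (rule AE_zero_of_open_set_integrals)
    show "integrable lborel (\<lambda>x. indicator ?I x * (v x - c))" using vc by (rule unit_extension_abs_integrable)
    fix W :: "real set" assume W: "open W"
    have "(LINT x:W|lborel. indicator ?I x * (v x - c)) = (LINT x|lborel. indicator ?I x *\<^sub>R ((v x - c) * indicator (W \<inter> ?I) x))"
      unfolding set_lebesgue_integral_def
      by (intro Bochner_Integration.integral_cong) (auto simp: indicator_def)
    also have "\<dots> = (LINT x|unit_lborel. (v x - c) * indicator (W \<inter> ?I) x)"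
      by (rule integral_restrict_space[symmetric]) auto
    also have "\<dots> = (LINT x|unit_lborel. v x * indicator (W \<inter> ?I) x - c * indicator (W \<inter> ?I) x)"
      by (intro Bochner_Integration.integral_cong) (auto simp: algebra_simps)
    also have "\<dots> = (LINT x|unit_lborel. v x * indicator (W \<inter> ?I) x) - c * (LINT x|unit_lborel. indicator (W \<inter> ?I) x)"
    proof -
      have "W \<inter> ?I \<in> sets unit_lborel" using W by (auto simp: sets_restrict_space)
      then show ?thesis
        using integrable_mult_indicator[of "W \<inter> ?I" unit_lborel v] integrable_mult_indicator[of "W \<inter> ?I" unit_lborel "\<lambda>x. 1::real"] v one
        by (simp add: mult.commute)
    qed
    also have "\<dots> = 0" using U[OF open_Int[OF W open_greaterThanLessThan]] by auto
    finally show "(LINT x:W|lborel. indicator ?I x * (v x - c)) = 0" .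
  qed
  then have "AE x in unit_lborel. v x = c"
    unfolding AE_unit_lborel_iff by eventually_elim (auto simp: indicator_def)
  then show ?thesis ..
qed

section \<open>A chain rule for indefinite integrals\<close>

text \<open>
  On an interval \<open>[x, y]\<close> the mean value theorem gives \<open>\<Phi> (P y) - \<Phi> (P x) = \<Phi>' (P w) (P y - P x)\<close>, that is, the
  integral of \<open>\<Phi>' (P w) h\<close>, for some \<open>w\<close> in \<open>[x, y]\<close>. If the interval is short, uniform continuity of \<open>\<Phi>' \<circ> P\<close>
  bounds the error of replacing \<open>\<Phi>' (P w)\<close> by \<open>\<Phi>' \<circ> P\<close> by \<open>e\<close> times the integral of \<open>\<bar>h\<bar>\<close>. These errors add up
  to at most \<open>e\<close> times the integral of \<open>\<bar>h\<bar>\<close> over \<open>[s, t]\<close>, for every \<open>e > 0\<close>.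
\<close>

lemma chain_rule_indefinite_integral:
  fixes h P \<Phi> \<Phi>' :: "real \<Rightarrow> real"
  assumes st: "s \<le> t" and h: "h absolutely_integrable_on {s..t}"
    and P: "\<And>x. x \<in> {s..t} \<Longrightarrow> P x = c + integral {s..x} h"
    and J: "is_interval J" "P ` {s..t} \<subseteq> J"
    and \<Phi>: "\<And>p. p \<in> J \<Longrightarrow> (\<Phi> has_real_derivative \<Phi>' p) (at p within J)" and cont: "continuous_on J \<Phi>'"
  shows "(\<lambda>x. \<Phi>' (P x) * h x) absolutely_integrable_on {s..t}"
    and "\<Phi> (P t) - \<Phi> (P s) = integral {s..t} (\<lambda>x. \<Phi>' (P x) * h x)"
proof -
  have hi: "h integrable_on {s..t}" and hai: "(\<lambda>x. \<bar>h x\<bar>) integrable_on {s..t}"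
    using h by (auto simp: absolutely_integrable_on_def)
  have Pc: "continuous_on {s..t} P"
  proof (rule continuous_on_eq)
    show "continuous_on {s..t} (\<lambda>x. c + integral {s..x} h)"
      by (intro continuous_intros indefinite_integral_continuous_1 hi)
  qed (simp add: P)
  have gc: "continuous_on {s..t} (\<lambda>x. \<Phi>' (P x))"
    by (rule continuous_on_compose2[OF cont Pc J(2)])
  show q: "(\<lambda>x. \<Phi>' (P x) * h x) absolutely_integrable_on {s..t}"
    by (intro absolutely_integrable_bounded_measurable_product_real h
          continuous_imp_measurable_on_sets_lebesgue gc compact_imp_bounded compact_continuous_image) auto
  let ?q = "\<lambda>x. \<Phi>' (P x) * h x"
  have qi: "?q integrable_on {s..t}" using q by (auto simp: absolutely_integrable_on_def)
  have sub: "f integrable_on {x..y}" if "f integrable_on {s..t}" "s \<le> x" "y \<le> t" for f :: "real \<Rightarrow> real" and x y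
    using that(2,3) by (intro integrable_on_subinterval[OF that(1)]) (simp add: Icc_subset_Ici_iff atLeastatMost_subset_iff)
  have split: "integral {s..y} f = integral {s..x} f + integral {x..y} f"
    if "f integrable_on {s..t}" "s \<le> x" "x \<le> y" "y \<le> t" for f :: "real \<Rightarrow> real" and x y
    using Henstock_Kurzweil_Integration.integral_combine[OF that(2,3) sub[OF that(1) order_refl that(4)]]
    by (rule sym)
  \<comment> \<open>\<open>E\<close> is the error of the claimed identity, \<open>A\<close> the quantity that controls it\<close>
  define E where "E x = \<Phi> (P x) - \<Phi> (P s) - integral {s..x} ?q" for x
  define A where "A x = integral {s..x} (\<lambda>x. \<bar>h x\<bar>)" for x
  have bound: "\<bar>E t\<bar> \<le> e * A t" if e: "e > 0" for e
  proof -
    have "uniformly_continuous_on {s..t} (\<lambda>x. \<Phi>' (P x))"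
      by (rule compact_uniformly_continuous[OF gc]) simp
    then obtain d where d: "d > 0"
      "\<And>x y. x \<in> {s..t} \<Longrightarrow> y \<in> {s..t} \<Longrightarrow> \<bar>y - x\<bar> < d \<Longrightarrow> \<bar>\<Phi>' (P y) - \<Phi>' (P x)\<bar> < e"
      using e unfolding uniformly_continuous_on_def dist_real_def by blast
    have step: "\<bar>E y - E x\<bar> \<le> e * (A y - A x)" if xy: "s \<le> x" "x \<le> y" "y \<le> t" "y - x < d" for x y
    proof -
      have Pxy: "P y - P x = integral {x..y} h" using xy split[OF hi, of x y] by (simp add: P)
      obtain w where w: "w \<in> {x..y}" "\<Phi> (P y) - \<Phi> (P x) = \<Phi>' (P w) * (P y - P x)"
      proof -
        have mvt: "\<exists>\<xi>. u \<le> \<xi> \<and> \<xi> \<le> v \<and> \<Phi> v - \<Phi> u = \<Phi>' \<xi> * (v - u)"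
          if uv: "u \<le> v" "u \<in> J" "v \<in> J" for u v
        proof (cases "u = v")
          case False
          have sJ: "{u..v} \<subseteq> J"
            using J(1) uv unfolding is_interval_1 by (meson atLeastAtMost_iff subsetI)
          have "(\<Phi> has_derivative (\<lambda>y. \<Phi>' p * y)) (at p within {u..v})" if "p \<in> {u..v}" for p
          proof -
            have "p \<in> J" using sJ that by blast
            from has_field_derivative_subset[OF \<Phi>[OF this] sJ] show ?thesis
              by (simp add: has_field_derivative_def)
          qed
          then have "\<exists>\<xi>\<in>{u<..<v}. \<Phi> v - \<Phi> u = \<Phi>' \<xi> * (v - u)"
            by (intro mvt_simple[of u v \<Phi> "\<lambda>\<xi> y. \<Phi>' \<xi> * y"]) (use uv False in simp_all)
          then obtain \<xi> where "\<xi> \<in> {u<..<v}" "\<Phi> v - \<Phi> u = \<Phi>' \<xi> * (v - u)" by blast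
          then show ?thesis by (intro exI[of _ \<xi>]) simp
        next
          case True
          then show ?thesis by (intro exI[of _ u]) simp
        qed
        have ivt: "\<exists>w\<in>{x..y}. P w = \<xi>" if "min (P x) (P y) \<le> \<xi>" "\<xi> \<le> max (P x) (P y)" for \<xi>
        proof -
          have "is_interval (P ` {x..y})"
            unfolding is_interval_connected_1
            by (intro connected_continuous_image continuous_on_subset[OF Pc] connected_Icc) (use xy in simp)
          moreover have "P x \<in> P ` {x..y}" "P y \<in> P ` {x..y}" using xy by auto
          moreover have "P x \<le> \<xi> \<and> \<xi> \<le> P y \<or> P y \<le> \<xi> \<and> \<xi> \<le> P x" using that by linarith
          ultimately have "\<xi> \<in> P ` {x..y}" unfolding is_interval_1 by blast
          then show ?thesis by auto
        qed
        have Jx: "P x \<in> J" "P y \<in> J" using xy J(2) by auto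
        obtain \<xi> where \<xi>: "min (P x) (P y) \<le> \<xi>" "\<xi> \<le> max (P x) (P y)" "\<Phi> (P y) - \<Phi> (P x) = \<Phi>' \<xi> * (P y - P x)"
        proof (cases "P x \<le> P y")
          case True
          from mvt[OF True Jx] obtain \<xi> where "P x \<le> \<xi>" "\<xi> \<le> P y" "\<Phi> (P y) - \<Phi> (P x) = \<Phi>' \<xi> * (P y - P x)"
            by blast
          with True show ?thesis by (intro that[of \<xi>]) auto
        next
          case False
          then have le: "P y \<le> P x" by simp
          from mvt[OF le Jx(2,1)] obtain \<xi> where x: "P y \<le> \<xi>" "\<xi> \<le> P x" "\<Phi> (P x) - \<Phi> (P y) = \<Phi>' \<xi> * (P x - P y)"
            by blast
          then have "\<Phi> (P y) - \<Phi> (P x) = \<Phi>' \<xi> * (P y - P x)" by (simp add: right_diff_distrib)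
          with x le show ?thesis by (intro that[of \<xi>]) auto
        qed
        from ivt[OF \<xi>(1,2)] obtain w where "w \<in> {x..y}" "P w = \<xi>" by blast
        with \<xi>(3) show ?thesis by (intro that[of w]) simp_all
      qed
      have i: "h integrable_on {x..y}" "?q integrable_on {x..y}" "(\<lambda>x. \<bar>h x\<bar>) integrable_on {x..y}"
        using sub hi qi hai xy by blast+
      have "E y - E x = \<Phi>' (P w) * integral {x..y} h - integral {x..y} ?q"
        using w(2) Pxy split[OF qi, of x y] xy by (simp add: E_def)
      also have "\<dots> = integral {x..y} (\<lambda>r. \<Phi>' (P w) * h r - ?q r)"
        using i by (subst Henstock_Kurzweil_Integration.integral_diff) (auto intro: integrable_on_mult_right)
      also have "\<bar>\<dots>\<bar> \<le> integral {x..y} (\<lambda>r. e * \<bar>h r\<bar>)"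
      proof (subst real_norm_def[symmetric], rule Henstock_Kurzweil_Integration.integral_norm_bound_integral)
        show "(\<lambda>r. \<Phi>' (P w) * h r - ?q r) integrable_on {x..y}"
          using i by (intro Henstock_Kurzweil_Integration.integrable_diff integrable_on_mult_right) auto
        show "(\<lambda>r. e * \<bar>h r\<bar>) integrable_on {x..y}" using i by (intro integrable_on_mult_right) auto
        fix r assume r: "r \<in> {x..y}"
        have "\<bar>\<Phi>' (P w) - \<Phi>' (P r)\<bar> \<le> e"
        proof -
          have "\<bar>w - r\<bar> < d" using w(1) r xy(4) by (simp add: abs_less_iff)
          moreover have "r \<in> {s..t}" "w \<in> {s..t}" using w(1) r xy by auto
          ultimately show ?thesis using d(2)[of r w] by simp
        qed
        then show "norm (\<Phi>' (P w) * h r - ?q r) \<le> e * \<bar>h r\<bar>"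
          by (simp add: left_diff_distrib[symmetric] abs_mult mult_right_mono)
      qed
      also have "\<dots> = e * (A y - A x)"
        using split[OF hai, of x y] xy by (simp add: A_def)
      finally show ?thesis .
    qed
    obtain n :: nat where n: "(t - s) / d < real n" "n > 0"
    proof -
      obtain n :: nat where "max 1 ((t - s) / d) < real n" using reals_Archimedean2 by blast
      then show ?thesis by (intro that[of n]) auto
    qed
    define x where "x i = s + real i * ((t - s) / n)" for i :: nat
    have "\<bar>E (x i)\<bar> \<le> e * A (x i)" if "i \<le> n" for i
      using that
    proof (induction i)
      case 0 show ?case by (simp add: x_def E_def A_def)
    next
      case (Suc i)
      have "(t - s) / n < d" using n d(1) by (simp add: field_simps)
      moreover have "x (Suc i) - x i = (t - s) / n" unfolding x_def of_nat_Suc distrib_right by simp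
      moreover have "x (Suc i) \<le> t"
      proof -
        have "real (Suc i) * ((t - s) / n) \<le> real n * ((t - s) / n)"
          using Suc.prems st by (intro mult_right_mono) auto
        then show ?thesis using n by (simp add: x_def)
      qed
      moreover have "s \<le> x i" "0 \<le> (t - s) / n" using st by (auto simp: x_def)
      ultimately have "\<bar>E (x (Suc i)) - E (x i)\<bar> \<le> e * (A (x (Suc i)) - A (x i))"
        by (intro step) auto
      with Suc show ?case by (simp add: algebra_simps)
    qed
    from this[of n] show ?thesis using n by (simp add: x_def)
  qed
  have "\<bar>E t\<bar> \<le> 0 + e" if "e > 0" for e
  proof -
    have A0: "A t \<ge> 0" unfolding A_def by (rule integral_nonneg) (use hai in auto)
    have "\<bar>E t\<bar> \<le> e / (A t + 1) * A t" using that A0 by (intro bound) auto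
    also have "\<dots> \<le> e" using that A0 by (simp add: field_simps)
    finally show ?thesis by simp
  qed
  then have "\<bar>E t\<bar> \<le> 0" by (rule field_le_epsilon)
  then show "\<Phi> (P t) - \<Phi> (P s) = integral {s..t} ?q" by (simp add: E_def)
qed

section \<open>Functions with a prescribed derivative measure\<close>

lemma C1_test_function_props:
  assumes "\<psi> \<in> C1_compact_support \<Omega>"
  shows "(\<psi> has_real_derivative deriv \<psi> x) (at x)"
    and "continuous_on UNIV (deriv \<psi>)"
    and "x \<notin> closure {x. \<psi> x \<noteq> 0} \<Longrightarrow> \<psi> x = 0"
    and "x \<notin> closure {x. \<psi> x \<noteq> 0} \<Longrightarrow> deriv \<psi> x = 0"
    and C1_test_function_support: "compact (closure {x. \<psi> x \<noteq> 0})" "closure {x. \<psi> x \<noteq> 0} \<subseteq> \<Omega>"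
proof -
  from assms have C1: "\<psi> C1_differentiable_on UNIV" and
    supp: "compact (closure {x. \<psi> x \<noteq> 0})" "closure {x. \<psi> x \<noteq> 0} \<subseteq> \<Omega>"
    by (auto simp: C1_compact_support_def)
  then show "compact (closure {x. \<psi> x \<noteq> 0})" "closure {x. \<psi> x \<noteq> 0} \<subseteq> \<Omega>" by auto
  from C1 obtain D where D: "\<And>x. (\<psi> has_vector_derivative D x) (at x)" "continuous_on UNIV D"
    unfolding C1_differentiable_on_def by auto
  then have D': "(\<psi> has_real_derivative D x) (at x)" for x
    by (simp add: has_real_derivative_iff_has_vector_derivative)
  then have eq: "deriv \<psi> = D" by (auto intro!: DERIV_imp_deriv)
  show "(\<psi> has_real_derivative deriv \<psi> x) (at x)" "continuous_on UNIV (deriv \<psi>)"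
    using D' D(2) by (simp_all add: eq)
  show z: "\<psi> x = 0" if "x \<notin> closure {x. \<psi> x \<noteq> 0}" for x
    using that closure_subset by force
  show "deriv \<psi> x = 0" if x: "x \<notin> closure {x. \<psi> x \<noteq> 0}"
  proof -
    have "((\<lambda>_. 0) has_real_derivative D x) (at x)"
    proof (rule has_field_derivative_transform_within_open[OF D'[of x]])
      show "open (- closure {x. \<psi> x \<noteq> 0})" by (simp add: open_Compl)
      show "x \<in> - closure {x. \<psi> x \<noteq> 0}" using x by simp
      show "\<psi> y = 0" if "y \<in> - closure {x. \<psi> x \<noteq> 0}" for y using that z[of y] by blast
    qed
    from DERIV_unique[OF this DERIV_const] show ?thesis by (simp add: eq)
  qed
qed

lemma C1_test_function_bounded_measurable:
  assumes "\<psi> \<in> C1_compact_support \<Omega>"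
  shows "\<exists>B. \<forall>x. \<bar>\<psi> x\<bar> \<le> B" "\<exists>B. \<forall>x. \<bar>deriv \<psi> x\<bar> \<le> B"
    "\<psi> \<in> borel_measurable borel" "deriv \<psi> \<in> borel_measurable borel"
proof -
  note p = C1_test_function_props[OF assms]
  have c: "continuous_on UNIV \<psi>" by (rule DERIV_continuous_on[OF p(1)])
  then show "\<psi> \<in> borel_measurable borel" by (rule borel_measurable_continuous_onI)
  show "deriv \<psi> \<in> borel_measurable borel" using p(2) by (rule borel_measurable_continuous_onI)
  have "\<exists>B. \<forall>x. \<bar>f x\<bar> \<le> B" if "continuous_on UNIV f" "\<And>x. x \<notin> closure {x. \<psi> x \<noteq> 0} \<Longrightarrow> f x = 0"
    for f :: "real \<Rightarrow> real"
  proof -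
    have "bounded (f ` closure {x. \<psi> x \<noteq> 0})"
      by (intro compact_imp_bounded compact_continuous_image continuous_on_subset[OF that(1)] p(5)) simp
    then obtain B where B: "\<And>x. x \<in> closure {x. \<psi> x \<noteq> 0} \<Longrightarrow> \<bar>f x\<bar> \<le> B"
      unfolding bounded_iff by auto
    have "\<bar>f x\<bar> \<le> max B 0" for x
      using B[of x] that(2)[of x] by (cases "x \<in> closure {x. \<psi> x \<noteq> 0}") auto
    then show ?thesis by blast
  qed
  then show "\<exists>B. \<forall>x. \<bar>\<psi> x\<bar> \<le> B" "\<exists>B. \<forall>x. \<bar>deriv \<psi> x\<bar> \<le> B"
    using c p(2,3,4) by blast+
qed

lemma integrable_mult_bounded:
  fixes f g :: "'a \<Rightarrow> real"
  assumes "integrable M f" "g \<in> borel_measurable M" "\<And>x. \<bar>g x\<bar> \<le> B"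
  shows "integrable M (\<lambda>x. f x * g x)"
proof (rule Bochner_Integration.integrable_bound)
  show "integrable M (\<lambda>x. B * f x)" using assms(1) by simp
  show "(\<lambda>x. f x * g x) \<in> borel_measurable M" using assms(1,2) by simp
  have "\<bar>f x\<bar> * \<bar>g x\<bar> \<le> \<bar>B\<bar> * \<bar>f x\<bar>" for x
    using mult_right_mono[of "\<bar>g x\<bar>" "\<bar>B\<bar>" "\<bar>f x\<bar>"] assms(3)[of x] by (simp add: mult.commute)
  then show "AE x in M. norm (f x * g x) \<le> norm (B * f x)" by (simp add: abs_mult)
qed

lemma C1_test_function_unit_integrals:
  assumes \<psi>: "\<psi> \<in> C1_compact_support {0<..<1}"
  shows "integrable unit_lborel (deriv \<psi>)"
    and "y \<in> {0<..<1} \<Longrightarrow> (LINT x:{y..}|unit_lborel. deriv \<psi> x) = - \<psi> y"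
    and "(LINT x|unit_lborel. deriv \<psi> x) = 0"
    and "y \<in> {0<..<1} \<Longrightarrow> (LINT x:{..y}|unit_lborel. deriv \<psi> x) = \<psi> y"
proof -
  note p = C1_test_function_props[OF \<psi>] and b = C1_test_function_bounded_measurable[OF \<psi>]
  have one: "integrable unit_lborel (\<lambda>x. 1::real)"
    using finite_measure.integrable_const[OF finite_measure_unit_lborel] .
  obtain B where "\<And>x. \<bar>deriv \<psi> x\<bar> \<le> B" using b(2) by blast
  then show i: "integrable unit_lborel (deriv \<psi>)"
    using integrable_mult_bounded[OF one, of "deriv \<psi>" B] measurable_restrict_space1[OF b(4), of "{0<..<1}"]
    by (simp add: measurable_cong_sets[OF sets_unit_lborel refl])
  have out: "deriv \<psi> x = 0" "\<psi> x = 0" if "x \<notin> {0<..<1}" for x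
    using p(3,4,6) that by blast+
  then have eq: "(\<lambda>x. indicator {0<..<1} x * deriv \<psi> x) = deriv \<psi>" by (auto simp: indicator_def fun_eq_iff)
  have FTC: "integral {a..b} (deriv \<psi>) = \<psi> b - \<psi> a" if "a \<le> b" for a b
    using that p(1) by (intro integral_unique fundamental_theorem_of_calculus)
      (auto simp: has_real_derivative_iff_has_vector_derivative[symmetric] intro: has_field_derivative_at_within)
  show "(LINT x:{y..}|unit_lborel. deriv \<psi> x) = - \<psi> y" if "y \<in> {0<..<1}"
    using that out(2)[of 1] FTC[of y 1] by (simp add: unit_final_integral[OF i] eq)
  show "(LINT x|unit_lborel. deriv \<psi> x) = 0"
    using out(2)[of 1] out(2)[of 0] FTC[of 0 1] by (simp add: unit_total_integral[OF i] eq)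
  show "(LINT x:{..y}|unit_lborel. deriv \<psi> x) = \<psi> y" if "y \<in> {0<..<1}"
    using that out(2)[of 0] FTC[of 0 y] by (simp add: unit_initial_integral[OF i] eq)
qed

text \<open>
  Functions in \<open>L\<^sup>1\<close> are only Lebesgue measurable, whereas densities with respect to measures on the Borel sets,
  and the Fubini argument, need Borel measurable functions.
\<close>

lemma borel_representative:
  fixes v :: "real \<Rightarrow> real"
  assumes v: "v absolutely_integrable_on {0<..<1}"
  obtains v' where "v' \<in> borel_measurable borel" "integrable unit_lborel v'"
    "AE x in lebesgue. x \<in> {0<..<1} \<longrightarrow> v x = v' x"
    "\<And>k. k \<in> borel_measurable unit_lborel \<Longrightarrow> (LINT x:{0<..<1}|lebesgue. v x * k x) = (LINT x|unit_lborel. v' x * k x)"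
proof -
  let ?I = "{0<..<1::real}"
  have i: "integrable lebesgue (\<lambda>x. indicator ?I x * v x)" using v by (simp add: set_integrable_def)
  then obtain v' where v': "v' \<in> borel_measurable lborel" "AE x in lborel. indicator ?I x * v x = v' x"
    using completion_ex_borel_measurable_real[OF borel_measurable_integrable] by blast
  have AE: "AE x in lebesgue. indicator ?I x * v x = v' x" using v'(2) by (rule AE_completion)
  have il: "integrable lebesgue v'"
    by (rule Bochner_Integration.integrable_cong_AE_imp[OF i]) (use AE v'(1) in \<open>auto intro: measurable_completion\<close>)
  then have "integrable lborel v'" using integrable_completion[OF v'(1)] by simp
  then have iL: "integrable unit_lborel v'"
    using integrable_mult_indicator[of ?I lborel v'] by (subst integrable_restrict_space) auto
  show ?thesis
  proof
    show "v' \<in> borel_measurable borel" using v'(1) by simp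
    show "integrable unit_lborel v'" by (rule iL)
    show AEI: "AE x in lebesgue. x \<in> ?I \<longrightarrow> v x = v' x"
      using AE by eventually_elim (auto simp: indicator_def)
    fix k :: "real \<Rightarrow> real" assume k: "k \<in> borel_measurable unit_lborel"
    have m: "(\<lambda>x. indicator ?I x *\<^sub>R (v' x * k x)) \<in> borel_measurable lborel"
      using borel_measurable_times[OF borel_measurable_integrable[OF iL] k]
      by (subst (asm) borel_measurable_restrict_space_iff) auto
    have ml: "(\<lambda>x. indicator ?I x *\<^sub>R (v' x * k x)) \<in> borel_measurable lebesgue"
      using m by (rule measurable_completion)
    have "(LINT x:?I|lebesgue. v x * k x) = (LINT x:?I|lebesgue. v' x * k x)"
      unfolding set_lebesgue_integral_def
    proof (rule integral_cong_AE)
      have "(\<lambda>x. indicator ?I x * k x) \<in> borel_measurable lebesgue"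
        using k by (subst (asm) borel_measurable_restrict_space_iff) (auto intro: measurable_completion)
      from borel_measurable_times[OF borel_measurable_integrable[OF i] this]
      show "(\<lambda>x. indicator ?I x *\<^sub>R (v x * k x)) \<in> borel_measurable lebesgue"
        by (rule measurable_cong[THEN iffD1, rotated]) (simp add: indicator_def)
      show "(\<lambda>x. indicator ?I x *\<^sub>R (v' x * k x)) \<in> borel_measurable lebesgue" by (rule ml)
      show "AE x in lebesgue. indicator ?I x *\<^sub>R (v x * k x) = indicator ?I x *\<^sub>R (v' x * k x)"
        using AEI by eventually_elim (auto simp: indicator_def)
    qed
    also have "\<dots> = (LINT x|unit_lborel. v' x * k x)"
      using borel_measurable_times[OF borel_measurable_integrable[OF iL] k] by (rule lebesgue_eq_unit_lborel)
    finally show "(LINT x:?I|lebesgue. v x * k x) = (LINT x|unit_lborel. v' x * k x)" .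
  qed
qed

context
  fixes K :: "real measure" and f :: "real \<Rightarrow> real" and \<mu> :: "real set \<Rightarrow> real"
  assumes K: "finite_measure K" and s: "sets K = sets (borel_on {0<..<1})" and f: "integrable K f"
    and \<mu>: "\<And>A. A \<in> sets (borel_on {0<..<1}) \<Longrightarrow> \<mu> A = (LINT x:A|K. f x)"
begin

lemma integrable_initial_integral: "integrable unit_lborel (\<lambda>x. LINT y:{..x}|K. f y)"
proof (rule Bochner_Integration.integrable_bound)
  show "integrable unit_lborel (\<lambda>x. LINT y|K. \<bar>f y\<bar>)"
    by (rule finite_measure.integrable_const[OF finite_measure_unit_lborel])
  show "(\<lambda>x. LINT y:{..x}|K. f y) \<in> borel_measurable unit_lborel"
    by (rule borel_measurable_unit[OF sets_unit_lborel borel_measurable_initial_integral[OF K s f]])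
  show "AE x in unit_lborel. norm (LINT y:{..x}|K. f y) \<le> norm (LINT y|K. \<bar>f y\<bar>)"
    using abs_initial_integral_le[OF s f] by (auto intro!: AE_I2 order_trans[OF _ abs_ge_self])
qed

text \<open>
  The constant \<open>C\<close> contributes nothing because the derivative of a test function has integral zero.
\<close>

lemma initial_integral_test_function:
  assumes \<psi>: "\<psi> \<in> C1_compact_support {0<..<1}"
  shows "(LINT x|unit_lborel. (C + (LINT y:{..x}|K. f y)) * deriv \<psi> x) = - (LINT y|K. f y * \<psi> y)"
proof -
  note b = C1_test_function_bounded_measurable[OF \<psi>] and i = C1_test_function_unit_integrals[OF \<psi>]
  let ?F = "\<lambda>x. LINT y:{..x}|K. f y"
  obtain B where B: "\<And>x. \<bar>deriv \<psi> x\<bar> \<le> B" using b(2) by blast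
  have "(LINT x|unit_lborel. (C + ?F x) * deriv \<psi> x) = C * (LINT x|unit_lborel. deriv \<psi> x) + (LINT x|unit_lborel. ?F x * deriv \<psi> x)"
    using i(1) integrable_mult_bounded[OF integrable_initial_integral borel_measurable_integrable[OF i(1)] B]
    by (simp add: distrib_right)
  also have "\<dots> = (LINT x|unit_lborel. ?F x * deriv \<psi> x)" using i(3) by simp
  also have "\<dots> = (LINT y|K. f y * (LINT x:{y..}|unit_lborel. deriv \<psi> x))"
    by (rule initial_integral_Fubini[OF K s f i(1)])
  also have "\<dots> = (LINT y|K. - (f y * \<psi> y))"
    using sets_eq_imp_space_eq[OF s]
    by (intro Bochner_Integration.integral_cong) (auto simp: i(2) space_restrict_space)
  finally show ?thesis by simp
qed

lemma signed_integral_test_function: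
  assumes \<psi>: "\<psi> \<in> C1_compact_support {0<..<1}"
  shows "signed_integral (borel_on {0<..<1}) \<mu> \<psi> = (LINT y|K. f y * \<psi> y)"
proof (rule signed_integral_density[OF s f \<mu>])
  note b = C1_test_function_bounded_measurable[OF \<psi>]
  show "\<psi> \<in> borel_measurable (borel_on {0<..<1})" using b(3) by (rule measurable_restrict_space1)
  obtain B where "\<And>x. \<bar>\<psi> x\<bar> \<le> B" using b(1) by blast
  then show "integrable K (\<lambda>x. f x * \<psi> x)"
    by (rule integrable_mult_bounded[OF f borel_measurable_unit[OF s b(3)]])
qed

lemma is_derivative_measure_initial_integral:
  assumes v: "\<And>x. x \<in> {0<..<1} \<Longrightarrow> v x = C + (LINT y:{..x}|K. f y)"
  shows "v absolutely_integrable_on {0<..<1}" "is_derivative_measure {0<..<1} v \<mu>"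
proof -
  let ?F = "\<lambda>x. LINT y:{..x}|K. f y"
  have i: "integrable unit_lborel (\<lambda>x. C + ?F x)"
    by (intro Bochner_Integration.integrable_add integrable_initial_integral
        finite_measure.integrable_const[OF finite_measure_unit_lborel])
  have vi: "integrable unit_lborel v"
    by (rule Bochner_Integration.integrable_cong[THEN iffD1, OF refl _ i]) (simp add: v space_restrict_space)
  then show "v absolutely_integrable_on {0<..<1}"
    by (intro absolutely_integrable_iff_unit_lborel[THEN iffD2]) auto
  show "is_derivative_measure {0<..<1} v \<mu>"
    unfolding is_derivative_measure_def
  proof (intro conjI ballI)
    show "signed_measure (borel_on {0<..<1}) \<mu>" by (rule signed_measure_density[OF s f \<mu>])
    fix \<psi> assume \<psi>: "\<psi> \<in> C1_compact_support {0<..<1}"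
    have "deriv \<psi> \<in> borel_measurable unit_lborel"
      using C1_test_function_unit_integrals(1)[OF \<psi>] by simp
    then have "(LINT x:{0<..<1}|lebesgue. v x * deriv \<psi> x) = (LINT x|unit_lborel. v x * deriv \<psi> x)"
      using vi by (intro lebesgue_eq_unit_lborel) auto
    also have "\<dots> = (LINT x|unit_lborel. (C + ?F x) * deriv \<psi> x)"
      by (intro Bochner_Integration.integral_cong) (auto simp: v space_restrict_space)
    also have "\<dots> = - signed_integral (borel_on {0<..<1}) \<mu> \<psi>"
      unfolding initial_integral_test_function[OF \<psi>] signed_integral_test_function[OF \<psi>] ..
    finally show "(LINT x:{0<..<1}|lebesgue. v x * deriv \<psi> x) = - signed_integral (borel_on {0<..<1}) \<mu> \<psi>" .
  qed
qed

text \<open>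
  The initial integral of the density has the same derivative measure, so the difference is constant by the du
  Bois-Reymond lemma.
\<close>

lemma derivative_measure_determines_function:
  assumes v: "v absolutely_integrable_on {0<..<1}" and d: "is_derivative_measure {0<..<1} v \<mu>"
  shows "\<exists>C. AE x in lebesgue. x \<in> {0<..<1} \<longrightarrow> v x = C + (LINT y:{..x}|K. f y)"
proof -
  let ?F = "\<lambda>x. LINT y:{..x}|K. f y"
  from v obtain v' where "v' \<in> borel_measurable borel" and v': "integrable unit_lborel v'"
    "AE x in lebesgue. x \<in> {0<..<1} \<longrightarrow> v x = v' x"
    "\<And>k. k \<in> borel_measurable unit_lborel \<Longrightarrow> (LINT x:{0<..<1}|lebesgue. v x * k x) = (LINT x|unit_lborel. v' x * k x)"
    by (rule borel_representative) blast
  have "\<exists>c. AE x in unit_lborel. v' x - ?F x = c"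
  proof (rule du_Bois_Reymond)
    show "integrable unit_lborel (\<lambda>x. v' x - ?F x)" using v'(1) integrable_initial_integral by simp
    fix \<psi> assume \<psi>: "\<psi> \<in> C1_compact_support {0<..<1}"
    note b = C1_test_function_bounded_measurable[OF \<psi>] and it = C1_test_function_unit_integrals[OF \<psi>]
    obtain B where B: "\<And>x. \<bar>deriv \<psi> x\<bar> \<le> B" using b(2) by blast
    have m: "deriv \<psi> \<in> borel_measurable unit_lborel" using it(1) by simp
    have "(LINT x|unit_lborel. (v' x - ?F x) * deriv \<psi> x) = (LINT x|unit_lborel. v' x * deriv \<psi> x) - (LINT x|unit_lborel. ?F x * deriv \<psi> x)"
      using integrable_mult_bounded[OF integrable_initial_integral m B] integrable_mult_bounded[OF v'(1) m B]
      by (simp add: left_diff_distrib)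
    also have "(LINT x|unit_lborel. v' x * deriv \<psi> x) = - signed_integral (borel_on {0<..<1}) \<mu> \<psi>"
      using v'(3)[OF m] d \<psi> by (simp add: is_derivative_measure_def)
    finally show "(LINT x|unit_lborel. (v' x - ?F x) * deriv \<psi> x) = 0"
      using signed_integral_test_function[OF \<psi>] initial_integral_test_function[OF \<psi>, of 0] by simp
  qed
  then obtain c where "AE x in lebesgue. x \<in> {0<..<1} \<longrightarrow> v' x - ?F x = c" unfolding AE_lebesgue_unit by blast
  then have "AE x in lebesgue. x \<in> {0<..<1} \<longrightarrow> v x = c + ?F x" using v'(2) by eventually_elim auto
  then show ?thesis ..
qed

end

section \<open>The flux of a bounded variation solution\<close>

lemma set_lebesgue_eq_unit_lborel:
  assumes a: "a \<in> borel_measurable unit_lborel" and A: "A \<in> sets (borel_on {0<..<1})"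
  shows "(LINT x:A|lebesgue. a x) = (LINT x:A|unit_lborel. (a x :: real))"
proof -
  have AL: "A \<in> sets unit_lborel" using A by (simp add: sets_unit_lborel)
  have sub: "A \<subseteq> {0<..<1}" using sets.sets_into_space[OF A] by (simp add: space_restrict_space)
  have "(LINT x:A|lebesgue. a x) = (LINT x:{0<..<1}|lebesgue. indicator A x * a x)"
    unfolding set_lebesgue_integral_def
    by (intro Bochner_Integration.integral_cong) (use sub in \<open>auto simp: indicator_def\<close>)
  also have "\<dots> = (LINT x|unit_lborel. indicator A x * a x)"
    by (rule lebesgue_eq_unit_lborel) (intro borel_measurable_times borel_measurable_indicator AL a)
  finally show ?thesis by (simp add: set_lebesgue_integral_def)
qed

lemma ess_support_subset:
  assumes "closed S" "\<And>x. x \<in> \<Omega> \<Longrightarrow> x \<notin> S \<Longrightarrow> v x = 0"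
  shows "ess_support \<Omega> v \<subseteq> S"
proof -
  have "- S \<in> {U. open U \<and> (AE x in lebesgue. x \<in> U \<inter> \<Omega> \<longrightarrow> v x = 0)}"
    using assms by (auto intro!: AE_I2)
  then show ?thesis unfolding ess_support_def by blast
qed

lemma Iic_Int_measurable:
  assumes "sets K = sets (borel_on {0<..<1::real})"
  shows "{..x} \<inter> space K \<in> sets K"
  unfolding assms using sets_eq_imp_space_eq[OF assms] by (auto simp: sets_restrict_space space_restrict_space)

lemma set_lebesgue_integral_Int_space: "(LINT x:A \<inter> space K|K. f x) = (LINT x:A|K. f x)"
  unfolding set_lebesgue_integral_def
  by (intro Bochner_Integration.integral_cong) (auto simp: indicator_def)

text \<open>
  Up to a constant, \<open>H\<close> is the primitive of \<open>h\<close>. The last clause is integration by parts against the function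
  with derivative measure \<open>f K\<close> that starts from \<open>0\<close> at the left end point; the vanishing total integral makes
  it return to \<open>0\<close> at the right end point, so no boundary terms occur.
\<close>

definition source_potential :: "(real \<Rightarrow> real) \<Rightarrow> (real \<Rightarrow> real) \<Rightarrow> bool" where
  "source_potential h H \<longleftrightarrow>
     (\<forall>s t. 0 < s \<and> s \<le> t \<and> t < 1 \<longrightarrow> H t - H s = integral {s..t} h) \<and>
     H \<in> borel_measurable borel \<and> (\<exists>B. \<forall>x. \<bar>H x\<bar> \<le> B) \<and>
     (\<forall>K f. finite_measure K \<and> sets K = sets (borel_on {0<..<1}) \<and> integrable K f \<and> (LINT y|K. f y) = 0 \<longrightarrow>
        (LINT x:{0<..<1}|lebesgue. h x * (LINT y:{..x}|K. f y)) = - (LINT y|K. f y * H y))"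

text \<open>
  The variational equation in the definition of a bounded variation solution, for fixed \<open>Du\<^sup>a\<close>, \<open>Du\<^sup>s\<close> and \<open>\<sigma>\<close>.
\<close>

definition bv_equation ::
    "(real \<Rightarrow> real) \<Rightarrow> (real \<Rightarrow> real) \<Rightarrow> (real set \<Rightarrow> real) \<Rightarrow> (real \<Rightarrow> real) \<Rightarrow> bool" where
  "bv_equation h Dua Dus \<sigma> \<longleftrightarrow>
     (\<forall>\<phi> D\<phi> D\<phi>a D\<phi>s.
        \<phi> \<in> BV {0<..<1} \<and> ess_support {0<..<1} \<phi> \<subseteq> {0<..<1} \<and>
        is_derivative_measure {0<..<1} \<phi> D\<phi> \<and> lebesgue_decomposition {0<..<1} D\<phi> D\<phi>a D\<phi>s \<and>
        absolutely_continuous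
          (total_variation (borel_on {0<..<1}) Dus) (total_variation (borel_on {0<..<1}) D\<phi>s) \<longrightarrow>
        (LINT x:{0<..<1}|lebesgue. Dua x * D\<phi>a x / sqrt (1 + (Dua x)\<^sup>2))
          + signed_integral (borel_on {0<..<1}) D\<phi>s \<sigma>
        = (LINT x:{0<..<1}|lebesgue. h x * \<phi> x))"

lemma source_potential_exists:
  assumes h: "h absolutely_integrable_on {0<..<1::real}"
  shows "\<exists>H. source_potential h H"
proof -
  let ?I = "{0<..<1::real}"
  from h obtain h' where h'm: "h' \<in> borel_measurable borel" and h'i: "integrable unit_lborel h'" and
    eq: "AE x in lebesgue. x \<in> ?I \<longrightarrow> h x = h' x" and
    int: "\<And>k. k \<in> borel_measurable unit_lborel \<Longrightarrow> (LINT x:?I|lebesgue. h x * k x) = (LINT x|unit_lborel. h' x * k x)"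
    by (rule borel_representative) blast
  define H where "H x = (LINT y:{..x}|unit_lborel. h' y)" for x
  note fin = finite_measure_unit_lborel and s = sets_unit_lborel
  have Hm: "H \<in> borel_measurable borel"
    using borel_measurable_initial_integral[OF fin s h'i] by (simp add: H_def[abs_def])
  obtain B where B: "\<And>x. \<bar>H x\<bar> \<le> B" using abs_initial_integral_le[OF s h'i] unfolding H_def by blast
  have "source_potential h H"
    unfolding source_potential_def
  proof (intro conjI allI impI Hm)
    fix s t :: real assume "0 < s \<and> s \<le> t \<and> t < 1"
    then have st: "0 < s" "s \<le> t" "t < 1" by auto
    let ?k = "\<lambda>x. indicator ?I x * h' x"
    have "H t - H s = integral {0..t} ?k - integral {0..s} ?k"
      using st by (simp add: H_def unit_initial_integral[OF h'i])
    also have "\<dots> = integral {s..t} ?k"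
      using Henstock_Kurzweil_Integration.integral_combine[of 0 s t ?k] st unit_extension_integrable[OF h'i] by simp
    also have "\<dots> = integral {s..t} h"
    proof (rule integral_spike)
      show "negligible {x. \<not> (x \<in> ?I \<longrightarrow> h x = h' x)}"
        using eq by (simp add: eventually_ae_filter_negligible) (meson negligible_subset)
    qed (use st in \<open>auto simp: indicator_def\<close>)
    finally show "H t - H s = integral {s..t} h" .
  next
    show "\<exists>B. \<forall>x. \<bar>H x\<bar> \<le> B" using B by blast
  next
    fix K :: "real measure" and f :: "real \<Rightarrow> real"
    assume "finite_measure K \<and> sets K = sets (borel_on ?I) \<and> integrable K f \<and> (LINT y|K. f y) = 0"
    then have K: "finite_measure K" "sets K = sets (borel_on ?I)" "integrable K f" and mean: "(LINT y|K. f y) = 0"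
      by auto
    have HK: "H \<in> borel_measurable K" by (rule borel_measurable_unit[OF K(2) Hm])
    let ?F = "\<lambda>x. LINT y:{..x}|K. f y"
    define T where "T = (LINT x|unit_lborel. h' x)"
    have final: "(LINT x:{y..}|unit_lborel. h' x) = T - H y" if y: "y \<in> ?I" for y
    proof -
      have "H y + (LINT x:{y..}|unit_lborel. h' x) = T"
        using y Henstock_Kurzweil_Integration.integral_combine[of 0 y 1 "\<lambda>x. indicator ?I x * h' x"] unit_extension_integrable[OF h'i]
        by (simp add: H_def T_def unit_initial_integral[OF h'i] unit_final_integral[OF h'i] unit_total_integral[OF h'i])
      then show ?thesis by simp
    qed
    have "(LINT x:?I|lebesgue. h x * ?F x) = (LINT x|unit_lborel. h' x * ?F x)"
      by (rule int[OF borel_measurable_unit[OF sets_unit_lborel borel_measurable_initial_integral[OF K]]])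
    also have "\<dots> = (LINT x|unit_lborel. ?F x * h' x)" by (simp add: mult.commute)
    also have "\<dots> = (LINT y|K. f y * (LINT x:{y..}|unit_lborel. h' x))"
      by (rule initial_integral_Fubini[OF K h'i])
    also have "\<dots> = (LINT y|K. T * f y - f y * H y)"
      using sets_eq_imp_space_eq[OF K(2)]
      by (intro Bochner_Integration.integral_cong) (auto simp: final space_restrict_space algebra_simps)
    also have "\<dots> = T * (LINT y|K. f y) - (LINT y|K. f y * H y)"
      using K(3) integrable_mult_bounded[OF K(3) HK B] by simp
    finally show "(LINT x:?I|lebesgue. h x * ?F x) = - (LINT y|K. f y * H y)" using mean by simp
  qed
  then show ?thesis by blast
qed

context
  fixes h u Dua \<sigma> :: "real \<Rightarrow> real" and Du Dus :: "real set \<Rightarrow> real" and N :: "real measure"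
  assumes u: "u absolutely_integrable_on {0<..<1}"
    and Du: "is_derivative_measure {0<..<1} u Du"
    and dec: "lebesgue_decomposition {0<..<1} Du Dua Dus"
    and dens: "is_signed_density (total_variation (borel_on {0<..<1}) Dus) Dus \<sigma>"
    and N_def: "N = total_variation (borel_on {0<..<1}) Dus"
begin

lemma sets_N: "sets N = sets (borel_on {0<..<1})"
  unfolding N_def total_variation_def by (rule sets.sets_measure_of_eq)

lemma integrable_sigma: "integrable N \<sigma>" and Dus_eq: "A \<in> sets (borel_on {0<..<1}) \<Longrightarrow> Dus A = (LINT x:A|N. \<sigma> x)"
  using dens sets_N unfolding is_signed_density_def N_def by auto

text \<open>
  By definition \<open>Du\<^sup>s\<close> has density \<open>\<sigma>\<close> with respect to \<open>N\<close>, so its total variation, which is \<open>N\<close> again, has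
  density \<open>\<bar>\<sigma>\<bar>\<close>. This is how \<open>\<bar>\<sigma>\<bar> = 1\<close> enters the argument; it also shows that \<open>N\<close> is finite.
\<close>

lemma N_eq_density: "N = density N (\<lambda>x. ennreal \<bar>\<sigma> x\<bar>)"
  using total_variation_density[OF sets_N integrable_sigma Dus_eq] N_def by simp

lemma finite_N: "finite_measure N"
proof (rule finite_measureI)
  have "emeasure N (space N) = emeasure (density N (\<lambda>x. ennreal \<bar>\<sigma> x\<bar>)) (space N)" using N_eq_density by simp
  also have "\<dots> = (\<integral>\<^sup>+x. ennreal \<bar>\<sigma> x\<bar> \<partial>N)"
    using integrable_sigma by (subst emeasure_density) (auto intro!: nn_integral_cong)
  also have "\<dots> < \<infinity>" using integrable_sigma by (simp add: integrable_iff_bounded)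
  finally show "emeasure N (space N) \<noteq> \<infinity>" by simp
qed

lemma measure_N:
  assumes A: "A \<in> sets N" shows "measure N A = (LINT x:A|N. \<bar>\<sigma> x\<bar>)"
proof -
  have "ennreal (measure N A) = emeasure N A" using finite_measure.emeasure_eq_measure[OF finite_N] by simp
  also have "\<dots> = emeasure (density N (\<lambda>x. ennreal \<bar>\<sigma> x\<bar>)) A" using N_eq_density by simp
  also have "\<dots> = (\<integral>\<^sup>+x. ennreal (indicator A x * \<bar>\<sigma> x\<bar>) \<partial>N)"
    using integrable_sigma A by (subst emeasure_density) (auto intro!: nn_integral_cong simp: indicator_def)
  also have "\<dots> = ennreal (LINT x:A|N. \<bar>\<sigma> x\<bar>)"
    unfolding set_lebesgue_integral_def
    using integrable_mult_indicator[OF A integrable_abs[OF integrable_sigma]]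
    by (subst nn_integral_eq_integral) auto
  finally show ?thesis
    by (subst (asm) ennreal_inj) (auto simp: set_lebesgue_integral_def)
qed

text \<open>
  The measure \<open>a dx + b N\<close> has a density with respect to \<open>K = dx + N\<close>: as the two measures are mutually singular,
  it is \<open>b\<close> on a Lebesgue null set \<open>Z\<close> carrying \<open>N\<close>, and \<open>a\<close> elsewhere.
\<close>

lemma common_density:
  obtains K Z where "finite_measure K" "sets K = sets (borel_on {0<..<1})"
    "Z \<in> sets unit_lborel" "emeasure unit_lborel Z = 0" "emeasure N (space unit_lborel - Z) = 0"
    "\<And>a b. integrable unit_lborel a \<Longrightarrow> integrable N b \<Longrightarrow>
       integrable K (\<lambda>x. if x \<in> Z then b x else a x :: real)"
    "\<And>a b A. integrable unit_lborel a \<Longrightarrow> integrable N b \<Longrightarrow> A \<inter> space K \<in> sets K \<Longrightarrow>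
       (LINT x:A|K. (if x \<in> Z then b x else a x :: real)) = (LINT x:A|unit_lborel. a x) + (LINT x:A|N. b x)"
proof -
  let ?L = unit_lborel
  have sNL: "sets N = sets ?L" using sets_N sets_unit_lborel by simp
  from dec obtain Z where Z: "Z \<in> sets ?L" "emeasure ?L Z = 0" "emeasure N (space ?L - Z) = 0"
    unfolding lebesgue_decomposition_def mutually_singular_def N_def by auto
  have sp: "space N = space ?L" using sNL by (rule sets_eq_imp_space_eq)
  define K where "K = add_measure ?L N"
  have sK: "sets K = sets (borel_on {0<..<1})" unfolding K_def using sets_unit_lborel by simp
  have "emeasure K (space K) = emeasure ?L (space ?L) + emeasure N (space ?L)"
    unfolding K_def space_add_measure by (rule emeasure_add_measure[OF sNL sets.top])
  then have fin: "finite_measure K"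
    using finite_measure.emeasure_finite[OF finite_N] finite_measure.emeasure_finite[OF finite_measure_unit_lborel]
    by (intro finite_measureI) simp
  have "Z \<in> null_sets ?L" using Z(1,2) by (rule null_setsI[rotated])
  then have AE_L: "AE x in ?L. x \<notin> Z" by (rule AE_not_in)
  have "space ?L - Z \<in> null_sets N"
    using Z(3) sets.compl_sets[OF Z(1)] unfolding sNL[symmetric] by (rule null_setsI)
  from AE_not_in[OF this] have AE_N: "AE x in N. x \<in> Z"
    using AE_space[of N] unfolding sp by eventually_elim blast
  have ints: "integrable ?L (\<lambda>x. if x \<in> Z then b x else a x :: real)" "integrable N (\<lambda>x. if x \<in> Z then b x else a x :: real)"
    if ab: "integrable ?L a" "integrable N b" for a b
  proof -
    have bm: "b \<in> borel_measurable ?L" using ab(2) measurable_cong_sets[OF sNL refl] by auto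
    have m: "(\<lambda>x. if x \<in> Z then b x else a x) \<in> borel_measurable ?L"
      using ab(1) bm sets.Int[OF Z(1) sets.top] by (intro measurable_If_set) simp_all
    have mN: "(\<lambda>x. if x \<in> Z then b x else a x) \<in> borel_measurable N"
      using m measurable_cong_sets[OF sNL refl] by auto
    show "integrable ?L (\<lambda>x. if x \<in> Z then b x else a x)"
      by (rule Bochner_Integration.integrable_cong_AE_imp[OF ab(1) m]) (use AE_L in \<open>eventually_elim, auto\<close>)
    show "integrable N (\<lambda>x. if x \<in> Z then b x else a x)"
      by (rule Bochner_Integration.integrable_cong_AE_imp[OF ab(2) mN]) (use AE_N in \<open>eventually_elim, auto\<close>)
  qed
  show ?thesis
  proof (rule that[OF fin sK Z])
    show "integrable K (\<lambda>x. if x \<in> Z then b x else a x :: real)" if "integrable ?L a" "integrable N b" for a b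
      unfolding K_def by (rule integrable_add_measure[OF sNL ints[OF that]])
    fix a b :: "real \<Rightarrow> real" and A assume ab: "integrable ?L a" "integrable N b" and A: "A \<inter> space K \<in> sets K"
    let ?f = "\<lambda>x. if x \<in> Z then b x else a x"
    define A' where "A' = A \<inter> space K"
    have AL: "A' \<in> sets ?L" and AN: "A' \<in> sets N"
      using A sK sets_unit_lborel sNL by (simp_all add: A'_def)
    have A'L: "A' = A \<inter> space ?L" and A'N: "A' = A \<inter> space N" by (simp_all add: A'_def K_def sp)
    note i = ints[OF ab]
    have "(LINT x:A|K. ?f x) = (LINT x:A'|K. ?f x)" by (simp add: A'_def set_lebesgue_integral_Int_space)
    also have "\<dots> = (LINT x:A'|?L. ?f x) + (LINT x:A'|N. ?f x)"
      unfolding K_def set_lebesgue_integral_def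
      by (rule integral_add_measure[OF sNL integrable_mult_indicator[OF AL i(1)] integrable_mult_indicator[OF AN i(2)]])
    also have "(LINT x:A'|?L. ?f x) = (LINT x:A'|?L. a x)"
      unfolding set_lebesgue_integral_def
    proof (rule integral_cong_AE)
      show "AE x in ?L. indicator A' x *\<^sub>R ?f x = indicator A' x *\<^sub>R a x"
        using AE_L by eventually_elim auto
    qed (rule borel_measurable_integrable integrable_mult_indicator AL i(1) ab(1))+
    also have "(LINT x:A'|N. ?f x) = (LINT x:A'|N. b x)"
      unfolding set_lebesgue_integral_def
    proof (rule integral_cong_AE)
      show "AE x in N. indicator A' x *\<^sub>R ?f x = indicator A' x *\<^sub>R b x"
        using AE_N by eventually_elim auto
    qed (rule borel_measurable_integrable integrable_mult_indicator AN i(2) ab(2))+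
    also have "(LINT x:A'|?L. a x) = (LINT x:A|?L. a x)" unfolding A'L by (rule set_lebesgue_integral_Int_space)
    also have "(LINT x:A'|N. b x) = (LINT x:A|N. b x)" unfolding A'N by (rule set_lebesgue_integral_Int_space)
    finally show "(LINT x:A|K. ?f x) = (LINT x:A|?L. a x) + (LINT x:A|N. b x)" .
  qed
qed

text \<open>
  The equation for the test function with derivative measure \<open>a dx + b N\<close>, in which the right-hand side has been
  integrated by parts. It is linear in \<open>a\<close> and \<open>b\<close>; \<open>vanish\<close> says that the test function is zero outside \<open>S\<close>.
\<close>

lemma bv_test_identity:
  fixes a b H :: "real \<Rightarrow> real"
  assumes weak: "bv_equation h Dua Dus \<sigma>" and H: "source_potential h H"
    and a: "integrable unit_lborel a" and b: "b \<in> borel_measurable N" "\<And>x. \<bar>b x\<bar> \<le> B"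
    and total: "(LINT x|unit_lborel. a x) + (LINT x|N. b x) = 0"
    and S: "closed S" "S \<subseteq> {0<..<1}"
    and vanish: "\<And>x. x \<in> {0<..<1} - S \<Longrightarrow> (LINT y:{..x}|unit_lborel. a y) + (LINT y:{..x}|N. b y) = 0"
  shows "(LINT x:{0<..<1}|lebesgue. Dua x * a x / sqrt (1 + (Dua x)\<^sup>2)) + (LINT x|N. b x * \<sigma> x)
     = - ((LINT x|unit_lborel. a x * H x) + (LINT x|N. b x * H x))"
proof -
  let ?I = "{0<..<1::real}"
  obtain K Z where K: "finite_measure K" "sets K = sets (borel_on ?I)"
    and Z: "Z \<in> sets unit_lborel" "emeasure unit_lborel Z = 0" "emeasure N (space unit_lborel - Z) = 0"
    and comb_int: "\<And>a b. integrable unit_lborel a \<Longrightarrow> integrable N b \<Longrightarrow>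
       integrable K (\<lambda>x. if x \<in> Z then b x else a x :: real)"
    and comb: "\<And>a b A. integrable unit_lborel a \<Longrightarrow> integrable N b \<Longrightarrow> A \<inter> space K \<in> sets K \<Longrightarrow>
       (LINT x:A|K. (if x \<in> Z then b x else a x :: real)) = (LINT x:A|unit_lborel. a x) + (LINT x:A|N. b x)"
    by (rule common_density) blast
  have one: "integrable N (\<lambda>x. 1::real)" using finite_measure.integrable_const[OF finite_N] .
  have bi: "integrable N b" using integrable_mult_bounded[OF one b] by simp
  have b\<sigma>: "integrable N (\<lambda>x. b x * \<sigma> x)"
    using integrable_mult_bounded[OF integrable_sigma b] by (simp add: mult.commute)
  define f where "f x = (if x \<in> Z then b x else a x)" for x
  have fi: "integrable K f" unfolding f_def by (rule comb_int[OF a bi])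
  have f_set: "(LINT x:A|K. f x) = (LINT x:A|unit_lborel. a x) + (LINT x:A|N. b x)" if "A \<inter> space K \<in> sets K" for A
    unfolding f_def by (rule comb[OF a bi that])
  have mean: "(LINT x|K. f x) = 0"
    using f_set[of UNIV] total by (simp add: set_lebesgue_integral_def)
  define \<phi> where "\<phi> x = (LINT y:{..x}|K. f y)" for x
  define D\<phi> where "D\<phi> A = (LINT x:A|K. f x)" for A
  define D\<phi>s where "D\<phi>s A = (LINT x:A|N. b x)" for A
  have d: "\<phi> absolutely_integrable_on ?I" "is_derivative_measure ?I \<phi> D\<phi>"
    by (rule is_derivative_measure_initial_integral[OF K fi, where C = 0]; simp add: \<phi>_def D\<phi>_def)+
  have \<phi>0: "\<phi> x = 0" if "x \<in> ?I" "x \<notin> S" for x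
    unfolding \<phi>_def using f_set[OF Iic_Int_measurable[OF K(2)]] vanish that by simp
  have tv: "total_variation (borel_on ?I) D\<phi>s = density N (\<lambda>x. ennreal \<bar>b x\<bar>)"
    by (rule total_variation_density[OF sets_N bi]) (simp add: D\<phi>s_def)
  have ms: "emeasure (density N (\<lambda>x. ennreal \<bar>b x\<bar>)) (space unit_lborel - Z) = 0"
  proof -
    have "space unit_lborel - Z \<in> null_sets N"
      using Z(3) sets.compl_sets[OF Z(1)] unfolding sets_N sets_unit_lborel[symmetric]
      by (intro null_setsI) (simp_all only: sets_N sets_unit_lborel[symmetric])
    moreover have "absolutely_continuous N (density N (\<lambda>x. ennreal \<bar>b x\<bar>))"
      using b by (intro absolutely_continuousI_density) simp
    ultimately have "space unit_lborel - Z \<in> null_sets (density N (\<lambda>x. ennreal \<bar>b x\<bar>))"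
      unfolding absolutely_continuous_def by (rule rev_subsetD)
    then show ?thesis by (rule null_setsD1)
  qed
  have am: "a \<in> borel_measurable unit_lborel" using a by simp
  have ld: "lebesgue_decomposition ?I D\<phi> a D\<phi>s"
    unfolding lebesgue_decomposition_def
  proof (intro conjI ballI)
    show "a absolutely_integrable_on ?I"
      using absolutely_integrable_iff_unit_lborel[OF am] a by simp
    show "signed_measure (borel_on ?I) D\<phi>s"
      by (rule signed_measure_density[OF sets_N bi]) (simp add: D\<phi>s_def)
    show "mutually_singular unit_lborel (total_variation (borel_on ?I) D\<phi>s)"
      unfolding mutually_singular_def tv by (intro bexI[of _ Z] conjI Z(1,2) ms)
    fix A assume A: "A \<in> sets (borel_on ?I)"
    then have "A \<inter> space K \<in> sets K" using K(2) by auto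
    from f_set[OF this] show "D\<phi> A = (LINT x:A|lebesgue. a x) + D\<phi>s A"
      using set_lebesgue_eq_unit_lborel[OF am A] by (simp add: D\<phi>_def D\<phi>s_def)
  qed
  have "(LINT x:?I|lebesgue. Dua x * a x / sqrt (1 + (Dua x)\<^sup>2)) + signed_integral (borel_on ?I) D\<phi>s \<sigma>
    = (LINT x:?I|lebesgue. h x * \<phi> x)"
  proof (rule weak[unfolded bv_equation_def, rule_format, of \<phi> D\<phi>], intro conjI)
    show "\<phi> \<in> BV ?I" using d by (auto simp: BV_def)
    have "ess_support ?I \<phi> \<subseteq> S" by (rule ess_support_subset[OF S(1) \<phi>0])
    then show "ess_support ?I \<phi> \<subseteq> ?I" using S(2) by blast
    show "absolutely_continuous (total_variation (borel_on ?I) Dus) (total_variation (borel_on ?I) D\<phi>s)"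
      unfolding tv N_def[symmetric] using b by (intro absolutely_continuousI_density) simp
  qed (rule d(2) ld)+
  moreover have "signed_integral (borel_on ?I) D\<phi>s \<sigma> = (LINT x|N. b x * \<sigma> x)"
  proof (rule signed_integral_density[OF sets_N bi _ _ b\<sigma>])
    show "\<sigma> \<in> borel_measurable (borel_on ?I)"
      using borel_measurable_integrable[OF integrable_sigma] by (simp add: measurable_cong_sets[OF sets_N refl])
  qed (simp add: D\<phi>s_def)
  moreover have "(LINT x:?I|lebesgue. h x * \<phi> x) = - (LINT y|K. f y * H y)"
    unfolding \<phi>_def using H K fi mean by (simp add: source_potential_def)
  moreover have "(LINT y|K. f y * H y) = (LINT x|unit_lborel. a x * H x) + (LINT x|N. b x * H x)"
  proof -
    obtain B' where B': "\<And>x. \<bar>H x\<bar> \<le> B'" and Hm: "H \<in> borel_measurable borel"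
      using H unfolding source_potential_def by blast
    have "integrable unit_lborel (\<lambda>x. a x * H x)" "integrable N (\<lambda>x. b x * H x)"
      using integrable_mult_bounded[OF a borel_measurable_unit[OF sets_unit_lborel Hm] B']
        integrable_mult_bounded[OF bi borel_measurable_unit[OF sets_N Hm] B'] .
    from comb[OF this, of UNIV] have "(LINT x|K. (if x \<in> Z then b x * H x else a x * H x)) =
       (LINT x|unit_lborel. a x * H x) + (LINT x|N. b x * H x)"
      by (simp add: set_lebesgue_integral_def)
    moreover have "(\<lambda>x. f x * H x) = (\<lambda>x. if x \<in> Z then b x * H x else a x * H x)"
      by (auto simp: f_def)
    ultimately show ?thesis by simp
  qed
  ultimately show ?thesis by simp
qed

text \<open>
  With \<open>p = Du\<^sup>a / sqrt (1 + (Du\<^sup>a)\<^sup>2)\<close>, the choice \<open>a = deriv \<psi>\<close> and \<open>b = 0\<close> shows that \<open>p + H\<close> is a constant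
  \<open>c\<close>. Then \<open>b\<close> is taken to be the indicator of \<open>B\<close>, and \<open>a\<close> the constant density on \<open>[\<alpha>, \<beta>]\<close> with total
  mass \<open>- N B\<close>; the resulting test function vanishes outside \<open>[\<alpha>, \<beta>]\<close>, and replacing \<open>p + H\<close> by \<open>c\<close> leaves
  the identity \<open>\<integral>\<^sub>B \<sigma> dN = c N B - \<integral>\<^sub>B H dN\<close>.
\<close>

lemma bv_solution_flux:
  fixes H :: "real \<Rightarrow> real"
  assumes weak: "bv_equation h Dua Dus \<sigma>" and H: "source_potential h H"
  obtains c where
    "AE x in lebesgue. x \<in> {0<..<1} \<longrightarrow> Dua x / sqrt (1 + (Dua x)\<^sup>2) = c - H x"
    "\<forall>B\<in>sets (borel_on {0<..<1}). \<forall>\<alpha> \<beta>. B \<subseteq> {\<alpha>..\<beta>} \<and> 0 < \<alpha> \<and> \<alpha> < \<beta> \<and> \<beta> < 1 \<longrightarrow>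
       (LINT x:B|N. \<sigma> x) = (LINT x:B|N. c - H x)"
proof -
  let ?I = "{0<..<1::real}"
  let ?L = unit_lborel
  define p where "p x = Dua x / sqrt (1 + (Dua x)\<^sup>2)" for x
  have "p absolutely_integrable_on ?I"
  proof -
    have i: "integrable lebesgue (\<lambda>x. indicator ?I x * Dua x)"
      using dec by (simp add: lebesgue_decomposition_def set_integrable_def)
    have eq: "indicator ?I x * p x = (indicator ?I x * Dua x) / sqrt (1 + (indicator ?I x * Dua x)\<^sup>2)" for x
      by (simp add: p_def indicator_def)
    have "integrable lebesgue (\<lambda>x. indicator ?I x * p x)"
    proof (rule Bochner_Integration.integrable_bound[OF i])
      show "(\<lambda>x. indicator ?I x * p x) \<in> borel_measurable lebesgue"
        unfolding eq using borel_measurable_integrable[OF i] by measurable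
      have "\<bar>d / sqrt (1 + d\<^sup>2)\<bar> \<le> \<bar>d\<bar>" for d :: real
      proof -
        have "1 \<le> sqrt (1 + d\<^sup>2)" "0 < 1 + d\<^sup>2" by (simp_all add: add_pos_nonneg)
        then have "\<bar>d\<bar> / sqrt (1 + d\<^sup>2) \<le> \<bar>d\<bar> / 1" by (intro divide_left_mono) auto
        then show ?thesis by simp
      qed
      then show "AE x in lebesgue. norm (indicator ?I x * p x) \<le> norm (indicator ?I x * Dua x)"
        unfolding eq by simp
    qed
    then show ?thesis by (simp add: set_integrable_def)
  qed
  then obtain p' where p'm: "p' \<in> borel_measurable borel" and p'i: "integrable ?L p'" and
    p'eq: "AE x in lebesgue. x \<in> ?I \<longrightarrow> p x = p' x" and
    p'int: "\<And>k. k \<in> borel_measurable ?L \<Longrightarrow> (LINT x:?I|lebesgue. p x * k x) = (LINT x|?L. p' x * k x)"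
    by (rule borel_representative) blast
  have test: "(LINT x|?L. p' x * a x) + (LINT x|N. b x * \<sigma> x)
     = - ((LINT x|?L. a x * H x) + (LINT x|N. b x * H x))"
    if a: "integrable ?L a" and b: "b \<in> borel_measurable N" "\<And>x. \<bar>b x\<bar> \<le> B"
    and total: "(LINT x|?L. a x) + (LINT x|N. b x) = 0"
    and S: "closed S" "S \<subseteq> ?I"
    and vanish: "\<And>x. x \<in> ?I - S \<Longrightarrow> (LINT y:{..x}|?L. a y) + (LINT y:{..x}|N. b y) = 0" for a b B S
  proof -
    have id: "(LINT x:?I|lebesgue. Dua x * a x / sqrt (1 + (Dua x)\<^sup>2)) + (LINT x|N. b x * \<sigma> x)
      = - ((LINT x|?L. a x * H x) + (LINT x|N. b x * H x))"
      by (rule bv_test_identity[OF weak H a b total S vanish]) assumption+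
    have "(LINT x:?I|lebesgue. Dua x * a x / sqrt (1 + (Dua x)\<^sup>2)) = (LINT x:?I|lebesgue. p x * a x)"
      unfolding p_def times_divide_eq_left ..
    also have "\<dots> = (LINT x|?L. p' x * a x)" by (rule p'int[OF borel_measurable_integrable[OF a]])
    finally show ?thesis using id by (simp only:)
  qed
  obtain B where B: "\<And>x. \<bar>H x\<bar> \<le> B" and Hm: "H \<in> borel_measurable borel"
    using H unfolding source_potential_def by blast
  note one = finite_measure.integrable_const[OF finite_measure_unit_lborel, of "1::real"]
  have HL: "H \<in> borel_measurable ?L" by (rule borel_measurable_unit[OF sets_unit_lborel Hm])
  have HN: "H \<in> borel_measurable N" by (rule borel_measurable_unit[OF sets_N Hm])
  have Hi: "integrable ?L H" using integrable_mult_bounded[OF one HL B] by simp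
  have "\<exists>c. AE x in ?L. p' x + H x = c"
  proof (rule du_Bois_Reymond)
    show "integrable ?L (\<lambda>x. p' x + H x)" using p'i Hi by simp
    fix \<psi> assume \<psi>: "\<psi> \<in> C1_compact_support ?I"
    note b = C1_test_function_bounded_measurable[OF \<psi>] and it = C1_test_function_unit_integrals[OF \<psi>]
      and q = C1_test_function_props[OF \<psi>]
    obtain B' where B': "\<And>x. \<bar>deriv \<psi> x\<bar> \<le> B'" using b(2) by blast
    have m: "deriv \<psi> \<in> borel_measurable ?L" using it(1) by simp
    have "(LINT x|?L. p' x * deriv \<psi> x) + (LINT x|N. 0 * \<sigma> x) = - ((LINT x|?L. deriv \<psi> x * H x) + (LINT x|N. 0 * H x))"
    proof (rule test[OF it(1), where S = "closure {x. \<psi> x \<noteq> 0}" and B = 0])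
      fix x assume x: "x \<in> ?I - closure {x. \<psi> x \<noteq> 0}"
      then have "\<psi> x = 0" using q(3) by blast
      then show "(LINT y:{..x}|?L. deriv \<psi> y) + (LINT y:{..x}|N. 0) = 0"
        using x it(4)[of x] by (simp add: set_lebesgue_integral_def)
    qed (use it(3) q(6) in simp_all)
    then show "(LINT x|?L. (p' x + H x) * deriv \<psi> x) = 0"
      using integrable_mult_bounded[OF p'i m B'] integrable_mult_bounded[OF Hi m B']
      by (simp add: distrib_right mult.commute[of "deriv \<psi> _" "H _"])
  qed
  then obtain c where c: "AE x in ?L. p' x + H x = c" by blast
  show ?thesis
  proof (rule that[of c]; (intro ballI allI impI)?)
    have "AE x in lebesgue. x \<in> ?I \<longrightarrow> p' x + H x = c" using c unfolding AE_lebesgue_unit .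
    then show "AE x in lebesgue. x \<in> ?I \<longrightarrow> Dua x / sqrt (1 + (Dua x)\<^sup>2) = c - H x"
      using p'eq unfolding p_def by eventually_elim auto
  next
    fix B' :: "real set" and \<alpha> \<beta> :: real
    assume B'b: "B' \<in> sets (borel_on ?I)" and "B' \<subseteq> {\<alpha>..\<beta>} \<and> 0 < \<alpha> \<and> \<alpha> < \<beta> \<and> \<beta> < 1"
    then have B': "B' \<in> sets (borel_on ?I)" "B' \<subseteq> {\<alpha>..\<beta>}" and \<alpha>\<beta>: "0 < \<alpha>" "\<alpha> < \<beta>" "\<beta> < 1" by auto
    have B'N: "B' \<in> sets N" using B' sets_N by simp
    have sub: "{\<alpha>..\<beta>} \<subseteq> ?I" using \<alpha>\<beta> by auto
    have mN: "(LINT x|N. indicator B' x) = measure N B'"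
      using B'N sets.sets_into_space[OF B'N] by (simp add: Int_absorb1 Int_absorb2)
    \<comment> \<open>the constant density that balances the mass of \<open>B'\<close>\<close>
    define k where "k = measure N B' / (\<beta> - \<alpha>)"
    define a where "a x = - k * indicator {\<alpha>..\<beta>} x" for x :: real
    have abL: "{\<alpha>..\<beta>} \<in> sets ?L" using sub by (auto simp: sets_restrict_space_iff)
    have ind: "integrable ?L (indicator {\<alpha>..\<beta>} :: real \<Rightarrow> real)"
      using integrable_mult_indicator[OF abL one] by (simp only: real_scaleR_def mult_1_right)
    have ai: "integrable ?L a" unfolding a_def using ind by (intro integrable_mult_right)
    have "measure ?L {\<alpha>..\<beta>} = \<beta> - \<alpha>"
      using sub \<alpha>\<beta> by (subst measure_restrict_space) auto
    then have "(LINT x|?L. indicator {\<alpha>..\<beta>} x) = \<beta> - \<alpha>"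
      using abL sets.sets_into_space[OF abL] by (simp add: Int_absorb1 Int_absorb2 del: space_restrict_space)
    then have a_tot: "(LINT x|?L. a x) = - measure N B'"
      unfolding a_def using \<alpha>\<beta> by (simp add: k_def)
    have id: "(LINT x|?L. p' x * a x) + (LINT x|N. indicator B' x * \<sigma> x)
       = - ((LINT x|?L. a x * H x) + (LINT x|N. indicator B' x * H x))"
    proof (rule test[OF ai, where S = "{\<alpha>..\<beta>}" and B = 1])
      show "indicator B' \<in> borel_measurable N" using B'N by simp
      show "(LINT x|?L. a x) + (LINT x|N. indicator B' x) = 0" using a_tot mN by simp
      fix x assume x: "x \<in> ?I - {\<alpha>..\<beta>}"
      show "(LINT y:{..x}|?L. a y) + (LINT y:{..x}|N. indicator B' y) = 0"
      proof (cases "x < \<alpha>")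
        case True
        have "(LINT y:{..x}|?L. a y) = 0" "(LINT y:{..x}|N. indicator B' y) = (0::real)"
          unfolding set_lebesgue_integral_def
          by (rule integral_eq_zero_AE; rule AE_I2; use True B'(2) in \<open>auto simp: a_def indicator_def\<close>)+
        then show ?thesis by simp
      next
        case False
        then have gt: "x > \<beta>" using x by auto
        have "(LINT y:{..x}|?L. a y) = (LINT y|?L. a y)" "(LINT y:{..x}|N. indicator B' y) = (LINT y|N. indicator B' y :: real)"
          unfolding set_lebesgue_integral_def
          by (rule Bochner_Integration.integral_cong[OF refl]; use gt B'(2) in \<open>auto simp: a_def indicator_def\<close>)+
        then show ?thesis using a_tot mN by simp
      qed
    qed (use sub in \<open>auto simp: indicator_def\<close>)
    have aH: "integrable ?L (\<lambda>x. a x * H x)" by (rule integrable_mult_bounded[OF ai HL B])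
    have ap: "integrable ?L (\<lambda>x. p' x * a x)"
    proof (rule integrable_mult_bounded[OF p'i])
      show "a \<in> borel_measurable ?L" using ai by simp
      show "\<bar>a x\<bar> \<le> \<bar>k\<bar>" for x by (simp add: a_def indicator_def)
    qed
    have "(LINT x|?L. p' x * a x) + (LINT x|?L. a x * H x) = (LINT x|?L. p' x * a x + a x * H x)"
      using aH ap by simp
    also have "\<dots> = (LINT x|?L. c * a x)"
    proof (rule integral_cong_AE)
      show "AE x in ?L. p' x * a x + a x * H x = c * a x"
        using c by eventually_elim (metis distrib_right mult.commute)
    qed (use aH ap ai in auto)
    also have "\<dots> = - c * measure N B'" using a_tot by simp
    finally have "(LINT x|N. indicator B' x * \<sigma> x) = c * measure N B' - (LINT x|N. indicator B' x * H x)"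
      using id by linarith
    also have "\<dots> = (LINT x|N. c * indicator B' x - indicator B' x * H x)"
    proof -
      have "integrable N (indicator B' :: real \<Rightarrow> real)"
        using integrable_mult_indicator[OF B'N finite_measure.integrable_const[OF finite_N, of "1::real"]]
        by (simp only: real_scaleR_def mult_1_right)
      from this integrable_mult_bounded[OF this HN B] mN show ?thesis by simp
    qed
    also have "\<dots> = (LINT x:B'|N. c - H x)"
      unfolding set_lebesgue_integral_def
      by (intro Bochner_Integration.integral_cong) (auto simp: algebra_simps)
    finally show "(LINT x:B'|N. \<sigma> x) = (LINT x:B'|N. c - H x)"
      by (simp add: set_lebesgue_integral_def)
  qed
qed

end

section \<open>Jumps and the gradient in terms of the flux\<close>

lemma inverse_flux:
  fixes d p :: real
  assumes "d / sqrt (1 + d\<^sup>2) = p"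
  shows "\<bar>p\<bar> < 1" "d = p / sqrt (1 - p\<^sup>2)"
proof -
  have pos: "0 < 1 + d\<^sup>2" by (simp add: add_pos_nonneg)
  have p2: "p\<^sup>2 = d\<^sup>2 / (1 + d\<^sup>2)"
    unfolding assms[symmetric] power_divide using pos by simp
  then have e: "1 - p\<^sup>2 = 1 / (1 + d\<^sup>2)" using pos by (simp add: field_simps)
  then have "p\<^sup>2 < 1" using pos by (smt (verit) divide_pos_pos)
  then show "\<bar>p\<bar> < 1" by (simp add: abs_square_less_1)
  show "d = p / sqrt (1 - p\<^sup>2)"
  proof -
    have "sqrt (1 - p\<^sup>2) = 1 / sqrt (1 + d\<^sup>2)" unfolding e by (simp add: real_sqrt_divide)
    moreover have "d = p * sqrt (1 + d\<^sup>2)" using assms pos by (simp add: field_simps)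
    ultimately show ?thesis by simp
  qed
qed

context
  fixes u Dua \<sigma> P :: "real \<Rightarrow> real" and Du Dus :: "real set \<Rightarrow> real" and N :: "real measure"
  assumes u: "u absolutely_integrable_on {0<..<1}"
    and Du: "is_derivative_measure {0<..<1} u Du"
    and dec: "lebesgue_decomposition {0<..<1} Du Dua Dus"
    and dens: "is_signed_density (total_variation (borel_on {0<..<1}) Dus) Dus \<sigma>"
    and N_def: "N = total_variation (borel_on {0<..<1}) Dus"
    and Pm: "P \<in> borel_measurable borel"
    and Pb: "\<exists>B. \<forall>x. \<bar>P x\<bar> \<le> B"
    and flux: "AE x in lebesgue. x \<in> {0<..<1} \<longrightarrow> Dua x / sqrt (1 + (Dua x)\<^sup>2) = P x"
    and sing: "\<forall>B\<in>sets (borel_on {0<..<1}). \<forall>\<alpha> \<beta>. B \<subseteq> {\<alpha>..\<beta>} \<and> 0 < \<alpha> \<and> \<alpha> < \<beta> \<and> \<beta> < 1 \<longrightarrow>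
       (LINT x:B|N. \<sigma> x) = (LINT x:B|N. P x)"
begin

lemmas decomp = u Du dec dens N_def
lemmas sN = sets_N[OF decomp]
lemmas finN = finite_N[OF decomp]
lemmas \<sigma>i = integrable_sigma[OF decomp]

lemma integrable_N_P: "integrable N P"
proof -
  obtain B where B: "\<And>x. \<bar>P x\<bar> \<le> B" using Pb by blast
  show ?thesis
    using integrable_mult_bounded[OF finite_measure.integrable_const[OF finN, of "1::real"] borel_measurable_unit[OF sN Pm] B] by simp
qed

text \<open>
  As \<open>N\<close> has density \<open>\<bar>\<sigma>\<bar>\<close> with respect to itself, \<open>N B\<close> is the integral of \<open>\<sigma>\<close> over the part of \<open>B\<close> where
  \<open>\<sigma> > 0\<close> minus the integral over the rest. In both integrals \<open>\<sigma>\<close> may be replaced by \<open>P\<close>, whence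
  \<open>N B \<le> \<integral>\<^sub>B \<bar>P\<bar> dN\<close>; this is impossible if \<open>\<bar>P\<bar> < 1\<close> on \<open>B\<close> unless \<open>N B = 0\<close>.
\<close>

lemma singular_part_null_where_flux_strict:
  assumes B: "B \<in> sets (borel_on {0<..<1})" "B \<subseteq> {\<alpha>..\<beta>}" "0 < \<alpha>" "\<alpha> < \<beta>" "\<beta> < 1"
    and P: "\<And>x. x \<in> B \<Longrightarrow> \<bar>P x\<bar> < 1"
  shows "emeasure N B = 0"
proof -
  have BN: "B \<in> sets N" using B(1) sN by simp
  have s: "{x \<in> space N. \<sigma> x > 0} \<in> sets N" using borel_measurable_integrable[OF \<sigma>i] by measurable
  define B1 where "B1 = B \<inter> {x \<in> space N. \<sigma> x > 0}"
  define B2 where "B2 = B - {x \<in> space N. \<sigma> x > 0}"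
  have B12: "B1 \<in> sets N" "B2 \<in> sets N" unfolding B1_def B2_def using BN s by auto
  have id: "(LINT x:B1|N. \<sigma> x) = (LINT x:B1|N. P x)" "(LINT x:B2|N. \<sigma> x) = (LINT x:B2|N. P x)"
    using B B12 sN by (intro sing[rule_format, of _ \<alpha> \<beta>]; auto simp: B1_def B2_def)+
  have int: "integrable N (\<lambda>x. indicator A x * f x)" if "A \<in> sets N" "integrable N f" for A and f :: "real \<Rightarrow> real"
    using integrable_mult_indicator[OF that] by simp
  have "measure N B = (LINT x|N. indicator B x * \<bar>\<sigma> x\<bar>)"
    using measure_N[OF decomp BN] by (simp add: set_lebesgue_integral_def)
  also have "\<dots> = (LINT x|N. indicator B1 x * \<sigma> x - indicator B2 x * \<sigma> x)"
    by (intro Bochner_Integration.integral_cong) (auto simp: B1_def B2_def indicator_def)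
  also have "\<dots> = (LINT x|N. indicator B1 x * P x - indicator B2 x * P x)"
    using id int[OF B12(1) \<sigma>i] int[OF B12(2) \<sigma>i] int[OF B12(1) integrable_N_P] int[OF B12(2) integrable_N_P]
    by (simp add: set_lebesgue_integral_def)
  also have "\<dots> \<le> (LINT x|N. indicator B x * \<bar>P x\<bar>)"
    by (intro integral_mono Bochner_Integration.integrable_diff int B12 BN integrable_N_P integrable_abs)
       (auto simp: B1_def B2_def indicator_def)
  finally have le: "measure N B \<le> (LINT x|N. indicator B x * \<bar>P x\<bar>)" .
  have one: "integrable N (\<lambda>x. indicator B x :: real)"
    using int[OF BN finite_measure.integrable_const[OF finN, of "1::real"]] by (simp only: mult_1_right)
  have m: "(LINT x|N. indicator B x) = measure N B"
    using BN sets.sets_into_space[OF BN] by (simp add: Int_absorb1 Int_absorb2)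
  have i: "integrable N (\<lambda>x. indicator B x - indicator B x * \<bar>P x\<bar>)"
    by (intro Bochner_Integration.integrable_diff one int BN integrable_abs integrable_N_P)
  have "(LINT x|N. indicator B x - indicator B x * \<bar>P x\<bar>) \<le> 0"
    using le m one int[OF BN integrable_abs[OF integrable_N_P]] by simp
  moreover have nn: "AE x in N. 0 \<le> indicator B x - indicator B x * \<bar>P x\<bar>"
    using P by (intro AE_I2) (auto simp: indicator_def less_imp_le)
  ultimately have "(LINT x|N. indicator B x - indicator B x * \<bar>P x\<bar>) = 0"
    using integral_nonneg_AE[OF nn] by simp
  then have "AE x in N. indicator B x - indicator B x * \<bar>P x\<bar> = 0"
    using integral_nonneg_eq_0_iff_AE[OF i nn] by simp
  then have "AE x in N. x \<notin> B"
    by eventually_elim (use P in \<open>force simp: indicator_def\<close>)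
  then show ?thesis using BN AE_iff_measurable[OF BN, of "\<lambda>x. x \<notin> B"] sets.sets_into_space[OF BN] by auto
qed

text \<open>
  At an atom \<open>y\<close>, the density \<open>\<bar>\<sigma>\<bar>\<close> of \<open>N\<close> with respect to itself gives \<open>\<bar>\<sigma> y\<bar> = 1\<close>, and \<open>\<sigma> y = P y\<close>.
\<close>

lemma singular_part_atom:
  assumes y: "y \<in> {0<..<1}"
  shows "(LINT x:{y}|N. \<sigma> x) = P y * measure N {y}" "measure N {y} \<noteq> 0 \<Longrightarrow> \<bar>P y\<bar> = 1"
proof -
  have yb: "{y} \<in> sets (borel_on {0<..<1})" using y by (auto simp: sets_restrict_space_iff)
  have yN: "{y} \<in> sets N" using yb sN by simp
  have sg: "(LINT x:{y}|N. f x) = f y * measure N {y}" for f :: "real \<Rightarrow> real"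
  proof -
    have "(LINT x:{y}|N. f x) = (LINT x|N. f y * indicator {y} x)"
      unfolding set_lebesgue_integral_def
      by (intro Bochner_Integration.integral_cong) (auto simp: indicator_def)
    also have "\<dots> = f y * measure N {y}"
      using yN sets.sets_into_space[OF yN] by (simp add: Int_absorb1 Int_absorb2)
    finally show ?thesis .
  qed
  have "(LINT x:{y}|N. \<sigma> x) = (LINT x:{y}|N. P x)"
    using y by (intro sing[rule_format, OF yb, of "y / 2" "(y + 1) / 2"]) auto
  then show e: "(LINT x:{y}|N. \<sigma> x) = P y * measure N {y}" using sg by simp
  show "\<bar>P y\<bar> = 1" if "measure N {y} \<noteq> 0"
    using measure_N[OF decomp yN] sg[of \<sigma>] sg[of "\<lambda>x. \<bar>\<sigma> x\<bar>"] e that by simp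
qed

lemma integrable_gradient:
  shows "integrable unit_lborel (\<lambda>x. P x / sqrt (1 - (P x)\<^sup>2))"
    and "AE x in lebesgue. x \<in> {0<..<1} \<longrightarrow> Dua x = P x / sqrt (1 - (P x)\<^sup>2)"
    and "A \<in> sets (borel_on {0<..<1}) \<Longrightarrow> (LINT x:A|lebesgue. Dua x) = (LINT x:A|unit_lborel. P x / sqrt (1 - (P x)\<^sup>2))"
proof -
  let ?G = "\<lambda>x. P x / sqrt (1 - (P x)\<^sup>2)"
  have "Dua absolutely_integrable_on {0<..<1}" using dec by (simp add: lebesgue_decomposition_def)
  then obtain D where Di: "integrable unit_lborel D" and Deq: "AE x in lebesgue. x \<in> {0<..<1} \<longrightarrow> Dua x = D x" and
    Dint: "\<And>k. k \<in> borel_measurable unit_lborel \<Longrightarrow> (LINT x:{0<..<1}|lebesgue. Dua x * k x) = (LINT x|unit_lborel. D x * k x)"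
    by (rule borel_representative) blast
  show eq: "AE x in lebesgue. x \<in> {0<..<1} \<longrightarrow> Dua x = ?G x"
    using flux by eventually_elim (auto dest: inverse_flux(2))
  have "AE x in lebesgue. x \<in> {0<..<1} \<longrightarrow> D x = ?G x" using eq Deq by eventually_elim auto
  then have DG: "AE x in unit_lborel. D x = ?G x" unfolding AE_lebesgue_unit .
  have [measurable]: "P \<in> borel_measurable unit_lborel" by (rule borel_measurable_unit[OF sets_unit_lborel Pm])
  show Gi: "integrable unit_lborel ?G"
    by (rule Bochner_Integration.integrable_cong_AE_imp[OF Di]) (use DG in auto)
  assume A: "A \<in> sets (borel_on {0<..<1})"
  then have AL: "A \<in> sets unit_lborel" by (simp add: sets_unit_lborel)
  have sub: "A \<subseteq> {0<..<1}" using sets.sets_into_space[OF A] by (simp add: space_restrict_space)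
  have "(LINT x:A|lebesgue. Dua x) = (LINT x:{0<..<1}|lebesgue. Dua x * indicator A x)"
    unfolding set_lebesgue_integral_def
    by (intro Bochner_Integration.integral_cong) (use sub in \<open>auto simp: indicator_def\<close>)
  also have "\<dots> = (LINT x|unit_lborel. D x * indicator A x)"
    by (rule Dint) (rule borel_measurable_indicator[OF AL])
  also have "\<dots> = (LINT x|unit_lborel. indicator A x *\<^sub>R ?G x)"
  proof (rule integral_cong_AE)
    show "AE x in unit_lborel. D x * indicator A x = indicator A x *\<^sub>R ?G x"
      using DG by eventually_elim simp
    show "(\<lambda>x. D x * indicator A x) \<in> borel_measurable unit_lborel"
      by (intro borel_measurable_times borel_measurable_integrable[OF Di] borel_measurable_indicator AL)
  qed (rule borel_measurable_integrable integrable_mult_indicator AL Gi)+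
  finally show "(LINT x:A|lebesgue. Dua x) = (LINT x:A|unit_lborel. ?G x)"
    by (simp add: set_lebesgue_integral_def)
qed

lemma solution_representation:
  "\<exists>C. AE x in lebesgue. x \<in> {0<..<1} \<longrightarrow>
     u x = C + (LINT y:{..x}|unit_lborel. P y / sqrt (1 - (P y)\<^sup>2)) + (LINT y:{..x}|N. \<sigma> y)"
proof -
  let ?G = "\<lambda>y. P y / sqrt (1 - (P y)\<^sup>2)"
  obtain K Z where K: "finite_measure K" "sets K = sets (borel_on {0<..<1})"
    and comb_int: "\<And>a b. integrable unit_lborel a \<Longrightarrow> integrable N b \<Longrightarrow>
       integrable K (\<lambda>x. if x \<in> Z then b x else a x :: real)"
    and comb: "\<And>a b A. integrable unit_lborel a \<Longrightarrow> integrable N b \<Longrightarrow> A \<inter> space K \<in> sets K \<Longrightarrow>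
       (LINT x:A|K. (if x \<in> Z then b x else a x :: real)) = (LINT x:A|unit_lborel. a x) + (LINT x:A|N. b x)"
    by (rule common_density[OF decomp]) blast
  have fi: "integrable K (\<lambda>x. if x \<in> Z then \<sigma> x else ?G x)" by (rule comb_int[OF integrable_gradient(1) \<sigma>i])
  have "\<exists>C. AE x in lebesgue. x \<in> {0<..<1} \<longrightarrow> u x = C + (LINT y:{..x}|K. if y \<in> Z then \<sigma> y else ?G y)"
  proof (rule derivative_measure_determines_function[OF K fi _ u Du])
    fix A assume A: "A \<in> sets (borel_on {0<..<1})"
    then have "A \<inter> space K \<in> sets K" using K(2) by auto
    from comb[OF integrable_gradient(1) \<sigma>i this] integrable_gradient(3)[OF A] Dus_eq[OF decomp A] dec A
    show "Du A = (LINT x:A|K. if x \<in> Z then \<sigma> x else ?G x)"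
      by (simp add: lebesgue_decomposition_def)
  qed
  then show ?thesis
    unfolding comb[OF integrable_gradient(1) \<sigma>i Iic_Int_measurable[OF K(2)]] by (simp add: add.assoc)
qed

text \<open>
  Where \<open>\<bar>P\<bar> < 1\<close> the singular part has no mass, so only an atom at \<open>z\<close> can remain. Here \<open>m\<close> is the mass \<open>N {z}\<close>
  and \<open>P z * m\<close> the height of the jump.
\<close>

lemma representation_one_jump:
  assumes ab: "0 \<le> a" "a < z" "z < b" "b \<le> 1"
    and P: "\<And>x. x \<in> {a<..<b} - {z} \<Longrightarrow> \<bar>P x\<bar> < 1"
  shows "\<exists>C m. 0 \<le> m \<and> (m \<noteq> 0 \<longrightarrow> \<bar>P z\<bar> = 1) \<and>
     (AE x in lebesgue. x \<in> {a<..<b} \<longrightarrow>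
        u x = C + (LINT y:{..x}|unit_lborel. P y / sqrt (1 - (P y)\<^sup>2)) + (if x < z then 0 else P z * m))"
proof -
  have sp: "space N = {0<..<1}" using sets_eq_imp_space_eq[OF sN] by (simp add: space_restrict_space)
  \<comment> \<open>exhaustion by intervals that are compact in \<open>(0,1)\<close>, the only ones that carry test functions\<close>
  define \<alpha> where "\<alpha> n = a + (z - a) / real (n + 2)" for n :: nat
  define \<beta> where "\<beta> n = b - (b - z) / real (n + 2)" for n :: nat
  have \<alpha>: "a < \<alpha> n" "\<alpha> n < z" and \<beta>: "z < \<beta> n" "\<beta> n < b" for n
  proof -
    have f: "0 < t / real (n + 2)" "t / real (n + 2) < t" if "0 < t" for t
      using that divide_strict_left_mono[of 1 "real (n + 2)" t] by simp_all
    show "a < \<alpha> n" "\<alpha> n < z" "z < \<beta> n" "\<beta> n < b"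
      using f[of "z - a"] f[of "b - z"] ab unfolding \<alpha>_def \<beta>_def by linarith+
  qed
  have null: "{\<alpha> n..\<beta> n} - {z} \<in> null_sets N" for n
  proof -
    have b: "{\<alpha> n..\<beta> n} - {z} \<in> sets (borel_on {0<..<1})"
      using \<alpha>[of n] \<beta>[of n] ab by (auto simp: sets_restrict_space_iff)
    have "emeasure N ({\<alpha> n..\<beta> n} - {z}) = 0"
      using \<alpha>[of n] \<beta>[of n] ab by (intro singular_part_null_where_flux_strict[OF b, of "\<alpha> n" "\<beta> n"] P) auto
    then show ?thesis using b sN by auto
  qed
  have l: "(\<lambda>n. t / real (n + 2)) \<longlonglongrightarrow> 0" for t
    using LIMSEQ_ignore_initial_segment[OF lim_const_over_n] .
  have lim: "\<alpha> \<longlonglongrightarrow> a" "\<beta> \<longlonglongrightarrow> b"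
    unfolding \<alpha>_def[abs_def] \<beta>_def[abs_def]
    using tendsto_add[OF tendsto_const l, of a "z - a"] tendsto_diff[OF tendsto_const l, of b "b - z"] by simp_all
  have "{a<..<b} - {z} \<subseteq> (\<Union>n. {\<alpha> n..\<beta> n} - {z})"
  proof
    fix x assume x: "x \<in> {a<..<b} - {z}"
    have "\<forall>\<^sub>F n in sequentially. \<alpha> n < x" "\<forall>\<^sub>F n in sequentially. x < \<beta> n"
      using order_tendstoD(2)[OF lim(1), of x] order_tendstoD(1)[OF lim(2), of x] x by auto
    then have "\<forall>\<^sub>F n in sequentially. \<alpha> n < x \<and> x < \<beta> n" by eventually_elim simp
    then obtain n where "\<alpha> n < x" "x < \<beta> n" using eventually_happens'[OF sequentially_bot] by blast
    then show "x \<in> (\<Union>n. {\<alpha> n..\<beta> n} - {z})" using x by (auto intro!: exI[of _ n])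
  qed
  then have "{a<..<b} - {z} \<in> null_sets N"
  proof (rule null_sets_subset[OF null_sets_UN[OF null], rotated])
    show "{a<..<b} - {z} \<in> sets N"
      unfolding sN using ab by (auto simp: sets_restrict_space_iff)
  qed
  then have AE: "AE x in N. x \<notin> {a<..<b} - {z}" by (rule AE_not_in)
  have zI: "z \<in> {0<..<1}" using ab by auto
  have zN: "{z} \<in> sets N" unfolding sN using zI by (auto simp: sets_restrict_space_iff)
  have jump: "(LINT y:{..x}|N. \<sigma> y) = (LINT y:{..a}|N. \<sigma> y) + (if x < z then 0 else P z * measure N {z})"
    if x: "x \<in> {a<..<b}" for x
  proof -
    have i: "integrable N (\<lambda>y. indicator {..x} y * \<sigma> y)" for x
    proof -
      have "integrable N (\<lambda>y. indicator ({..x} \<inter> space N) y *\<^sub>R \<sigma> y)"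
        by (rule integrable_mult_indicator[OF Iic_Int_measurable[OF sN] \<sigma>i])
      then show ?thesis
        by (rule Bochner_Integration.integrable_cong[THEN iffD1, OF refl, rotated]) (auto simp: indicator_def)
    qed
    have iz: "integrable N (\<lambda>y. indicator {z} y * \<sigma> y)" using integrable_mult_indicator[OF zN \<sigma>i] by simp
    define t :: real where "t = (if x < z then 0 else 1)"
    have "(LINT y|N. indicator {..x} y * \<sigma> y) = (LINT y|N. indicator {..a} y * \<sigma> y + t * (indicator {z} y * \<sigma> y))"
    proof (rule integral_cong_AE)
      show "AE y in N. indicator {..x} y * \<sigma> y = indicator {..a} y * \<sigma> y + t * (indicator {z} y * \<sigma> y)"
        using AE
      proof eventually_elim
        case (elim y)
        then have "(indicator {..x} y :: real) = indicator {..a} y + t * indicator {z} y"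
          using x ab by (cases "y \<le> a"; cases "y \<le> x"; cases "y = z") (simp_all add: t_def)
        then show ?case by (simp only: distrib_right mult.assoc)
      qed
    qed (use i iz in simp_all)
    also have "\<dots> = (LINT y|N. indicator {..a} y * \<sigma> y) + t * (LINT y|N. indicator {z} y * \<sigma> y)"
      using i iz by simp
    also have "(LINT y|N. indicator {z} y * \<sigma> y) = P z * measure N {z}"
      using singular_part_atom(1)[OF zI] by (simp add: set_lebesgue_integral_def)
    finally show ?thesis by (simp add: set_lebesgue_integral_def t_def)
  qed
  obtain C where C: "AE x in lebesgue. x \<in> {0<..<1} \<longrightarrow>
     u x = C + (LINT y:{..x}|unit_lborel. P y / sqrt (1 - (P y)\<^sup>2)) + (LINT y:{..x}|N. \<sigma> y)"
    using solution_representation by blast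
  show ?thesis
  proof (rule exI[of _ "C + (LINT y:{..a}|N. \<sigma> y)"], rule exI[of _ "measure N {z}"], intro conjI impI)
    show "AE x in lebesgue. x \<in> {a<..<b} \<longrightarrow> u x = C + (LINT y:{..a}|N. \<sigma> y) +
        (LINT y:{..x}|unit_lborel. P y / sqrt (1 - (P y)\<^sup>2)) + (if x < z then 0 else P z * measure N {z})"
      using C
    proof eventually_elim
      case (elim x)
      show ?case
      proof
        assume x: "x \<in> {a<..<b}"
        then have "x \<in> {0<..<1}" using ab by auto
        with elim jump[OF x] show "u x = C + (LINT y:{..a}|N. \<sigma> y) +
          (LINT y:{..x}|unit_lborel. P y / sqrt (1 - (P y)\<^sup>2)) + (if x < z then 0 else P z * measure N {z})"
          by linarith
      qed
    qed
    show "\<bar>P z\<bar> = 1" if "measure N {z} \<noteq> 0" by (rule singular_part_atom(2)[OF zI that])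
  qed simp
qed

end

lemma bv_solution_structure:
  assumes h: "h absolutely_integrable_on {0<..<1}" and sol: "bv_solution h u"
  obtains P :: "real \<Rightarrow> real" where
    "\<forall>s t. 0 < s \<and> s \<le> t \<and> t < 1 \<longrightarrow> P s - P t = integral {s..t} h"
    "AE x in unit_lborel. \<bar>P x\<bar> < 1"
    "integrable unit_lborel (\<lambda>x. P x / sqrt (1 - (P x)\<^sup>2))"
    "\<forall>a z b. 0 \<le> a \<and> a < z \<and> z < b \<and> b \<le> 1 \<and> (\<forall>x\<in>{a<..<b} - {z}. \<bar>P x\<bar> < 1) \<longrightarrow>
      (\<exists>C m. 0 \<le> m \<and> (m \<noteq> 0 \<longrightarrow> \<bar>P z\<bar> = 1) \<and>
       (AE x in lebesgue. x \<in> {a<..<b} \<longrightarrow>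
          u x = C + (LINT y:{..x}|unit_lborel. P y / sqrt (1 - (P y)\<^sup>2)) + (if x < z then 0 else P z * m)))"
proof -
  from sol obtain Du Dua Dus \<sigma> where
    Du: "is_derivative_measure {0<..<1} u Du" and
    dec: "lebesgue_decomposition {0<..<1} Du Dua Dus" and
    dens: "is_signed_density (total_variation (borel_on {0<..<1}) Dus) Dus \<sigma>" and
    weak: "bv_equation h Dua Dus \<sigma>"
    unfolding bv_solution_def bv_equation_def by blast
  have u: "u absolutely_integrable_on {0<..<1}" using sol by (simp add: bv_solution_def BV_def)
  obtain H where H: "source_potential h H" using source_potential_exists[OF h] by blast
  define N where N: "N = total_variation (borel_on {0<..<1}) Dus"
  obtain c where flux: "AE x in lebesgue. x \<in> {0<..<1} \<longrightarrow> Dua x / sqrt (1 + (Dua x)\<^sup>2) = c - H x"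
    and sing: "\<forall>B\<in>sets (borel_on {0<..<1}). \<forall>\<alpha> \<beta>. B \<subseteq> {\<alpha>..\<beta>} \<and> 0 < \<alpha> \<and> \<alpha> < \<beta> \<and> \<beta> < 1 \<longrightarrow>
       (LINT x:B|N. \<sigma> x) = (LINT x:B|N. c - H x)"
    by (rule bv_solution_flux[OF u Du dec dens N weak H])
  define P where "P x = c - H x" for x
  obtain B where B: "\<And>x. \<bar>H x\<bar> \<le> B" and Hm: "H \<in> borel_measurable borel"
    using H unfolding source_potential_def by blast
  have Pm: "P \<in> borel_measurable borel" unfolding P_def using Hm by simp
  have "\<bar>P x\<bar> \<le> \<bar>c\<bar> + B" for x using B[of x] unfolding P_def by linarith
  then have Pb: "\<exists>B. \<forall>x. \<bar>P x\<bar> \<le> B" by blast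
  note all = u Du dec dens N Pm Pb flux[folded P_def] sing[folded P_def]
  show ?thesis
  proof (rule that)
    show "\<forall>s t. 0 < s \<and> s \<le> t \<and> t < 1 \<longrightarrow> P s - P t = integral {s..t} h"
      using H by (simp add: P_def source_potential_def)
    have "AE x in lebesgue. x \<in> {0<..<1} \<longrightarrow> \<bar>P x\<bar> < 1"
      using flux[folded P_def] by eventually_elim (auto dest: inverse_flux(1))
    then show "AE x in unit_lborel. \<bar>P x\<bar> < 1" unfolding AE_lebesgue_unit .
    show "integrable unit_lborel (\<lambda>x. P x / sqrt (1 - (P x)\<^sup>2))"
      by (rule integrable_gradient(1)[OF all])
  qed (intro allI impI representation_one_jump[OF all]; blast)
qed

section \<open>Weak derivatives from local primitives\<close>

lemma set_lebesgue_integral_Ioo_eq_integral: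
  fixes f :: "real \<Rightarrow> real"
  assumes "f absolutely_integrable_on {a<..<b}"
  shows "(LINT x:{a<..<b}|lebesgue. f x) = integral {a..b} f"
  using set_lebesgue_integral_eq_integral(2)[OF assms] integral_open_interval_real by metis

lemma AE_unit_ex_between:
  assumes "AE x in unit_lborel. Q x" "0 \<le> s" "s < t" "t \<le> 1"
  obtains x where "s < x" "x < t" "Q x"
proof -
  have "\<exists>x\<in>{s<..<t}. Q x"
  proof (rule ccontr)
    assume n: "\<not> (\<exists>x\<in>{s<..<t}. Q x)"
    have "AE x in lborel. x \<in> {0<..<1} \<longrightarrow> Q x" using assms(1) unfolding AE_unit_lborel_iff .
    then have AE: "AE x in lborel. x \<notin> {s<..<t}"
      by eventually_elim (use n assms in auto)
    have "{x \<in> space lborel. \<not> x \<notin> {s<..<t}} = {s<..<t}" by auto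
    from AE_iff_measurable[THEN iffD1, OF _ this AE] have "emeasure lborel {s<..<t} = 0" by simp
    then show False using assms by simp
  qed
  then show ?thesis using that by auto
qed

lemma C1_test_function_Icc:
  assumes \<psi>: "\<psi> \<in> C1_compact_support {a<..<b}" and ab: "a < b"
  obtains s t where "a < s" "s \<le> t" "t < b" "closure {x. \<psi> x \<noteq> 0} \<subseteq> {s..t}"
proof (cases "closure {x. \<psi> x \<noteq> 0} = {}")
  case True
  show ?thesis by (rule that[of "(a + b) / 2" "(a + b) / 2"]) (use True ab in \<open>auto simp: field_simps\<close>)
next
  case False
  let ?S = "closure {x. \<psi> x \<noteq> 0}"
  note c = C1_test_function_support[OF \<psi>]
  obtain s where s: "s \<in> ?S" "\<And>x. x \<in> ?S \<Longrightarrow> s \<le> x" using compact_attains_inf[OF c(1) False] by blast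
  obtain t where t: "t \<in> ?S" "\<And>x. x \<in> ?S \<Longrightarrow> x \<le> t" using compact_attains_sup[OF c(1) False] by blast
  show ?thesis
  proof (rule that)
    show "a < s" "t < b" using s(1) t(1) c(2) by auto
    show "s \<le> t" using s(2)[OF t(1)] .
    show "?S \<subseteq> {s..t}" using s(2) t(2) by auto
  qed
qed

text \<open>
  A test function is supported in some \<open>[s, t]\<close>, and after cutting off \<open>f\<close> and \<open>g\<close> outside \<open>[s, t]\<close> the Fubini
  argument for functions that are integrable on the whole of \<open>(0,1)\<close> applies.
\<close>

lemma weak_derivative_of_local_primitive:
  fixes f g :: "real \<Rightarrow> real"
  assumes ab: "0 \<le> a" "a < b" "b \<le> 1"
    and f: "\<And>s t. a < s \<Longrightarrow> s \<le> t \<Longrightarrow> t < b \<Longrightarrow> f absolutely_integrable_on {s..t}"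
    and g: "\<And>s t. a < s \<Longrightarrow> s \<le> t \<Longrightarrow> t < b \<Longrightarrow> g absolutely_integrable_on {s..t}"
    and prim: "\<And>s t. a < s \<Longrightarrow> s \<le> t \<Longrightarrow> t < b \<Longrightarrow>
      \<exists>c. AE x in lebesgue. x \<in> {s..t} \<longrightarrow> f x = c + integral {s..x} g"
  shows "weak_derivative {a<..<b} f g"
proof -
  have L1: "k \<in> L1_loc {a<..<b}"
    if k: "\<And>s t. a < s \<Longrightarrow> s \<le> t \<Longrightarrow> t < b \<Longrightarrow> k absolutely_integrable_on {s..t}" for k :: "real \<Rightarrow> real"
    unfolding L1_loc_def
  proof (intro CollectI allI impI)
    fix K :: "real set" assume K: "compact K \<and> K \<subseteq> {a<..<b}"
    show "k absolutely_integrable_on K"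
    proof (cases "K = {}")
      case False
      obtain s where s: "s \<in> K" "\<And>x. x \<in> K \<Longrightarrow> s \<le> x" using compact_attains_inf[of K] K False by blast
      obtain t where t: "t \<in> K" "\<And>x. x \<in> K \<Longrightarrow> x \<le> t" using compact_attains_sup[of K] K False by blast
      have "k absolutely_integrable_on {s..t}" using s t K by (intro k) auto
      then show ?thesis
        by (rule set_integrable_subset) (use K s t in \<open>auto simp: compact_imp_closed\<close>)
    qed simp
  qed
  show ?thesis
    unfolding weak_derivative_def
  proof (intro conjI L1 f g ballI)
    fix \<psi> assume \<psi>I: "\<psi> \<in> C1_compact_support {a<..<b}"
    obtain s t where st: "a < s" "s \<le> t" "t < b" and supp: "closure {x. \<psi> x \<noteq> 0} \<subseteq> {s..t}"
      by (rule C1_test_function_Icc[OF \<psi>I ab(2)])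
    have "{a<..<b} \<subseteq> {0<..<1}" using ab by auto
    then have \<psi>: "\<psi> \<in> C1_compact_support {0<..<1}" using \<psi>I by (auto simp: C1_compact_support_def)
    note p = C1_test_function_props[OF \<psi>] and bm = C1_test_function_bounded_measurable[OF \<psi>]
    have out: "\<psi> x = 0" "deriv \<psi> x = 0" if "x \<notin> {s..t}" for x using p(3,4) supp that by blast+
    have st01: "0 < s" "t < 1" using st ab by auto
    have stI: "{s..t} \<subseteq> {0<..<1}" "{s..t} \<subseteq> {a<..<b}" using st ab by auto
    have local: "(LINT x:{a<..<b}|lebesgue. k x * \<theta> x) = (LINT x:{0<..<1}|lebesgue. (indicator {s..t} x * k x) * \<theta> x)"
      if "\<And>x. x \<notin> {s..t} \<Longrightarrow> \<theta> x = 0" for k \<theta> :: "real \<Rightarrow> real"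
      unfolding set_lebesgue_integral_def
    proof (intro Bochner_Integration.integral_cong refl)
      fix x show "indicator {a<..<b} x *\<^sub>R (k x * \<theta> x) = indicator {0<..<1} x *\<^sub>R ((indicator {s..t} x * k x) * \<theta> x)"
        using that[of x] stI by (cases "x \<in> {s..t}") (auto simp: indicator_def)
    qed
    have ai: "(\<lambda>x. indicator {s..t} x * k x) absolutely_integrable_on {0<..<1}" if "k absolutely_integrable_on {s..t}" for k :: "real \<Rightarrow> real"
    proof -
      have "(\<lambda>x. indicator {0<..<1} x *\<^sub>R (indicator {s..t} x * k x)) = (\<lambda>x. indicator {s..t} x *\<^sub>R k x)"
        using stI by (auto simp: indicator_def fun_eq_iff)
      then show ?thesis using that by (simp add: set_integrable_def)
    qed
    obtain f' where f': "AE x in lebesgue. x \<in> {0<..<1} \<longrightarrow> indicator {s..t} x * f x = f' x"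
      "\<And>k. k \<in> borel_measurable unit_lborel \<Longrightarrow>
        (LINT x:{0<..<1}|lebesgue. (indicator {s..t} x * f x) * k x) = (LINT x|unit_lborel. f' x * k x)"
      and f'i: "integrable unit_lborel f'"
      by (rule borel_representative[OF ai[OF f[OF st]]]) blast
    obtain g' where g': "AE x in lebesgue. x \<in> {0<..<1} \<longrightarrow> indicator {s..t} x * g x = g' x"
      "\<And>k. k \<in> borel_measurable unit_lborel \<Longrightarrow>
        (LINT x:{0<..<1}|lebesgue. (indicator {s..t} x * g x) * k x) = (LINT x|unit_lborel. g' x * k x)"
      and g'i: "integrable unit_lborel g'"
      by (rule borel_representative[OF ai[OF g[OF st]]]) blast
    let ?F = "\<lambda>x. LINT y:{..x}|unit_lborel. g' y"
    have F: "?F x = integral {s..x} g" if x: "x \<in> {s..t}" for x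
    proof -
      have "?F x = integral {0..x} (\<lambda>y. indicator {0<..<1} y * g' y)"
        using x stI by (intro unit_initial_integral[OF g'i]) auto
      also have "\<dots> = integral {0..x} (\<lambda>y. if y \<in> {s..x} then g y else 0)"
      proof (rule integral_spike)
        show "negligible {y. \<not> (y \<in> {0<..<1} \<longrightarrow> indicator {s..t} y * g y = g' y)}"
          using g'(1) by (simp add: eventually_ae_filter_negligible) (meson negligible_subset)
      qed (use x st01 in \<open>auto simp: indicator_def split: if_splits\<close>)
      also have "\<dots> = integral {s..x} g"
        unfolding integral_restrict_Int using x st01 by simp
      finally show ?thesis .
    qed
    obtain c where c: "AE x in lebesgue. x \<in> {s..t} \<longrightarrow> f x = c + integral {s..x} g" using prim[OF st] by blast
    have m: "deriv \<psi> \<in> borel_measurable unit_lborel" "\<psi> \<in> borel_measurable unit_lborel"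
      by (rule borel_measurable_unit[OF sets_unit_lborel] bm(3,4))+
    have "AE x in lebesgue. x \<in> {0<..<1} \<longrightarrow> f' x * deriv \<psi> x = (c + ?F x) * deriv \<psi> x"
      using f'(1) c
    proof eventually_elim
      case (elim x)
      then show ?case using out(2)[of x] F[of x] by (cases "x \<in> {s..t}") auto
    qed
    then have AE: "AE x in unit_lborel. f' x * deriv \<psi> x = (c + ?F x) * deriv \<psi> x"
      unfolding AE_lebesgue_unit .
    have "(LINT x:{a<..<b}|lebesgue. f x * deriv \<psi> x)
        = (LINT x:{0<..<1}|lebesgue. (indicator {s..t} x * f x) * deriv \<psi> x)"
      by (rule local) (rule out(2))
    also have "\<dots> = (LINT x|unit_lborel. f' x * deriv \<psi> x)" by (rule f'(2)[OF m(1)])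
    also have "\<dots> = (LINT x|unit_lborel. (c + ?F x) * deriv \<psi> x)"
    proof (rule integral_cong_AE[OF _ _ AE])
      show "(\<lambda>x. f' x * deriv \<psi> x) \<in> borel_measurable unit_lborel" using f'i m(1) by simp
      show "(\<lambda>x. (c + ?F x) * deriv \<psi> x) \<in> borel_measurable unit_lborel"
        by (intro borel_measurable_times borel_measurable_add borel_measurable_const m(1)
            borel_measurable_unit[OF sets_unit_lborel
              borel_measurable_initial_integral[OF finite_measure_unit_lborel sets_unit_lborel g'i]])
    qed
    also have "\<dots> = - (LINT x|unit_lborel. g' x * \<psi> x)"
      by (rule initial_integral_test_function[OF finite_measure_unit_lborel sets_unit_lborel g'i _ \<psi>]) simp
    also have "(LINT x|unit_lborel. g' x * \<psi> x)
        = (LINT x:{0<..<1}|lebesgue. (indicator {s..t} x * g x) * \<psi> x)"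
      by (rule g'(2)[OF m(2), symmetric])
    also have "\<dots> = (LINT x:{a<..<b}|lebesgue. g x * \<psi> x)"
      by (rule local[symmetric]) (rule out(1))
    finally show "(LINT x:{a<..<b}|lebesgue. f x * deriv \<psi> x) = - (LINT x:{a<..<b}|lebesgue. g x * \<psi> x)" .
  qed
qed

section \<open>The flux under the sign condition\<close>

text \<open>
  Here \<open>p\<close> is a value of the flux, \<open>p / sqrt (1 - p\<^sup>2)\<close> the corresponding slope of \<open>u\<close>, and \<open>q\<close> the value of the
  flux at \<open>z\<close>. Both estimates use \<open>1 - p\<^sup>2 = (1 - p) (1 + p)\<close>. The first one combines two regimes: for
  \<open>p \<le> - 1/2\<close> one has \<open>sqrt (1 - p) \<le> 3/2 \<le> 3 \<bar>p\<bar>\<close>, and otherwise \<open>1 + p\<close> is bounded below. The second one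
  rests on \<open>- p < sqrt (1 - p)\<close>.
\<close>

lemma
  fixes p q :: real
  assumes "-1 < p" "p < 1"
  shows inverse_sqrt_le_gradient: "(1 + p) powr (- 1/2) \<le> 3 * \<bar>p / sqrt (1 - p\<^sup>2)\<bar> + 3"
    and neg_gradient_less: "-1 \<le> q \<Longrightarrow> q < p \<Longrightarrow> - (p / sqrt (1 - p\<^sup>2)) < (p - q) powr (- 1/2)"
proof -
  have pw: "x powr (- 1/2) = 1 / sqrt x" if "0 < x" for x :: real
    using that by (simp add: powr_minus_divide powr_half_sqrt[symmetric])
  have sq: "sqrt (1 - p\<^sup>2) = sqrt (1 - p) * sqrt (1 + p)"
    by (simp add: real_sqrt_mult[symmetric] power2_eq_square algebra_simps)
  have s: "0 < sqrt (1 + p)" "0 < sqrt (1 - p)" using assms by auto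
  show "(1 + p) powr (- 1/2) \<le> 3 * \<bar>p / sqrt (1 - p\<^sup>2)\<bar> + 3"
  proof (cases "p \<le> - 1/2")
    case True
    have "sqrt (1 - p) \<le> sqrt ((3/2)\<^sup>2)" using assms by (intro real_sqrt_le_mono) (simp add: power2_eq_square)
    then have "sqrt (1 - p) \<le> 3 * \<bar>p\<bar>" using True by simp
    then have "1 / sqrt (1 + p) \<le> 3 * \<bar>p\<bar> / (sqrt (1 - p) * sqrt (1 + p))"
      using s by (simp add: field_simps)
    moreover have "0 < 1 + p" using assms by simp
    ultimately show ?thesis unfolding pw[OF \<open>0 < 1 + p\<close>] sq using s by (simp add: abs_mult)
  next
    case False
    have "1 / 2 \<le> sqrt (1 + p)" using False by (intro real_le_rsqrt) (simp add: power2_eq_square)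
    then have "1 / sqrt (1 + p) \<le> 3" using s by (simp add: field_simps)
    moreover have "0 \<le> \<bar>p / sqrt (1 - p\<^sup>2)\<bar>" by simp
    moreover have "0 < 1 + p" using assms by simp
    ultimately show ?thesis unfolding pw[OF \<open>0 < 1 + p\<close>] by linarith
  qed
  assume q: "-1 \<le> q" "q < p"
  have "- p < sqrt (1 - p)"
  proof (cases "p < 0")
    case True
    then have "1 < sqrt (1 - p)" by simp
    then show ?thesis using assms by linarith
  qed (use s in linarith)
  then have "- p / (sqrt (1 - p) * sqrt (1 + p)) < 1 / sqrt (1 + p)"
    using s by (simp add: field_simps)
  also have "\<dots> \<le> 1 / sqrt (p - q)"
    using q assms by (intro divide_left_mono) auto
  finally show "- (p / sqrt (1 - p\<^sup>2)) < (p - q) powr (- 1/2)"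
    using q pw[of "p - q"] by (simp add: sq)
qed

lemma gradient_of_flux_has_derivative:
  fixes p :: real
  assumes "p \<in> {-1<..<1}"
  shows "((\<lambda>p. p / sqrt (1 - p\<^sup>2)) has_real_derivative 1 / (sqrt (1 - p\<^sup>2)) ^ 3) (at p within {-1<..<1})"
proof -
  have "p\<^sup>2 < 1" using assms by (simp add: abs_square_less_1 abs_less_iff)
  then have pos: "0 < 1 - p\<^sup>2" by simp
  have "sqrt (1 - p\<^sup>2) * sqrt (1 - p\<^sup>2) = 1 - p\<^sup>2" using pos by simp
  then show ?thesis using pos
    by (auto intro!: derivative_eq_intros simp: field_simps power2_eq_square power3_eq_cube)
qed

context
  fixes h P :: "real \<Rightarrow> real" and a z b :: real
  assumes h: "h absolutely_integrable_on {0<..<1}"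
    and ab: "0 \<le> a" "a < z" "z < b" "b \<le> 1"
    and h_pos: "AE x in lebesgue. x \<in> {a<..<z} \<longrightarrow> h x \<ge> 0"
    and h_neg: "AE x in lebesgue. x \<in> {z<..<b} \<longrightarrow> h x \<le> 0"
    and flux: "\<forall>s t. 0 < s \<and> s \<le> t \<and> t < 1 \<longrightarrow> P s - P t = integral {s..t} h"
    and P_AE: "AE x in unit_lborel. \<bar>P x\<bar> < 1"
begin

lemma flux_integral: "0 < s \<Longrightarrow> s \<le> t \<Longrightarrow> t < 1 \<Longrightarrow> P s - P t = integral {s..t} h"
  using flux by blast

lemma source_integrable_Ioo: "s \<in> {0..1} \<Longrightarrow> t \<in> {0..1} \<Longrightarrow> h absolutely_integrable_on {s<..<t}"
  by (rule set_integrable_subset[OF h]) auto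

lemma source_integrable_Icc: "0 < s \<Longrightarrow> t < 1 \<Longrightarrow> h absolutely_integrable_on {s..t}"
  by (rule set_integrable_subset[OF h]) auto

lemma flux_difference: "0 < s \<Longrightarrow> s \<le> t \<Longrightarrow> t < 1 \<Longrightarrow> P s - P t = (LINT x:{s<..<t}|lebesgue. h x)"
  by (subst set_lebesgue_integral_Ioo_eq_integral) (auto intro: source_integrable_Ioo flux_integral)

lemma integral_to_eq:
  assumes "x \<in> {0<..<1}"
  shows "integral_to h z x = P x - P z"
proof (cases "x \<le> z")
  case True
  then show ?thesis
    using assms ab flux_difference[of x z] by (simp add: integral_to_def interval_lebesgue_integral_def)
next
  case False
  then show ?thesis
    using assms ab flux_difference[of z x] by (simp add: integral_to_def interval_lebesgue_integral_def)
qed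

lemma flux_antimono_left:
  assumes "a < s" "s \<le> t" "t \<le> z" shows "P t \<le> P s"
proof -
  have "0 \<le> (LINT x:{s<..<t}|lebesgue. h x)"
    unfolding set_lebesgue_integral_def
    by (rule integral_nonneg_AE) (use h_pos in \<open>eventually_elim\<close>, use assms in \<open>auto simp: indicator_def\<close>)
  then show ?thesis using flux_difference[of s t] assms ab by simp
qed

lemma flux_mono_right:
  assumes "z \<le> s" "s \<le> t" "t < b" shows "P s \<le> P t"
proof -
  have "0 \<le> (LINT x|lebesgue. - (indicator {s<..<t} x *\<^sub>R h x))"
    by (rule integral_nonneg_AE) (use h_neg in \<open>eventually_elim\<close>, use assms in \<open>auto simp: indicator_def\<close>)
  then show ?thesis using flux_difference[of s t] assms ab by (simp add: set_lebesgue_integral_def)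
qed

text \<open>
  As \<open>P\<close> is monotone on the side of \<open>z\<close> containing \<open>x\<close>, its value at \<open>x\<close> lies between two values at points on
  that side where \<open>\<bar>P\<bar> < 1\<close>; such points exist on both sides of \<open>x\<close> because \<open>\<bar>P\<bar> < 1\<close> almost everywhere.
\<close>

lemma flux_strict:
  assumes x: "x \<in> {a<..<b} - {z}" shows "\<bar>P x\<bar> < 1"
proof (cases "x < z")
  case True
  obtain s where s: "a < s" "s < x" "\<bar>P s\<bar> < 1" by (rule AE_unit_ex_between[OF P_AE, of a x]) (use x True ab in auto)
  obtain t where t: "x < t" "t < z" "\<bar>P t\<bar> < 1" by (rule AE_unit_ex_between[OF P_AE, of x z]) (use x True ab in auto)
  show ?thesis using flux_antimono_left[of s x] flux_antimono_left[of x t] s t True x by auto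
next
  case False
  obtain s where s: "z < s" "s < x" "\<bar>P s\<bar> < 1" by (rule AE_unit_ex_between[OF P_AE, of z x]) (use x False ab in auto)
  obtain t where t: "x < t" "t < b" "\<bar>P t\<bar> < 1" by (rule AE_unit_ex_between[OF P_AE, of x b]) (use x False ab in auto)
  show ?thesis using flux_mono_right[of s x] flux_mono_right[of x t] s t False x by auto
qed

lemma flux_min: "x \<in> {a<..<b} \<Longrightarrow> P z \<le> P x"
  using flux_antimono_left[of x z] flux_mono_right[of z x] by (cases "x \<le> z") auto

lemma flux_continuous: "continuous_on {a<..<b} P"
proof -
  have "continuous (at x) P" if x: "x \<in> {a<..<b}" for x
  proof -
    define s t where "s = (a + x) / 2" and "t = (x + b) / 2"
    have st: "a < s" "s < x" "x < t" "t < b" using x by (auto simp: s_def t_def)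
    have "continuous_on {s..t} (\<lambda>y. P s - integral {s..y} h)"
      using source_integrable_Icc[of s t] st ab
      by (intro continuous_intros indefinite_integral_continuous_1) (auto simp: absolutely_integrable_on_def)
    then have "continuous_on {s..t} P"
      by (rule continuous_on_eq) (use st ab in \<open>auto simp: flux_integral[symmetric]\<close>)
    then have "continuous_on {s<..<t} P" by (rule continuous_on_subset) auto
    then show ?thesis using st by (simp add: continuous_on_eq_continuous_at)
  qed
  then show ?thesis by (simp add: continuous_at_imp_continuous_on)
qed

text \<open>
  At \<open>z\<close> itself the lower bound survives only as a weak inequality, by continuity. The upper bound is strict because
  \<open>z\<close> is the minimum point.
\<close>

lemma flux_bounds_at_z: "-1 \<le> P z" "P z < 1"
proof -
  have z: "z \<in> {a<..<b}" using ab by auto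
  then have "(P \<longlongrightarrow> P z) (at z)"
    using flux_continuous by (simp add: continuous_on_eq_continuous_at isCont_def)
  moreover have "\<forall>\<^sub>F x in at z. x \<in> {a<..<b}"
    using z by (intro eventually_at_in_open') auto
  then have "\<forall>\<^sub>F x in at z. -1 \<le> P x"
    using eventually_neq_at_within[of z z UNIV]
  proof eventually_elim
    case (elim x)
    then show ?case using flux_strict[of x] by (simp add: abs_less_iff)
  qed
  ultimately show "-1 \<le> P z" by (rule tendsto_lowerbound) simp
  obtain x where "a < x" "x < z" by (rule dense[OF ab(2), THEN exE]) blast
  then show "P z < 1" using flux_min[of x] flux_strict[of x] ab by auto
qed

text \<open>
  The chain rule for \<open>p / sqrt (1 - p\<^sup>2)\<close>, whose derivative is \<open>1 / sqrt (1 - p\<^sup>2) ^ 3\<close>. The hypothesis at \<open>z\<close>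
  completes \<open>\<bar>P\<bar> < 1\<close> to the whole interval; on compact subintervals \<open>P\<close> then stays away from \<open>\<plusminus>1\<close>, and the
  factor in front of \<open>h\<close> is bounded.
\<close>

lemma gradient_weak_derivative:
  assumes "\<bar>P z\<bar> < 1"
  shows "weak_derivative {a<..<b} (\<lambda>x. P x / sqrt (1 - (P x)\<^sup>2)) (\<lambda>x. 1 / (sqrt (1 - (P x)\<^sup>2)) ^ 3 * (- h x))"
proof -
  let ?\<Phi> = "\<lambda>p::real. p / sqrt (1 - p\<^sup>2)" and ?\<Phi>' = "\<lambda>p::real. 1 / (sqrt (1 - p\<^sup>2)) ^ 3"
  have J: "P x \<in> {-1<..<1}" if "x \<in> {a<..<b}" for x
    using flux_strict[of x] that assms by (cases "x = z") auto
  have "1 - p\<^sup>2 \<noteq> 0" if "p \<in> {-1<..<1}" for p :: real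
    using that by (metis abs_less_iff abs_square_less_1 diff_gt_0_iff_gt greaterThanLessThan_iff less_irrefl minus_less_iff)
  then have cont: "continuous_on {-1<..<1} ?\<Phi>'"
    by (intro continuous_intros) auto
  have chain: "(\<lambda>x. ?\<Phi>' (P x) * (- h x)) absolutely_integrable_on {s..x}"
      "?\<Phi> (P x) - ?\<Phi> (P s) = integral {s..x} (\<lambda>x. ?\<Phi>' (P x) * (- h x))"
    if sx: "a < s" "s \<le> x" "x < b" for s x
  proof -
    have 1: "(\<lambda>x. - h x) absolutely_integrable_on {s..x}"
      using source_integrable_Icc[of s x] sx ab by (simp add: set_integrable_def)
    have 2: "P y = P s + integral {s..y} (\<lambda>x. - h x)" if "y \<in> {s..x}" for y
      using flux_integral[of s y] that sx ab by simp
    have 3: "is_interval {-1<..<1::real}" by (rule is_interval_oo)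
    have 4: "P ` {s..x} \<subseteq> {-1<..<1}" using J sx by fastforce
    note c = chain_rule_indefinite_integral[where \<Phi> = ?\<Phi> and \<Phi>' = ?\<Phi>' and P = P and h = "\<lambda>x. - h x",
        OF sx(2) 1 2 3 4 gradient_of_flux_has_derivative cont]
    show "(\<lambda>x. ?\<Phi>' (P x) * (- h x)) absolutely_integrable_on {s..x}"
      "?\<Phi> (P x) - ?\<Phi> (P s) = integral {s..x} (\<lambda>x. ?\<Phi>' (P x) * (- h x))"
      using c by auto
  qed
  show ?thesis
  proof (rule weak_derivative_of_local_primitive)
    fix s t assume st: "a < s" "s \<le> t" "t < b"
    show "(\<lambda>x. ?\<Phi>' (P x) * (- h x)) absolutely_integrable_on {s..t}" by (rule chain(1)[OF st])
    have "continuous_on {s..t} (\<lambda>x. ?\<Phi> (P x))"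
    proof (rule continuous_on_eq)
      show "continuous_on {s..t} (\<lambda>x. ?\<Phi> (P s) + integral {s..x} (\<lambda>x. ?\<Phi>' (P x) * (- h x)))"
        using chain(1)[OF st]
        by (intro continuous_intros indefinite_integral_continuous_1) (simp only: absolutely_integrable_on_def)
      show "?\<Phi> (P s) + integral {s..x} (\<lambda>x. ?\<Phi>' (P x) * (- h x)) = ?\<Phi> (P x)" if "x \<in> {s..t}" for x
        using chain(2)[of s x] that st by simp
    qed
    then show "(\<lambda>x. ?\<Phi> (P x)) absolutely_integrable_on {s..t}" by (rule absolutely_integrable_continuous_real)
    show "\<exists>c. AE x in lebesgue. x \<in> {s..t} \<longrightarrow> ?\<Phi> (P x) = c + integral {s..x} (\<lambda>x. ?\<Phi>' (P x) * (- h x))"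
    proof (intro exI AE_I2 impI)
      show "?\<Phi> (P x) = ?\<Phi> (P s) + integral {s..x} (\<lambda>x. ?\<Phi>' (P x) * (- h x))" if "x \<in> {s..t}" for x
        using chain(2)[of s x] that st by simp
    qed
  qed (use ab in auto)
qed

end

section \<open>Regularity or a jump at the sign change\<close>

theorem theorem7p1:
  fixes h u :: "real \<Rightarrow> real" and z \<delta>1 \<delta>2 :: real
  assumes "h absolutely_integrable_on {0<..<1}"
    and "z \<in> {0<..<1}" and "\<delta>1 > 0" and "\<delta>2 > 0"
    and "{z - \<delta>1<..<z + \<delta>2} \<subseteq> {0<..<1}"
    and "AE x in lebesgue. x \<in> {z - \<delta>1<..<z} \<longrightarrow> h x \<ge> 0"
    and "AE x in lebesgue. x \<in> {z<..<z + \<delta>2} \<longrightarrow> h x \<le> 0"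
    and "bv_solution h u"
  shows
    "((\<integral>\<^sup>+x\<in>{z - \<delta>1<..<z}. ennreal (integral_to h z x powr (- 1/2)) \<partial>lebesgue) = \<infinity> \<or>
      (\<integral>\<^sup>+x\<in>{z<..<z + \<delta>2}. ennreal (integral_to h z x powr (- 1/2)) \<partial>lebesgue) = \<infinity> \<or>
      (\<exists>x0\<in>{z - \<delta>1<..<z + \<delta>2} - {z}. integral_to h z x0 = 0)
        \<longrightarrow> u \<in> W21_loc {z - \<delta>1<..<z + \<delta>2})
     \<and>
     (\<exists>w u_left u_right.
        continuous_representative u (z - \<delta>1) z (z + \<delta>2) w \<and>
        (w \<longlongrightarrow> u_left) (at_left z) \<and> (w \<longlongrightarrow> u_right) (at_right z) \<and>
        ((\<forall>x\<in>{z - \<delta>1<..<z + \<delta>2} - {z}. integral_to h z x > 0) \<and>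
         (\<exists>x1\<in>{z - \<delta>1<..<z}. \<exists>x2\<in>{z<..<z + \<delta>2}.
            (\<integral>\<^sup>+x\<in>{x1<..<z}. ennreal (integral_to h z x powr (- 1/2)) \<partial>lebesgue) < \<infinity> \<and>
            (\<integral>\<^sup>+x\<in>{z<..<x2}. ennreal (integral_to h z x powr (- 1/2)) \<partial>lebesgue) < \<infinity> \<and>
            (LINT x:{x1<..<x2}|lebesgue. integral_to h z x powr (- 1/2)) \<le> w x1 - w x2)
          \<longrightarrow> u_left > u_right))"
proof -
  define a where "a = z - \<delta>1"
  define b where "b = z + \<delta>2"
  let ?I = "{a<..<b}" and ?O = "{0<..<1::real}"
  have azb: "a < z" "z < b" using assms(3,4) by (auto simp: a_def b_def)
  have ab: "0 \<le> a" "a < z" "z < b" "b \<le> 1"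
    using assms(5) azb by (auto simp: a_def[symmetric] b_def[symmetric] greaterThanLessThan_subseteq_greaterThanLessThan)
  have hp: "AE x in lebesgue. x \<in> {a<..<z} \<longrightarrow> h x \<ge> 0" and hn: "AE x in lebesgue. x \<in> {z<..<b} \<longrightarrow> h x \<le> 0"
    using assms(6,7) by (simp_all add: a_def b_def)
  obtain P where P: "\<forall>s t. 0 < s \<and> s \<le> t \<and> t < 1 \<longrightarrow> P s - P t = integral {s..t} h"
    and P_AE: "AE x in unit_lborel. \<bar>P x\<bar> < 1"
    and G_int: "integrable unit_lborel (\<lambda>x. P x / sqrt (1 - (P x)\<^sup>2))"
    and rep: "\<forall>a z b. 0 \<le> a \<and> a < z \<and> z < b \<and> b \<le> 1 \<and> (\<forall>x\<in>{a<..<b} - {z}. \<bar>P x\<bar> < 1) \<longrightarrow>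
      (\<exists>C m. 0 \<le> m \<and> (m \<noteq> 0 \<longrightarrow> \<bar>P z\<bar> = 1) \<and>
       (AE x in lebesgue. x \<in> {a<..<b} \<longrightarrow>
          u x = C + (LINT y:{..x}|unit_lborel. P y / sqrt (1 - (P y)\<^sup>2)) + (if x < z then 0 else P z * m)))"
    by (rule bv_solution_structure[OF assms(1,8)])
  note strict = flux_strict[OF assms(1) ab hp hn P P_AE]
    and min = flux_min[OF assms(1) ab hp hn P P_AE]
    and at_z = flux_bounds_at_z[OF assms(1) ab hp hn P P_AE]
    and integral_to = integral_to_eq[OF assms(1) ab hp hn P P_AE]
    and cont = flux_continuous[OF assms(1) ab hp hn P P_AE]
  define G where "G x = P x / sqrt (1 - (P x)\<^sup>2)" for x
  have Gi: "integrable unit_lborel G" unfolding G_def by (rule G_int)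
  have G_abs: "G absolutely_integrable_on ?O"
    using absolutely_integrable_iff_unit_lborel[OF borel_measurable_integrable[OF Gi]] Gi by blast
  define F where "F x = (LINT y:{..x}|unit_lborel. G y)" for x
  have IO: "?I \<subseteq> ?O" using ab by auto
  obtain C m where m: "0 \<le> m" "m \<noteq> 0 \<Longrightarrow> \<bar>P z\<bar> = 1"
    and u_eq: "AE x in lebesgue. x \<in> ?I \<longrightarrow> u x = C + F x + (if x < z then 0 else P z * m)"
    using rep[rule_format, of a z b] ab strict unfolding F_def G_def by blast
  have F_diff: "F t - F s = integral {s..t} G" if st: "0 < s" "s \<le> t" "t < 1" for s t
  proof -
    let ?k = "\<lambda>x. indicator ?O x * G x"
    have "F t - F s = integral {0..t} ?k - integral {0..s} ?k"
      using st by (simp add: F_def unit_initial_integral[OF Gi])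
    also have "\<dots> = integral {s..t} ?k"
      using Henstock_Kurzweil_Integration.integral_combine[of 0 s t ?k] st unit_extension_integrable[OF Gi] by simp
    also have "\<dots> = integral {s..t} G"
      by (rule Henstock_Kurzweil_Integration.integral_cong) (use st in \<open>auto simp: indicator_def\<close>)
    finally show ?thesis .
  qed
  have F_cont: "continuous_on ?O F"
  proof (rule continuous_on_eq)
    show "continuous_on ?O (\<lambda>x. integral {0..x} (\<lambda>x. indicator ?O x * G x))"
      by (rule continuous_on_subset[OF indefinite_integral_continuous_1[OF unit_extension_integrable[OF Gi], of 0 1]]) auto
  qed (simp add: F_def unit_initial_integral[OF Gi])
  have G_weak: "weak_derivative ?I G (\<lambda>x. 1 / (sqrt (1 - (P x)\<^sup>2)) ^ 3 * (- h x))" if "\<bar>P z\<bar> < 1"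
    unfolding G_def[abs_def] by (rule gradient_weak_derivative[OF assms(1) ab hp hn P P_AE that])
  \<comment> \<open>(a): the hypothesis rules out \<open>P z = - 1\<close>, the only value at which a jump is possible\<close>
  have partA: "u \<in> W21_loc ?I"
    if hyp: "(\<integral>\<^sup>+x\<in>{a<..<z}. ennreal (integral_to h z x powr (- 1/2)) \<partial>lebesgue) = \<infinity> \<or>
      (\<integral>\<^sup>+x\<in>{z<..<b}. ennreal (integral_to h z x powr (- 1/2)) \<partial>lebesgue) = \<infinity> \<or>
      (\<exists>x0\<in>?I - {z}. integral_to h z x0 = 0)"
  proof -
    have "P z \<noteq> -1"
    proof
      assume Pz: "P z = -1"
      \<comment> \<open>if \<open>P z = - 1\<close>, the integral of \<open>h\<close> from \<open>x\<close> to \<open>z\<close> is \<open>1 + P x\<close>\<close>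
      have bound: "integral_to h z x powr (- 1/2) \<le> 3 * \<bar>G x\<bar> + 3" "integral_to h z x \<noteq> 0" if x: "x \<in> ?I - {z}" for x
        using strict[OF x] integral_to[of x] x IO inverse_sqrt_le_gradient[of "P x"]
        by (auto simp: Pz G_def add.commute)
      have fin: "(\<integral>\<^sup>+x\<in>A. ennreal (integral_to h z x powr (- 1/2)) \<partial>lebesgue) < \<infinity>" if A: "A \<subseteq> ?I - {z}" for A
      proof -
        have "set_integrable lebesgue ?O (\<lambda>x. 3 * \<bar>G x\<bar> + 3)"
          using G_abs by (intro set_integral_add set_integrable_mult_right set_integrable_abs) (auto intro: absolutely_integrable_on_const)
        then have i: "integrable lebesgue (\<lambda>x. indicator ?O x * (3 * \<bar>G x\<bar> + 3))"
          by (simp add: set_integrable_def)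
        have "(\<integral>\<^sup>+x\<in>A. ennreal (integral_to h z x powr (- 1/2)) \<partial>lebesgue)
          \<le> (\<integral>\<^sup>+x. ennreal (norm (indicator ?O x * (3 * \<bar>G x\<bar> + 3))) \<partial>lebesgue)"
        proof (rule nn_integral_mono)
          fix x
          show "ennreal (integral_to h z x powr (- 1/2)) * indicator A x \<le> ennreal (norm (indicator ?O x * (3 * \<bar>G x\<bar> + 3)))"
          proof (cases "x \<in> A")
            case True
            then have x: "x \<in> ?I - {z}" "x \<in> ?O" using A IO by auto
            then show ?thesis using True ennreal_leI[OF bound(1)[OF x(1)]] by (simp del: ennreal_plus)
          qed simp
        qed
        also have "\<dots> < \<infinity>" using i by (simp add: integrable_iff_bounded)
        finally show ?thesis .
      qed
      have "{a<..<z} \<subseteq> ?I - {z}" "{z<..<b} \<subseteq> ?I - {z}" using ab by auto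
      from fin[OF this(1)] fin[OF this(2)] show False using hyp bound(2) by auto
    qed
    then have Pz: "\<bar>P z\<bar> < 1" using at_z by (simp add: abs_less_iff)
    then have m0: "m = 0" using m(2) by force
    have u_eq': "AE x in lebesgue. x \<in> ?I \<longrightarrow> u x = C + F x"
      using u_eq by eventually_elim (simp add: m0)
    have u_int: "u absolutely_integrable_on ?O" using assms(8) by (simp add: bv_solution_def BV_def)
    have "weak_derivative ?I u G"
    proof (rule weak_derivative_of_local_primitive)
      fix s t assume st: "a < s" "s \<le> t" "t < b"
      show "u absolutely_integrable_on {s..t}" "G absolutely_integrable_on {s..t}"
        using st ab by (auto intro: set_integrable_subset[OF u_int] set_integrable_subset[OF G_abs])
      have "AE x in lebesgue. x \<in> {s..t} \<longrightarrow> u x = (C + F s) + integral {s..x} G"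
        using u_eq'
      proof eventually_elim
        case (elim x)
        then show ?case using F_diff[of s x] st ab by auto
      qed
      then show "\<exists>c. AE x in lebesgue. x \<in> {s..t} \<longrightarrow> u x = c + integral {s..x} G" by blast
    qed (use ab in auto)
    then show ?thesis using G_weak[OF Pz] by (auto simp: W21_loc_def)
  qed
  define w where "w x = (if x \<in> ?I then C + F x + (if x < z then 0 else P z * m) else u x)" for x
  have w_rep: "continuous_representative u a z b w"
    unfolding continuous_representative_def
  proof (intro conjI)
    show "AE x in lebesgue. x \<in> ?O \<longrightarrow> w x = u x"
      using u_eq by eventually_elim (auto simp: w_def)
    show "continuous_on {a<..<z} w"
    proof (rule continuous_on_eq)
      show "continuous_on {a<..<z} (\<lambda>x. C + F x)"
        by (intro continuous_intros continuous_on_subset[OF F_cont]) (use ab in auto)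
    qed (use ab in \<open>auto simp: w_def\<close>)
    show "continuous_on {z<..<b} w"
    proof (rule continuous_on_eq)
      show "continuous_on {z<..<b} (\<lambda>x. C + F x + P z * m)"
        by (intro continuous_intros continuous_on_subset[OF F_cont]) (use ab in auto)
    qed (use ab in \<open>auto simp: w_def\<close>)
  qed
  have F_lim: "(F \<longlongrightarrow> F z) (at z)"
    using F_cont ab by (auto simp: continuous_on_eq_continuous_at isCont_def)
  have w_left: "(w \<longlongrightarrow> C + F z) (at_left z)"
  proof (rule Lim_transform_eventually)
    show "((\<lambda>x. C + F x) \<longlongrightarrow> C + F z) (at_left z)"
      by (intro tendsto_intros tendsto_within_subset[OF F_lim]) simp
    show "\<forall>\<^sub>F x in at_left z. C + F x = w x"
      using eventually_at_left_real[OF ab(2)] by eventually_elim (use ab in \<open>auto simp: w_def\<close>)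
  qed
  have w_right: "(w \<longlongrightarrow> C + F z + P z * m) (at_right z)"
  proof (rule Lim_transform_eventually)
    show "((\<lambda>x. C + F x + P z * m) \<longlongrightarrow> C + F z + P z * m) (at_right z)"
      by (intro tendsto_intros tendsto_within_subset[OF F_lim]) simp
    show "\<forall>\<^sub>F x in at_right z. C + F x + P z * m = w x"
      using eventually_at_right_real[OF ab(3)] by eventually_elim (use ab in \<open>auto simp: w_def\<close>)
  qed
  \<comment> \<open>(b): the one-sided limits at \<open>z\<close> differ by the jump \<open>P z * m\<close>\<close>
  have partB: "C + F z > C + F z + P z * m"
    if pos: "\<forall>x\<in>?I - {z}. integral_to h z x > 0"
      and x12: "x1 \<in> {a<..<z}" "x2 \<in> {z<..<b}"
      and f1: "(\<integral>\<^sup>+x\<in>{x1<..<z}. ennreal (integral_to h z x powr (- 1/2)) \<partial>lebesgue) < \<infinity>"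
      and f2: "(\<integral>\<^sup>+x\<in>{z<..<x2}. ennreal (integral_to h z x powr (- 1/2)) \<partial>lebesgue) < \<infinity>"
      and le: "(LINT x:{x1<..<x2}|lebesgue. integral_to h z x powr (- 1/2)) \<le> w x1 - w x2" for x1 x2
  proof (rule ccontr)
    assume "\<not> C + F z > C + F z + P z * m"
    then have nonneg: "P z * m \<ge> 0" by simp
    have "m = 0"
    proof (rule ccontr)
      assume m0: "m \<noteq> 0"
      then have "P z = -1" using m(2) at_z by (auto simp: abs_if split: if_splits)
      then show False using nonneg m(1) m0 by simp
    qed
    let ?k = "\<lambda>x. integral_to h z x powr (- 1/2)"
    let ?X = "{x1<..<x2}"
    have XI: "?X \<subseteq> ?I" using x12 by auto
    have X_eq: "integral_to h z x = P x - P z" if "x \<in> ?X" for x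
      using integral_to[of x] that XI IO by blast
    have k_meas: "(\<lambda>x. indicator ?X x * ?k x) \<in> borel_measurable lebesgue"
    proof -
      have "(\<lambda>x. indicator ?X x *\<^sub>R P x) \<in> borel_measurable borel"
        by (rule borel_measurable_continuous_on_indicator) (use XI cont in \<open>auto intro: continuous_on_subset\<close>)
      then have "(\<lambda>x. indicator ?X x * (indicator ?X x *\<^sub>R P x - P z) powr (- 1/2)) \<in> borel_measurable borel"
        by measurable
      moreover have "(\<lambda>x. indicator ?X x * (indicator ?X x *\<^sub>R P x - P z) powr (- 1/2)) = (\<lambda>x. indicator ?X x * ?k x)"
        using X_eq by (auto simp: indicator_def fun_eq_iff)
      ultimately show ?thesis by (simp add: measurable_completion)
    qed
    have k_int: "integrable lebesgue (\<lambda>x. indicator ?X x * ?k x)"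
    proof (rule integrableI_bounded[OF k_meas])
      have part: "(\<lambda>x. ennreal (?k x) * indicator A x) \<in> borel_measurable lebesgue"
        if A: "A \<subseteq> ?X" "A \<in> sets borel" for A
      proof -
        have "(\<lambda>x. indicator A x * (indicator ?X x * ?k x)) \<in> borel_measurable lebesgue"
          by (rule borel_measurable_times[OF borel_measurable_indicator k_meas])
             (use A(2) in \<open>simp add: sets_completionI_sets\<close>)
        then have "(\<lambda>x. ennreal (indicator A x * (indicator ?X x * ?k x))) \<in> borel_measurable lebesgue" by measurable
        moreover have "(\<lambda>x. ennreal (indicator A x * (indicator ?X x * ?k x))) = (\<lambda>x. ennreal (?k x) * indicator A x)"
          using A(1) by (auto simp: indicator_def fun_eq_iff)
        ultimately show ?thesis by (simp only:)
      qed
      have "AE x in lebesgue. x \<noteq> z" by (rule AE_completion[OF AE_lborel_singleton])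
      then have "(\<integral>\<^sup>+x. ennreal (norm (indicator ?X x * ?k x)) \<partial>lebesgue)
        = (\<integral>\<^sup>+x. ennreal (?k x) * indicator {x1<..<z} x + ennreal (?k x) * indicator {z<..<x2} x \<partial>lebesgue)"
        by (intro nn_integral_cong_AE, eventually_elim) (use x12 in \<open>auto simp: indicator_def\<close>)
      also have "\<dots> = (\<integral>\<^sup>+x\<in>{x1<..<z}. ennreal (?k x) \<partial>lebesgue) + (\<integral>\<^sup>+x\<in>{z<..<x2}. ennreal (?k x) \<partial>lebesgue)"
        by (rule nn_integral_add; rule part) (use x12 in auto)
      also have "\<dots> < \<infinity>" using f1 f2 by (simp add: less_top)
      finally show "(\<integral>\<^sup>+x. ennreal (norm (indicator ?X x * ?k x)) \<partial>lebesgue) < \<infinity>" .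
    qed
    have G_X: "G absolutely_integrable_on ?X" by (rule set_integrable_subset[OF G_abs]) (use XI IO in auto)
    then have G_int': "integrable lebesgue (\<lambda>x. indicator ?X x * G x)" by (simp add: set_integrable_def)
    have "w x1 - w x2 = - (F x2 - F x1)" using x12 by (simp add: w_def \<open>m = 0\<close>)
    also have "\<dots> = - (LINT x:?X|lebesgue. G x)"
      using F_diff[of x1 x2] x12 ab by (simp add: set_lebesgue_integral_Ioo_eq_integral[OF G_X])
    finally have "(LINT x|lebesgue. indicator ?X x * ?k x) + (LINT x|lebesgue. indicator ?X x * G x) \<le> 0"
      using le by (simp add: set_lebesgue_integral_def)
    then have int_le: "(LINT x|lebesgue. indicator ?X x * ?k x + indicator ?X x * G x) \<le> 0"
      using k_int G_int' by simp
    \<comment> \<open>a nonnegative function with nonpositive integral vanishes, but this one is positive off \<open>z\<close>\<close>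
    have less: "0 < ?k x + G x" if x: "x \<in> ?X" "x \<noteq> z" for x
    proof -
      have xI: "x \<in> ?I - {z}" using x XI by auto
      have e: "integral_to h z x = P x - P z" by (rule X_eq[OF x(1)])
      have "P z < P x" using pos[rule_format, OF xI] e by simp
      then have "- (P x / sqrt (1 - (P x)\<^sup>2)) < (P x - P z) powr (- 1/2)"
        using strict[OF xI] at_z by (intro neg_gradient_less) (auto simp: abs_less_iff)
      then show ?thesis by (simp add: e G_def)
    qed
    have nn: "AE x in lebesgue. 0 \<le> indicator ?X x * ?k x + indicator ?X x * G x"
      using AE_completion[OF AE_lborel_singleton[of z]]
      by eventually_elim (use less in \<open>force simp: indicator_def\<close>)
    then have "(LINT x|lebesgue. indicator ?X x * ?k x + indicator ?X x * G x) = 0"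
      using int_le integral_nonneg_AE[OF nn] by simp
    then have "AE x in lebesgue. indicator ?X x * ?k x + indicator ?X x * G x = 0"
      using integral_nonneg_eq_0_iff_AE[OF Bochner_Integration.integrable_add[OF k_int G_int'] nn] by simp
    then have "AE x in lebesgue. x \<in> ?O \<longrightarrow> indicator ?X x * ?k x + indicator ?X x * G x = 0"
      by eventually_elim simp
    then have "AE x in unit_lborel. indicator ?X x * ?k x + indicator ?X x * G x = 0" unfolding AE_lebesgue_unit .
    then obtain x where "x1 < x" "x < z" "indicator ?X x * ?k x + indicator ?X x * G x = 0"
      by (rule AE_unit_ex_between[of _ x1 z]) (use x12 ab in auto)
    then show False using less[of x] x12 by simp
  qed
  have "\<exists>w u_left u_right.
        continuous_representative u a z b w \<and>
        (w \<longlongrightarrow> u_left) (at_left z) \<and> (w \<longlongrightarrow> u_right) (at_right z) \<and>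
        ((\<forall>x\<in>?I - {z}. integral_to h z x > 0) \<and>
         (\<exists>x1\<in>{a<..<z}. \<exists>x2\<in>{z<..<b}.
            (\<integral>\<^sup>+x\<in>{x1<..<z}. ennreal (integral_to h z x powr (- 1/2)) \<partial>lebesgue) < \<infinity> \<and>
            (\<integral>\<^sup>+x\<in>{z<..<x2}. ennreal (integral_to h z x powr (- 1/2)) \<partial>lebesgue) < \<infinity> \<and>
            (LINT x:{x1<..<x2}|lebesgue. integral_to h z x powr (- 1/2)) \<le> w x1 - w x2)
          \<longrightarrow> u_left > u_right)"
    using w_rep w_left w_right partB by blast
  then show ?thesis using partA unfolding a_def b_def by blast
qed

end
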